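(* Let $\Bbbk$ be a unital commutative ring, let $\Omega(\mathsf{E})$ be the cobar construction on the exponential species $\mathsf{E}$, and let $\mathsf{E}^!=H^0(\Omega(\mathsf{E}))$ be its Koszul dual algebra. Then the projection $\Omega(\mathsf{E})\longrightarrow \mathsf{E}^!$ is a quasi-isomorphism of algebras in species; that is, it is a morphism of differential graded algebras in species (with $\mathsf{E}^!$ placed in degree $0$ of the grading described in the context and with zero differential) and for every finite set $I$ the induced map $H^*(\Omega(\mathsf{E})[I])\to \mathsf{E}^![I]$ is an isomorphism.
   Context: A (linear) species is a functor from the category of finite sets and bijections to $\Bbbk$-modules. The Cauchy product of species is $(\mathsf{X}\cdot\mathsf{Y})[I]=\bigoplus \mathsf{X}[S]\otimes\mathsf{Y}[T]$, the sum over ordered pairs $(S,T)$ of disjoint, possibly empty, subsets of $I$ with union $I$; an algebra in species is an associative unital algebra for this product. The exponential species $\mathsf{E}$ has $\mathsf{E}[I]=\Bbbk e_I$, with coproduct components $\mathsf{E}[I]\to\mathsf{E}[S]\otimes\mathsf{E}[T]$, $e_I\mapsto e_S\otimes e_T$. A composition of $I$ with $q$ blocks is a tuple $(F_1,\ldots,F_q)$ of nonempty pairwise disjoint subsets of $I$ with union $I$ (the empty set has exactly one composition, with $q=0$). Explicitly, $\Omega(\mathsf{E})[I]$ is the free $\Bbbk$-module with basis the compositions of $I$; its differential is $$d(F_1,\ldots,F_q)=\sum_{i=1}^q(-1)^i\sum_{(A,B)}(F_1,\ldots,F_{i-1},A,B,F_{i+1},\ldots,F_q),$$ the inner sum over ordered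 pairs of disjoint nonempty sets with $A\cup B=F_i$; its product is concatenation of compositions $\Omega(\mathsf{E})[S]\otimes\Omega(\mathsf{E})[T]\to\Omega(\mathsf{E})[I]$. The composition $(F_1,\ldots,F_q)$ is placed in degree $q-\sum_i|F_i|=q-|I|\le 0$, so that $d$ raises the degree by one and $H^0(\Omega(\mathsf{E}))$ is a quotient algebra of $\Omega(\mathsf{E})$; the projection in the claim is zero on components of negative degree and is the quotient map in degree $0$. *)

theory Defs
  imports "HOL-Algebra.Module" "HOL-Algebra.QuotRing"
begin

section \<open>Modules over a commutative ring\<close>

definition linear_maps ::
    "('k, 'z) ring_scheme \<Rightarrow> ('k, 'm, 'c) module_scheme \<Rightarrow> ('k, 'n, 'd) module_scheme \<Rightarrow> ('m \<Rightarrow> 'n) set"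
  where "linear_maps R M N =
    {f. f \<in> carrier M \<rightarrow> carrier N \<and>
        (\<forall>x \<in> carrier M. \<forall>y \<in> carrier M. f (x \<oplus>\<^bsub>M\<^esub> y) = f x \<oplus>\<^bsub>N\<^esub> f y) \<and>
        (\<forall>r \<in> carrier R. \<forall>x \<in> carrier M. f (r \<odot>\<^bsub>M\<^esub> x) = r \<odot>\<^bsub>N\<^esub> f x)}"

definition linear_isos ::
    "('k, 'z) ring_scheme \<Rightarrow> ('k, 'm, 'c) module_scheme \<Rightarrow> ('k, 'n, 'd) module_scheme \<Rightarrow> ('m \<Rightarrow> 'n) set"
  where "linear_isos R M N = {f \<in> linear_maps R M N. bij_betw f (carrier M) (carrier N)}"

text \<open>
  The fields \<^const>\<open>monoid.mult\<close> and \<^const>\<open>one\<close> of a module record play no role for modules.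
  Quotients consist of cosets, with operations given on representatives as in \<^const>\<open>FactRing\<close>.
\<close>

definition quotient_module :: "('k, 'm, 'c) module_scheme \<Rightarrow> 'm set \<Rightarrow> ('k, 'm set) module"
  where "quotient_module M B =
    \<lparr>carrier = a_rcosets\<^bsub>M\<^esub> B, monoid.mult = undefined, one = undefined,
     zero = B, add = set_add M,
     smult = (\<lambda>r A. \<Union>a\<in>A. B +>\<^bsub>M\<^esub> (r \<odot>\<^bsub>M\<^esub> a))\<rparr>"

text \<open>The free module with basis \<open>B\<close>: finitely supported functions on \<open>B\<close>, extended by zero.\<close>

definition free_module :: "('k, 'z) ring_scheme \<Rightarrow> 'b set \<Rightarrow> ('k, 'b \<Rightarrow> 'k) module"
  where "free_module R B =
    \<lparr>carrier = {f. (\<forall>b\<in>B. f b \<in> carrier R) \<and> (\<forall>b. b \<notin> B \<longrightarrow> f b = \<zero>\<^bsub>R\<^esub>) \<and>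
                   finite {b. f b \<noteq> \<zero>\<^bsub>R\<^esub>}},
     monoid.mult = undefined, one = undefined,
     zero = (\<lambda>b. \<zero>\<^bsub>R\<^esub>), add = (\<lambda>f g b. f b \<oplus>\<^bsub>R\<^esub> g b),
     smult = (\<lambda>r f b. r \<otimes>\<^bsub>R\<^esub> f b)\<rparr>"

definition basis_vector :: "('k, 'z) ring_scheme \<Rightarrow> 'b \<Rightarrow> 'b \<Rightarrow> 'k"
  where "basis_vector R b = (\<lambda>c. if c = b then \<one>\<^bsub>R\<^esub> else \<zero>\<^bsub>R\<^esub>)"

text \<open>Linear extension to the free module on a finite set \<open>B\<close> of a map given on the basis.\<close>

definition linear_extension :: "'b set \<Rightarrow> ('k, 'm, 'c) module_scheme \<Rightarrow> ('b \<Rightarrow> 'm) \<Rightarrow> ('b \<Rightarrow> 'k) \<Rightarrow> 'm"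
  where "linear_extension B M \<phi> f = (\<Oplus>\<^bsub>M\<^esub>b\<in>B. f b \<odot>\<^bsub>M\<^esub> \<phi> b)"

definition power_of_minus_one :: "('k, 'z) ring_scheme \<Rightarrow> int \<Rightarrow> 'k"
  where "power_of_minus_one R n = (if even n then \<one>\<^bsub>R\<^esub> else \<ominus>\<^bsub>R\<^esub> \<one>\<^bsub>R\<^esub>)"


section \<open>Differential graded algebras in species\<close>

text \<open>
  Species are considered on the finite subsets of an arbitrary type \<open>'a\<close>.
  A bijection with domain \<open>I\<close> is a function \<open>\<sigma> :: 'a \<Rightarrow> 'a\<close> injective on \<open>I\<close>; its codomain
  is \<open>\<sigma> ` I\<close>, and only its values on \<open>I\<close> matter.
  A differential graded species is given by its homogeneous components:
  \<open>component X I n\<close> is the degree-\<open>n\<close> part of \<open>X[I]\<close>, \<open>transport X \<sigma> I n\<close> is the degree-\<open>n\<close> part of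
  \<open>X[\<sigma>]\<close>, and \<open>differential X I n\<close> is the differential starting in degree \<open>n\<close>.
  Linear maps \<open>X[S] \<otimes> X[T] \<rightarrow> X[S \<union> T]\<close> are given as bilinear maps
  \<open>product X S T m n\<close> on the parts of degrees \<open>m\<close> and \<open>n\<close>.  The unit is a morphism
  from the species that is the ground ring on the empty set and zero elsewhere, that is,
  an element of \<open>X[{}]\<close>.
\<close>

record ('a, 'k, 'm) dg_species_alg =
  component :: "'a set \<Rightarrow> int \<Rightarrow> ('k, 'm) module"
  transport :: "('a \<Rightarrow> 'a) \<Rightarrow> 'a set \<Rightarrow> int \<Rightarrow> 'm \<Rightarrow> 'm"
  differential :: "'a set \<Rightarrow> int \<Rightarrow> 'm \<Rightarrow> 'm"
  product :: "'a set \<Rightarrow> 'a set \<Rightarrow> int \<Rightarrow> int \<Rightarrow> 'm \<Rightarrow> 'm \<Rightarrow> 'm"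
  unit_element :: "'m"

text \<open>
  Degrees are normalised by subtracting the cardinality of the underlying set: the cobar
  construction is naturally graded by the number \<open>q\<close> of blocks, and \<open>n = q - |I|\<close>.
  The Koszul sign in the Leibniz rule is the one of the cobar construction, so that an
  element of \<open>X[S]\<close> of normalised degree \<open>m\<close> has parity \<open>m + |S|\<close>.  (With the differential
  of the cobar construction, concatenation does not satisfy the rule with sign \<open>(-1)^m\<close>.)
\<close>

locale dg_algebra_in_species = R?: cring R
  for R :: "('k, 'z) ring_scheme" (structure) and X :: "('a, 'k, 'm) dg_species_alg" +
  assumes module_comp: "finite I \<Longrightarrow> module R (component X I n)"
    and transport_linear:
      "\<lbrakk>finite I; inj_on \<sigma> I\<rbrakk>
        \<Longrightarrow> transport X \<sigma> I n \<in> linear_maps R (component X I n) (component X (\<sigma> ` I) n)"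
    and transport_cong:
      "\<lbrakk>finite I; inj_on \<sigma> I; \<And>i. i \<in> I \<Longrightarrow> \<sigma> i = \<tau> i; x \<in> carrier (component X I n)\<rbrakk>
        \<Longrightarrow> transport X \<sigma> I n x = transport X \<tau> I n x"
    and transport_id:
      "\<lbrakk>finite I; x \<in> carrier (component X I n)\<rbrakk> \<Longrightarrow> transport X id I n x = x"
    and transport_comp:
      "\<lbrakk>finite I; inj_on \<sigma> I; inj_on \<tau> (\<sigma> ` I); x \<in> carrier (component X I n)\<rbrakk>
        \<Longrightarrow> transport X (\<tau> \<circ> \<sigma>) I n x = transport X \<tau> (\<sigma> ` I) n (transport X \<sigma> I n x)"
    and diff_linear:
      "finite I \<Longrightarrow> differential X I n \<in> linear_maps R (component X I n) (component X I (n + 1))"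
    and diff_natural:
      "\<lbrakk>finite I; inj_on \<sigma> I; x \<in> carrier (component X I n)\<rbrakk>
        \<Longrightarrow> differential X (\<sigma> ` I) n (transport X \<sigma> I n x) = transport X \<sigma> I (n + 1) (differential X I n x)"
    and diff_diff:
      "\<lbrakk>finite I; x \<in> carrier (component X I n)\<rbrakk>
        \<Longrightarrow> differential X I (n + 1) (differential X I n x) = \<zero>\<^bsub>component X I (n + 1 + 1)\<^esub>"
    and prod_linear_left:
      "\<lbrakk>finite S; finite T; S \<inter> T = {}; y \<in> carrier (component X T n)\<rbrakk>
        \<Longrightarrow> (\<lambda>x. product X S T m n x y) \<in> linear_maps R (component X S m) (component X (S \<union> T) (m + n))"
    and prod_linear_right:
      "\<lbrakk>finite S; finite T; S \<inter> T = {}; x \<in> carrier (component X S m)\<rbrakk>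
        \<Longrightarrow> (\<lambda>y. product X S T m n x y) \<in> linear_maps R (component X T n) (component X (S \<union> T) (m + n))"
    and prod_natural:
      "\<lbrakk>finite S; finite T; S \<inter> T = {}; inj_on \<sigma> (S \<union> T);
        x \<in> carrier (component X S m); y \<in> carrier (component X T n)\<rbrakk>
        \<Longrightarrow> transport X \<sigma> (S \<union> T) (m + n) (product X S T m n x y)
           = product X (\<sigma> ` S) (\<sigma> ` T) m n (transport X \<sigma> S m x) (transport X \<sigma> T n y)"
    and prod_assoc:
      "\<lbrakk>finite S; finite T; finite U; S \<inter> T = {}; S \<inter> U = {}; T \<inter> U = {};
        x \<in> carrier (component X S m); y \<in> carrier (component X T n); z \<in> carrier (component X U p)\<rbrakk>
        \<Longrightarrow> product X (S \<union> T) U (m + n) p (product X S T m n x y) z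
           = product X S (T \<union> U) m (n + p) x (product X T U n p y z)"
    and unit_closed: "unit_element X \<in> carrier (component X {} 0)"
    and diff_unit: "differential X {} 0 (unit_element X) = \<zero>\<^bsub>component X {} 1\<^esub>"
    and unit_left:
      "\<lbrakk>finite I; x \<in> carrier (component X I n)\<rbrakk> \<Longrightarrow> product X {} I 0 n (unit_element X) x = x"
    and unit_right:
      "\<lbrakk>finite I; x \<in> carrier (component X I n)\<rbrakk> \<Longrightarrow> product X I {} n 0 x (unit_element X) = x"
    and leibniz:
      "\<lbrakk>finite S; finite T; S \<inter> T = {};
        x \<in> carrier (component X S m); y \<in> carrier (component X T n)\<rbrakk>
        \<Longrightarrow> differential X (S \<union> T) (m + n) (product X S T m n x y)
           = product X S T (m + 1) n (differential X S m x) y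
             \<oplus>\<^bsub>component X (S \<union> T) (m + n + 1)\<^esub>
             power_of_minus_one R (m + int (card S)) \<odot>\<^bsub>component X (S \<union> T) (m + n + 1)\<^esub>
               product X S T m (n + 1) x (differential X T n y)"

locale dg_algebra_morphism =
  X?: dg_algebra_in_species R X + Y?: dg_algebra_in_species R Y
  for R :: "('k, 'z) ring_scheme" (structure)
    and X :: "('a, 'k, 'm) dg_species_alg" and Y :: "('a, 'k, 'n) dg_species_alg" +
  fixes f :: "'a set \<Rightarrow> int \<Rightarrow> 'm \<Rightarrow> 'n"
  assumes morphism_linear:
      "finite I \<Longrightarrow> f I n \<in> linear_maps R (component X I n) (component Y I n)"
    and morphism_natural:
      "\<lbrakk>finite I; inj_on \<sigma> I; x \<in> carrier (component X I n)\<rbrakk>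
        \<Longrightarrow> f (\<sigma> ` I) n (transport X \<sigma> I n x) = transport Y \<sigma> I n (f I n x)"
    and morphism_diff:
      "\<lbrakk>finite I; x \<in> carrier (component X I n)\<rbrakk>
        \<Longrightarrow> f I (n + 1) (differential X I n x) = differential Y I n (f I n x)"
    and morphism_prod:
      "\<lbrakk>finite S; finite T; S \<inter> T = {};
        x \<in> carrier (component X S m); y \<in> carrier (component X T n)\<rbrakk>
        \<Longrightarrow> f (S \<union> T) (m + n) (product X S T m n x y) = product Y S T m n (f S m x) (f T n y)"
    and morphism_unit: "f {} 0 (unit_element X) = unit_element Y"


section \<open>Cohomology and quasi-isomorphisms\<close>

definition cocycles :: "('a, 'k, 'm) dg_species_alg \<Rightarrow> 'a set \<Rightarrow> int \<Rightarrow> 'm set"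
  where "cocycles X I n = {x \<in> carrier (component X I n). differential X I n x = \<zero>\<^bsub>component X I (n + 1)\<^esub>}"

definition coboundaries :: "('a, 'k, 'm) dg_species_alg \<Rightarrow> 'a set \<Rightarrow> int \<Rightarrow> 'm set"
  where "coboundaries X I n = differential X I (n - 1) ` carrier (component X I (n - 1))"

definition cohomology :: "('a, 'k, 'm) dg_species_alg \<Rightarrow> 'a set \<Rightarrow> int \<Rightarrow> ('k, 'm set) module"
  where "cohomology X I n =
    quotient_module ((component X I n)\<lparr>carrier := cocycles X I n\<rparr>) (coboundaries X I n)"

text \<open>
  Maps on cohomology send the class of \<open>x\<close> to the class of its image; as in
  \<^const>\<open>rcoset_mult\<close>, this is written as a union over all representatives \<open>x\<close>.
\<close>

definition cohomology_map ::
    "('a, 'k, 'n) dg_species_alg \<Rightarrow> ('a set \<Rightarrow> int \<Rightarrow> 'm \<Rightarrow> 'n) \<Rightarrow> 'a set \<Rightarrow> int \<Rightarrow> 'm set \<Rightarrow> 'n set"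
  where "cohomology_map Y f I n A = (\<Union>x\<in>A. coboundaries Y I n +>\<^bsub>component Y I n\<^esub> f I n x)"

locale dg_algebra_quasi_iso = dg_algebra_morphism +
  assumes cohomology_iso:
    "finite I \<Longrightarrow>
      cohomology_map Y f I n \<in> linear_isos R (cohomology X I n) (cohomology Y I n)"


section \<open>Algebras in species without grading\<close>

record ('a, 'k, 'm) species_alg =
  scomp :: "'a set \<Rightarrow> ('k, 'm) module"
  stransport :: "('a \<Rightarrow> 'a) \<Rightarrow> 'a set \<Rightarrow> 'm \<Rightarrow> 'm"
  sprod :: "'a set \<Rightarrow> 'a set \<Rightarrow> 'm \<Rightarrow> 'm \<Rightarrow> 'm"
  sunit :: "'m"

definition in_degree_zero :: "('a, 'k, 'm) species_alg \<Rightarrow> ('a, 'k, 'm) dg_species_alg"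
  where "in_degree_zero A =
    \<lparr>component = (\<lambda>I n. if n = 0 then scomp A I else (scomp A I)\<lparr>carrier := {\<zero>\<^bsub>scomp A I\<^esub>}\<rparr>),
     transport = (\<lambda>\<sigma> I n x. if n = 0 then stransport A \<sigma> I x else \<zero>\<^bsub>scomp A (\<sigma> ` I)\<^esub>),
     differential = (\<lambda>I n x. \<zero>\<^bsub>scomp A I\<^esub>),
     product = (\<lambda>S T m n x y. if m = 0 \<and> n = 0 then sprod A S T x y else \<zero>\<^bsub>scomp A (S \<union> T)\<^esub>),
     unit_element = sunit A\<rparr>"

definition H0_algebra :: "('a, 'k, 'm) dg_species_alg \<Rightarrow> ('a, 'k, 'm set) species_alg"
  where "H0_algebra X =
    \<lparr>scomp = (\<lambda>I. cohomology X I 0),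
     stransport = (\<lambda>\<sigma> I A. \<Union>x\<in>A.
       coboundaries X (\<sigma> ` I) 0 +>\<^bsub>component X (\<sigma> ` I) 0\<^esub> transport X \<sigma> I 0 x),
     sprod = (\<lambda>S T A B. \<Union>x\<in>A. \<Union>y\<in>B.
       coboundaries X (S \<union> T) 0 +>\<^bsub>component X (S \<union> T) 0\<^esub> product X S T 0 0 x y),
     sunit = coboundaries X {} 0 +>\<^bsub>component X {} 0\<^esub> unit_element X\<rparr>"


section \<open>The cobar construction on the exponential species and its Koszul dual\<close>

definition set_composition :: "'a set \<Rightarrow> 'a set list \<Rightarrow> bool"
  where "set_composition I F \<longleftrightarrow>
    {} \<notin> set F \<and> \<Union>(set F) = I \<and>
    (\<forall>i < length F. \<forall>j < length F. i \<noteq> j \<longrightarrow> F ! i \<inter> F ! j = {})"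

definition compositions :: "'a set \<Rightarrow> int \<Rightarrow> 'a set list set"
  where "compositions I n = {F. set_composition I F \<and> int (length F) - int (card I) = n}"

definition cobar_comp :: "('k, 'z) ring_scheme \<Rightarrow> 'a set \<Rightarrow> int \<Rightarrow> ('k, 'a set list \<Rightarrow> 'k) module"
  where "cobar_comp R I n = free_module R (compositions I n)"

definition splittings :: "'a set \<Rightarrow> ('a set \<times> 'a set) set"
  where "splittings C = {(A, B). A \<noteq> {} \<and> B \<noteq> {} \<and> A \<inter> B = {} \<and> A \<union> B = C}"

text \<open>The blocks are numbered from 0 here, so that block \<open>i\<close> contributes with sign \<open>(-1)^(i + 1)\<close>.\<close>

definition cobar_diff_basis ::
    "('k, 'z) ring_scheme \<Rightarrow> 'a set \<Rightarrow> int \<Rightarrow> 'a set list \<Rightarrow> ('a set list \<Rightarrow> 'k)"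
  where "cobar_diff_basis R I n F =
    (\<Oplus>\<^bsub>cobar_comp R I (n + 1)\<^esub>i\<in>{..<length F}.
       power_of_minus_one R (int i + 1) \<odot>\<^bsub>cobar_comp R I (n + 1)\<^esub>
         (\<Oplus>\<^bsub>cobar_comp R I (n + 1)\<^esub>P\<in>splittings (F ! i).
            basis_vector R (take i F @ [fst P, snd P] @ drop (Suc i) F)))"

definition cobar_E :: "('k, 'z) ring_scheme \<Rightarrow> ('a, 'k, 'a set list \<Rightarrow> 'k) dg_species_alg"
  where "cobar_E R =
    \<lparr>component = cobar_comp R,
     transport = (\<lambda>\<sigma> I n. linear_extension (compositions I n) (cobar_comp R (\<sigma> ` I) n)
       (\<lambda>F. basis_vector R (map ((`) \<sigma>) F))),
     differential = (\<lambda>I n. linear_extension (compositions I n) (cobar_comp R I (n + 1))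
       (cobar_diff_basis R I n)),
     product = (\<lambda>S T m n f g.
       linear_extension (compositions S m) (cobar_comp R (S \<union> T) (m + n))
         (\<lambda>F. linear_extension (compositions T n) (cobar_comp R (S \<union> T) (m + n))
           (\<lambda>G. basis_vector R (F @ G)) g) f),
     unit_element = basis_vector R []\<rparr>"

definition koszul_dual_E ::
    "('k, 'z) ring_scheme \<Rightarrow> ('a, 'k, ('a set list \<Rightarrow> 'k) set) species_alg"
  where "koszul_dual_E R = H0_algebra (cobar_E R)"

text \<open>
  Every element of degree 0 is a cocycle, there being no compositions of positive degree,
  so the projection in degree 0 is defined on the whole component.
\<close>

definition cobar_projection ::
    "('k, 'z) ring_scheme \<Rightarrow> 'a set \<Rightarrow> int \<Rightarrow> ('a set list \<Rightarrow> 'k) \<Rightarrow> ('a set list \<Rightarrow> 'k) set"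
  where "cobar_projection R I n x =
    (if n = 0 then coboundaries (cobar_E R) I 0 +>\<^bsub>cobar_comp R I 0\<^esub> x
     else \<zero>\<^bsub>scomp (koszul_dual_E R) I\<^esub>)"

end

theory Submission
  imports Defs
begin

text \<open>
  Two facts carry the theorem.

  The first is formal.  If a differential graded algebra \<open>X\<close> in species has no elements of positive
  degree and every cocycle of negative degree is a coboundary, then its projection to \<open>H\<^sup>0(X)\<close>
  is a quasi-isomorphism: outside degree 0 both cohomologies vanish, and in degree 0 the map induced on
  cohomology sends a class \<open>A\<close> to the singleton coset \<open>{A}\<close> (\<open>H0_projection_quasi_iso\<close>).
  The Leibniz rule makes the product of a cocycle and a coboundary a coboundary, which is
  what turns \<open>H\<^sup>0(X)\<close> into an algebra (\<open>algebra_H0\<close>).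

  The second is the exactness of \<open>\<Omega>(E)[I]\<close> in negative degrees (\<open>cobar_exact\<close>), by induction on
  \<open>I\<close>.  Let \<open>a \<notin> I\<close>.  A composition of \<open>I \<union> {a}\<close> consists of a composition \<open>G\<close> of \<open>I\<close> and a place
  for \<open>a\<close>: either \<open>{a}\<close> is a block of its own in one of the gaps before, between and after the blocks
  of \<open>G\<close>, or \<open>a\<close> joins one of these blocks.  For fixed \<open>G\<close> the places form a path, with the gaps as
  vertices and the blocks as edges: splitting \<open>a\<close> off from its block produces, up to sign, the two
  neighbouring gaps.  A path is contractible, so everything can be moved to the first gap: there are a
  map \<open>p\<close> from \<open>\<Omega>(E)[I \<union> {a}]\<close> to \<open>\<Omega>(E)[I]\<close> that forgets a singleton block \<open>{a}\<close> with a sign, a map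
  \<open>s\<close> back that puts \<open>{a}\<close> in front, and a map \<open>h\<close> lowering the degree by one with
  \<open>d h + h d = 1 - s p\<close> (\<open>extract_sum_homotopy\<close>).  Both \<open>p\<close> and \<open>s\<close> preserve the degree and anticommute with
  \<open>d\<close>.  If \<open>f\<close> is a cocycle of negative degree, then \<open>p f\<close> is a cocycle of the same degree, hence
  \<open>p f = d q\<close> by induction, and \<open>f = d (h f) + s (d q) = d (h f - s q)\<close>.

  An element of \<open>\<Omega>(E)[I]\<close> is a coefficient function on lists of blocks, and it is convenient to
  describe the maps by their effect on coefficients: the coefficient of \<open>d f\<close> at a composition is a
  signed sum of the values of \<open>f\<close> at the results of merging two adjacent blocks
  (\<open>cobar_differential_eq\<close>).  In this form \<open>d\<close>, \<open>p\<close> and \<open>h\<close> are defined by recursion on lists, and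
  their relations, \<open>d d = 0\<close> among them, follow by induction on lists.  The other algebra axioms state that
  linear or multilinear maps agree, so it is enough to check them on basis elements, where transport
  relabels a composition and the product concatenates two compositions.
\<close>

section \<open>Linear maps\<close>

lemma linear_mapsI:
  assumes "\<And>x. x \<in> carrier M \<Longrightarrow> f x \<in> carrier N"
    and "\<And>x y. x \<in> carrier M \<Longrightarrow> y \<in> carrier M \<Longrightarrow> f (x \<oplus>\<^bsub>M\<^esub> y) = f x \<oplus>\<^bsub>N\<^esub> f y"
    and "\<And>r x. r \<in> carrier R \<Longrightarrow> x \<in> carrier M \<Longrightarrow> f (r \<odot>\<^bsub>M\<^esub> x) = r \<odot>\<^bsub>N\<^esub> f x"
  shows "f \<in> linear_maps R M N"
  using assms by (auto simp: linear_maps_def)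

lemma linear_mapsD:
  assumes "f \<in> linear_maps R M N"
  shows "x \<in> carrier M \<Longrightarrow> f x \<in> carrier N"
    and "x \<in> carrier M \<Longrightarrow> y \<in> carrier M \<Longrightarrow> f (x \<oplus>\<^bsub>M\<^esub> y) = f x \<oplus>\<^bsub>N\<^esub> f y"
    and "r \<in> carrier R \<Longrightarrow> x \<in> carrier M \<Longrightarrow> f (r \<odot>\<^bsub>M\<^esub> x) = r \<odot>\<^bsub>N\<^esub> f x"
  using assms by (auto simp: linear_maps_def)

lemma linear_maps_cong:
  assumes "module R M" "f \<in> linear_maps R M N" "\<And>x. x \<in> carrier M \<Longrightarrow> f x = g x"
  shows "g \<in> linear_maps R M N"
proof -
  interpret module R M by fact
  show ?thesis
  proof (rule linear_mapsI)
    fix x y assume "x \<in> carrier M" "y \<in> carrier M"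
    then show "g (x \<oplus>\<^bsub>M\<^esub> y) = g x \<oplus>\<^bsub>N\<^esub> g y" using linear_mapsD[OF assms(2)] assms(3) by (metis M.a_closed)
  qed (use linear_mapsD[OF assms(2)] assms(3) in \<open>metis smult_closed\<close>)+
qed

lemma linear_maps_id: "(\<lambda>x. x) \<in> linear_maps R M M"
  by (rule linear_mapsI) auto

lemma linear_maps_comp:
  "f \<in> linear_maps R M N \<Longrightarrow> g \<in> linear_maps R N P \<Longrightarrow> (\<lambda>x. g (f x)) \<in> linear_maps R M P"
  by (auto simp: linear_maps_def Pi_def)

lemma linear_maps_zero:
  assumes "module R M" "module R N" "f \<in> linear_maps R M N"
  shows "f \<zero>\<^bsub>M\<^esub> = \<zero>\<^bsub>N\<^esub>"
proof -
  interpret M: module R M by fact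
  interpret N: module R N by fact
  show ?thesis
    using linear_mapsD(3)[OF assms(3), of "\<zero>\<^bsub>R\<^esub>" "\<zero>\<^bsub>M\<^esub>"] linear_mapsD(1)[OF assms(3), of "\<zero>\<^bsub>M\<^esub>"]
    by simp
qed

lemma linear_maps_minus:
  assumes "module R M" "module R N" "f \<in> linear_maps R M N" "x \<in> carrier M"
  shows "f (\<ominus>\<^bsub>M\<^esub> x) = \<ominus>\<^bsub>N\<^esub> f x"
proof -
  interpret M: module R M by fact
  interpret N: module R N by fact
  have "f ((\<ominus>\<^bsub>R\<^esub> \<one>\<^bsub>R\<^esub>) \<odot>\<^bsub>M\<^esub> x) = (\<ominus>\<^bsub>R\<^esub> \<one>\<^bsub>R\<^esub>) \<odot>\<^bsub>N\<^esub> f x"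
    using linear_mapsD[OF assms(3)] assms(4) by simp
  then show ?thesis using linear_mapsD(1)[OF assms(3)] assms(4) by (simp add: M.smult_l_minus N.smult_l_minus)
qed

lemma linear_maps_finsum:
  assumes "module R M" "module R N" "f \<in> linear_maps R M N" "\<phi> \<in> A \<rightarrow> carrier M" "finite A"
  shows "f (\<Oplus>\<^bsub>M\<^esub>a\<in>A. \<phi> a) = (\<Oplus>\<^bsub>N\<^esub>a\<in>A. f (\<phi> a))"
  using assms(5,4)
proof (induction A)
  interpret M: module R M by fact
  interpret N: module R N by fact
  {
    case empty
    show ?case using linear_maps_zero assms by simp
  next
    case (insert a A)
    then show ?case
      using linear_mapsD[OF assms(3)] by (simp add: Pi_iff)
  }
qed

lemma linear_maps_add:
  assumes "module R M" "module R N" "f \<in> linear_maps R M N" "g \<in> linear_maps R M N"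
  shows "(\<lambda>x. f x \<oplus>\<^bsub>N\<^esub> g x) \<in> linear_maps R M N"
proof -
  interpret M: module R M by fact
  interpret N: module R N by fact
  note f = linear_mapsD[OF assms(3)] and g = linear_mapsD[OF assms(4)]
  show ?thesis
    by (rule linear_mapsI) (simp_all add: f g N.smult_r_distr N.a_ac)
qed

lemma linear_maps_smult:
  assumes "module R M" "module R N" "f \<in> linear_maps R M N" "c \<in> carrier R"
  shows "(\<lambda>x. c \<odot>\<^bsub>N\<^esub> f x) \<in> linear_maps R M N"
proof -
  interpret M: module R M by fact
  interpret N: module R N by fact
  note f = linear_mapsD[OF assms(3)]
  show ?thesis
    by (rule linear_mapsI)
      (simp_all add: f assms(4) N.smult_r_distr M.R.m_comm flip: N.smult_assoc1)
qed

lemma linear_maps_sum: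
  assumes "module R M" "module R N" "finite A" "\<And>a. a \<in> A \<Longrightarrow> h a \<in> linear_maps R M N"
  shows "(\<lambda>x. \<Oplus>\<^bsub>N\<^esub>a\<in>A. h a x) \<in> linear_maps R M N"
  using assms(3,4)
proof (induction A)
  case empty
  interpret N: module R N by fact
  show ?case by (rule linear_mapsI) simp_all
next
  case (insert a A)
  interpret N: module R N by fact
  have "(\<lambda>x. h a x \<oplus>\<^bsub>N\<^esub> (\<Oplus>\<^bsub>N\<^esub>b\<in>A. h b x)) \<in> linear_maps R M N"
    using insert by (intro linear_maps_add assms(1,2)) auto
  then show ?case
  proof (rule linear_maps_cong[OF assms(1)])
    fix x assume "x \<in> carrier M"
    then have "h b x \<in> carrier N" if "b \<in> insert a A" for b
      using insert.prems[OF that] by (rule linear_mapsD(1)[rotated])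
    then show "h a x \<oplus>\<^bsub>N\<^esub> (\<Oplus>\<^bsub>N\<^esub>b\<in>A. h b x) = (\<Oplus>\<^bsub>N\<^esub>b\<in>insert a A. h b x)"
      using insert.hyps by (subst N.finsum_insert) auto
  qed
qed

section \<open>Free modules\<close>

lemma free_module_sel [simp]:
  "\<zero>\<^bsub>free_module R B\<^esub> = (\<lambda>b. \<zero>\<^bsub>R\<^esub>)"
  "f \<oplus>\<^bsub>free_module R B\<^esub> g = (\<lambda>b. f b \<oplus>\<^bsub>R\<^esub> g b)"
  "r \<odot>\<^bsub>free_module R B\<^esub> f = (\<lambda>b. r \<otimes>\<^bsub>R\<^esub> f b)"
  by (simp_all add: free_module_def)

lemma carrier_free_module:
  "finite B \<Longrightarrow> carrier (free_module R B) =
    {f. (\<forall>b\<in>B. f b \<in> carrier R) \<and> (\<forall>b. b \<notin> B \<longrightarrow> f b = \<zero>\<^bsub>R\<^esub>)}"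
  by (auto simp: free_module_def intro: rev_finite_subset)

lemma free_module_eqI:
  assumes "f \<in> carrier (free_module R B)" "g \<in> carrier (free_module R B)" "\<And>b. b \<in> B \<Longrightarrow> f b = g b"
  shows "f = g"
proof
  fix b show "f b = g b" using assms by (cases "b \<in> B") (auto simp: free_module_def)
qed

context cring
begin

lemma free_module_apply_closed:
  "f \<in> carrier (free_module R B) \<Longrightarrow> f b \<in> carrier R"
  by (cases "b \<in> B") (auto simp: free_module_def)

lemma module_free_module: "module R (free_module R B)"
proof -
  let ?M = "free_module R B"
  have fin: "finite {b. h b \<noteq> \<zero>}"
    if "finite {b. f b \<noteq> \<zero>}" "finite {b. g b \<noteq> \<zero>}" "\<And>b. f b = \<zero> \<Longrightarrow> g b = \<zero> \<Longrightarrow> h b = \<zero>"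
    for f g h :: "'x \<Rightarrow> 'a"
    by (rule finite_subset[of _ "{b. f b \<noteq> \<zero>} \<union> {b. g b \<noteq> \<zero>}"]) (use that in auto)
  have add: "f \<oplus>\<^bsub>?M\<^esub> g \<in> carrier ?M" if "f \<in> carrier ?M" "g \<in> carrier ?M" for f g
  proof -
    have "finite {b. f b \<oplus> g b \<noteq> \<zero>}"
      by (rule fin[of f g]) (use that in \<open>auto simp: free_module_def\<close>)
    then show ?thesis using that by (auto simp: free_module_def)
  qed
  have smult: "r \<odot>\<^bsub>?M\<^esub> f \<in> carrier ?M" if "r \<in> carrier R" "f \<in> carrier ?M" for r f
  proof -
    have "finite {b. r \<otimes> f b \<noteq> \<zero>}"
      by (rule fin[of f f]) (use that in \<open>auto simp: free_module_def\<close>)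
    then show ?thesis using that by (auto simp: free_module_def)
  qed
  have inv: "\<exists>g\<in>carrier ?M. g \<oplus>\<^bsub>?M\<^esub> f = \<zero>\<^bsub>?M\<^esub>" if "f \<in> carrier ?M" for f
  proof -
    have "finite {b. \<ominus> f b \<noteq> \<zero>}"
      by (rule fin[of f f]) (use that in \<open>auto simp: free_module_def\<close>)
    then have "(\<lambda>b. \<ominus> f b) \<in> carrier ?M" using that by (auto simp: free_module_def)
    then show ?thesis using free_module_apply_closed[OF that]
      by (intro bexI[of _ "\<lambda>b. \<ominus> f b"]) (auto simp: l_neg)
  qed
  have "abelian_group ?M"
    by (rule abelian_groupI) (use add inv in \<open>auto simp: fun_eq_iff a_ac free_module_apply_closed\<close>,
      simp add: free_module_def)
  then show ?thesis
    by (intro moduleI is_cring smult)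
      (auto simp: fun_eq_iff l_distr r_distr m_assoc free_module_apply_closed)
qed

lemma basis_vector_closed [simp, intro]: "b \<in> B \<Longrightarrow> basis_vector R b \<in> carrier (free_module R B)"
  by (auto simp: free_module_def basis_vector_def)

lemma finsum_free_module_apply:
  assumes "\<phi> \<in> A \<rightarrow> carrier (free_module R B)"
  shows "(\<Oplus>\<^bsub>free_module R B\<^esub>a\<in>A. \<phi> a) b = (\<Oplus>a\<in>A. \<phi> a b)"
proof -
  interpret M: module R "free_module R B" by (rule module_free_module)
  show ?thesis using assms
  proof (induction A rule: infinite_finite_induct)
    case (insert a A)
    then have "(\<lambda>x. \<phi> x b) \<in> A \<rightarrow> carrier R" "\<phi> a b \<in> carrier R" by (auto intro: free_module_apply_closed)
    then show ?case using insert by (simp add: Pi_iff)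
  qed auto
qed

text \<open>
  The expansion of an element in the basis; with it linear maps out of a free module are
  determined by their values on basis vectors.
\<close>

lemma free_module_expand:
  assumes "finite B" "f \<in> carrier (free_module R B)"
  shows "f = (\<Oplus>\<^bsub>free_module R B\<^esub>b\<in>B. f b \<odot>\<^bsub>free_module R B\<^esub> basis_vector R b)"
proof -
  interpret M: module R "free_module R B" by (rule module_free_module)
  note [simp] = free_module_apply_closed[OF assms(2)]
  have \<phi>: "(\<lambda>b. f b \<odot>\<^bsub>free_module R B\<^esub> basis_vector R b) \<in> B \<rightarrow> carrier (free_module R B)"
    by (intro Pi_I M.smult_closed) auto
  show ?thesis
  proof (rule free_module_eqI[OF assms(2)])
    fix c assume c: "c \<in> B"
    have "(\<Oplus>\<^bsub>free_module R B\<^esub>b\<in>B. f b \<odot>\<^bsub>free_module R B\<^esub> basis_vector R b) c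
       = (\<Oplus>b\<in>B. if c = b then f b else \<zero>)"
      using finsum_free_module_apply[OF \<phi>]
      by (auto simp: basis_vector_def intro!: finsum_cong')
    also have "\<dots> = f c" using c assms by (intro add.finprod_singleton) auto
    finally show "f c = (\<Oplus>\<^bsub>free_module R B\<^esub>b\<in>B. f b \<odot>\<^bsub>free_module R B\<^esub> basis_vector R b) c" ..
  qed (use \<phi> in simp)
qed

lemma linear_extension_linear:
  assumes "finite B" "module R M" "\<phi> \<in> B \<rightarrow> carrier M"
  shows "linear_extension B M \<phi> \<in> linear_maps R (free_module R B) M"
proof -
  interpret M: module R M by fact
  note [simp] = Pi_mem[OF assms(3)]
  show ?thesis
  proof (rule linear_mapsI)
    fix f assume "f \<in> carrier (free_module R B)"
    then show "linear_extension B M \<phi> f \<in> carrier M"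
      by (auto simp: linear_extension_def free_module_apply_closed intro!: M.finsum_closed)
  next
    fix f g assume "f \<in> carrier (free_module R B)" "g \<in> carrier (free_module R B)"
    note [simp] = this[THEN free_module_apply_closed]
    have "(\<Oplus>\<^bsub>M\<^esub>b\<in>B. f b \<odot>\<^bsub>M\<^esub> \<phi> b \<oplus>\<^bsub>M\<^esub> g b \<odot>\<^bsub>M\<^esub> \<phi> b) =
       (\<Oplus>\<^bsub>M\<^esub>b\<in>B. f b \<odot>\<^bsub>M\<^esub> \<phi> b) \<oplus>\<^bsub>M\<^esub> (\<Oplus>\<^bsub>M\<^esub>b\<in>B. g b \<odot>\<^bsub>M\<^esub> \<phi> b)"
      by (rule M.finsum_addf) auto
    moreover have "(\<Oplus>\<^bsub>M\<^esub>b\<in>B. (f b \<oplus> g b) \<odot>\<^bsub>M\<^esub> \<phi> b) =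
       (\<Oplus>\<^bsub>M\<^esub>b\<in>B. f b \<odot>\<^bsub>M\<^esub> \<phi> b \<oplus>\<^bsub>M\<^esub> g b \<odot>\<^bsub>M\<^esub> \<phi> b)"
      by (rule M.finsum_cong') (auto simp: M.smult_l_distr)
    ultimately show "linear_extension B M \<phi> (f \<oplus>\<^bsub>free_module R B\<^esub> g) =
        linear_extension B M \<phi> f \<oplus>\<^bsub>M\<^esub> linear_extension B M \<phi> g"
      by (simp add: linear_extension_def)
  next
    fix r f assume r: "r \<in> carrier R" and f: "f \<in> carrier (free_module R B)"
    note [simp] = r f[THEN free_module_apply_closed]
    have "(\<Oplus>\<^bsub>M\<^esub>b\<in>B. (r \<otimes> f b) \<odot>\<^bsub>M\<^esub> \<phi> b) = (\<Oplus>\<^bsub>M\<^esub>b\<in>B. r \<odot>\<^bsub>M\<^esub> (f b \<odot>\<^bsub>M\<^esub> \<phi> b))"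
      by (rule M.finsum_cong') (auto simp: M.smult_assoc1)
    then show "linear_extension B M \<phi> (r \<odot>\<^bsub>free_module R B\<^esub> f) = r \<odot>\<^bsub>M\<^esub> linear_extension B M \<phi> f"
      by (simp add: linear_extension_def M.finsum_smult_ldistr assms(1) Pi_iff)
  qed
qed

lemma linear_extension_unique:
  assumes "finite B" "module R M" "T \<in> linear_maps R (free_module R B) M"
    and "\<And>b. b \<in> B \<Longrightarrow> T (basis_vector R b) = \<phi> b"
    and "f \<in> carrier (free_module R B)"
  shows "T f = linear_extension B M \<phi> f"
proof -
  interpret F: module R "free_module R B" by (rule module_free_module)
  interpret M: module R M by fact
  note T = linear_mapsD[OF assms(3)]
  have "T f = T (\<Oplus>\<^bsub>free_module R B\<^esub>b\<in>B. f b \<odot>\<^bsub>free_module R B\<^esub> basis_vector R b)"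
    using free_module_expand[OF assms(1,5)] by simp
  also have "\<dots> = (\<Oplus>\<^bsub>M\<^esub>b\<in>B. T (f b \<odot>\<^bsub>free_module R B\<^esub> basis_vector R b))"
    using assms free_module_apply_closed[OF assms(5)]
    by (intro linear_maps_finsum[OF F.module_axioms]) (auto simp del: free_module_sel)
  also have "\<dots> = (\<Oplus>\<^bsub>M\<^esub>b\<in>B. f b \<odot>\<^bsub>M\<^esub> \<phi> b)"
    using assms(4) free_module_apply_closed[OF assms(5)] T(1)[OF basis_vector_closed]
    by (intro M.finsum_cong') (auto simp: T(3) simp del: free_module_sel)
  finally show ?thesis by (simp add: linear_extension_def)
qed

lemma linear_maps_eq_on_basis:
  assumes "finite B" "module R M"
    and "T \<in> linear_maps R (free_module R B) M" "T' \<in> linear_maps R (free_module R B) M"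
    and "\<And>b. b \<in> B \<Longrightarrow> T (basis_vector R b) = T' (basis_vector R b)"
    and "f \<in> carrier (free_module R B)"
  shows "T f = T' f"
  using linear_extension_unique[OF assms(1-3) _ assms(6), of "\<lambda>b. T' (basis_vector R b)"]
    linear_extension_unique[OF assms(1,2,4) _ assms(6), of "\<lambda>b. T' (basis_vector R b)"] assms(5)
  by simp

text \<open>
  One variable is reduced to basis vectors at a time, the other one being held fixed.
\<close>

lemma bilinear_eq_on_basis:
  assumes "finite B" "finite C" "module R M"
    and "\<And>y. y \<in> carrier (free_module R C) \<Longrightarrow> (\<lambda>x. T x y) \<in> linear_maps R (free_module R B) M"
    and "\<And>x. x \<in> carrier (free_module R B) \<Longrightarrow> (\<lambda>y. T x y) \<in> linear_maps R (free_module R C) M"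
    and "\<And>y. y \<in> carrier (free_module R C) \<Longrightarrow> (\<lambda>x. T' x y) \<in> linear_maps R (free_module R B) M"
    and "\<And>x. x \<in> carrier (free_module R B) \<Longrightarrow> (\<lambda>y. T' x y) \<in> linear_maps R (free_module R C) M"
    and "\<And>b c. b \<in> B \<Longrightarrow> c \<in> C \<Longrightarrow> T (basis_vector R b) (basis_vector R c) = T' (basis_vector R b) (basis_vector R c)"
    and "f \<in> carrier (free_module R B)" "g \<in> carrier (free_module R C)"
  shows "T f g = T' f g"
proof (rule linear_maps_eq_on_basis[OF assms(1,3) assms(4,6)[OF assms(10)] _ assms(9)])
  fix b assume "b \<in> B"
  then show "T (basis_vector R b) g = T' (basis_vector R b) g"
    using assms(8)
    by (intro linear_maps_eq_on_basis[OF assms(2,3) assms(5,7) _ assms(10)] basis_vector_closed) auto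
qed

lemma linear_extension_basis_vector:
  assumes "finite B" "module R M" "\<phi> \<in> B \<rightarrow> carrier M" "b \<in> B"
  shows "linear_extension B M \<phi> (basis_vector R b) = \<phi> b"
proof -
  interpret M: module R M by fact
  note [simp] = Pi_mem[OF assms(3)]
  have "(\<Oplus>\<^bsub>M\<^esub>c\<in>B. basis_vector R b c \<odot>\<^bsub>M\<^esub> \<phi> c) = (\<Oplus>\<^bsub>M\<^esub>c\<in>B. if b = c then \<phi> c else \<zero>\<^bsub>M\<^esub>)"
    by (rule M.finsum_cong') (auto simp: basis_vector_def)
  also have "\<dots> = \<phi> b" using assms by (intro M.add.finprod_singleton) auto
  finally show ?thesis by (simp add: linear_extension_def)
qed

end

section \<open>Quotient modules\<close>

text \<open>
  A coset involves only the addition, so cosets in the module of cocycles are cosets in the ambient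
  component.
\<close>

lemma a_r_coset_carrier_update [simp]: "a_r_coset (M\<lparr>carrier := Z\<rparr>) = a_r_coset M"
  by (simp add: fun_eq_iff a_r_coset_def r_coset_def)

lemma quotient_module_sel:
  "carrier (quotient_module M B) = (\<lambda>x. B +>\<^bsub>M\<^esub> x) ` carrier M"
  "\<zero>\<^bsub>quotient_module M B\<^esub> = B"
  "A \<oplus>\<^bsub>quotient_module M B\<^esub> A' = A <+>\<^bsub>M\<^esub> A'"
  "r \<odot>\<^bsub>quotient_module M B\<^esub> A = (\<Union>a\<in>A. B +>\<^bsub>M\<^esub> (r \<odot>\<^bsub>M\<^esub> a))"
  by (auto simp: quotient_module_def A_RCOSETS_def')

locale module_quotient = module R M for R (structure) and M (structure) and B +
  assumes submodule: "submodule B R M"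
begin

sublocale abelian_subgroup B M
  using submodule submodule.axioms(1) abelian_subgroupI2[OF M.a_comm_group] by auto

lemma smult_B: "r \<in> carrier R \<Longrightarrow> b \<in> B \<Longrightarrow> r \<odot>\<^bsub>M\<^esub> b \<in> B"
  using submodule by (rule submodule.smult_closed)

lemma coset_eq_iff:
  assumes "x \<in> carrier M" "y \<in> carrier M"
  shows "B +>\<^bsub>M\<^esub> x = B +>\<^bsub>M\<^esub> y \<longleftrightarrow> x \<ominus>\<^bsub>M\<^esub> y \<in> B"
  using a_rcos_module[OF assms(2,1)] a_rcos_self[OF assms(1)] a_repr_independence'[OF _ assms(2), of x]
  by (auto simp: M.minus_eq)

lemma in_coset_iff:
  assumes "x \<in> carrier M"
  shows "y \<in> B +>\<^bsub>M\<^esub> x \<longleftrightarrow> y \<in> carrier M \<and> B +>\<^bsub>M\<^esub> y = B +>\<^bsub>M\<^esub> x"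
  using a_elemrcos_carrier[OF assms, of y] a_rcos_self[of y] a_repr_independence'[OF _ assms, of y] by auto

text \<open>Operations on cosets are given as unions over representatives; such a union collapses to its value at
  one representative once well-definedness is known.\<close>

lemma coset_UNION_eq:
  assumes "x \<in> carrier M"
    and "\<And>y. y \<in> carrier M \<Longrightarrow> B +>\<^bsub>M\<^esub> y = B +>\<^bsub>M\<^esub> x \<Longrightarrow> h y = h x"
  shows "(\<Union>y\<in>B +>\<^bsub>M\<^esub> x. h y) = h x"
proof -
  have "h y = h x" if "y \<in> B +>\<^bsub>M\<^esub> x" for y
    by (rule assms(2)) (use that in_coset_iff[OF assms(1)] in auto)
  then show ?thesis using a_rcos_self[OF assms(1)] by blast
qed

lemma quotient_add:
  "x \<in> carrier M \<Longrightarrow> y \<in> carrier M \<Longrightarrow>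
    (B +>\<^bsub>M\<^esub> x) \<oplus>\<^bsub>quotient_module M B\<^esub> (B +>\<^bsub>M\<^esub> y) = B +>\<^bsub>M\<^esub> (x \<oplus>\<^bsub>M\<^esub> y)"
  by (simp add: quotient_module_sel a_rcos_sum)

lemma quotient_smult:
  assumes "r \<in> carrier R" "x \<in> carrier M"
  shows "r \<odot>\<^bsub>quotient_module M B\<^esub> (B +>\<^bsub>M\<^esub> x) = B +>\<^bsub>M\<^esub> (r \<odot>\<^bsub>M\<^esub> x)"
proof -
  have "B +>\<^bsub>M\<^esub> (r \<odot>\<^bsub>M\<^esub> y) = B +>\<^bsub>M\<^esub> (r \<odot>\<^bsub>M\<^esub> x)" if "y \<in> carrier M" "B +>\<^bsub>M\<^esub> y = B +>\<^bsub>M\<^esub> x" for y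
  proof -
    have "r \<odot>\<^bsub>M\<^esub> (y \<ominus>\<^bsub>M\<^esub> x) \<in> B" using that assms coset_eq_iff[of y x] by (intro smult_B) auto
    then show ?thesis using that assms
      by (simp add: coset_eq_iff smult_r_distr smult_r_minus M.minus_eq)
  qed
  then show ?thesis unfolding quotient_module_sel by (rule coset_UNION_eq[OF assms(2)])
qed

lemma quotient_zero: "\<zero>\<^bsub>quotient_module M B\<^esub> = B +>\<^bsub>M\<^esub> \<zero>\<^bsub>M\<^esub>"
  by (simp add: quotient_module_sel a_rcos_const)

lemma carrier_quotientE:
  assumes "A \<in> carrier (quotient_module M B)"
  obtains x where "x \<in> carrier M" "A = B +>\<^bsub>M\<^esub> x"
  using assms by (auto simp: quotient_module_sel)

lemma coset_in_quotient: "x \<in> carrier M \<Longrightarrow> B +>\<^bsub>M\<^esub> x \<in> carrier (quotient_module M B)"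
  by (auto simp: quotient_module_sel)

lemma module_quotient_module: "module R (quotient_module M B)"
proof -
  let ?Q = "quotient_module M B"
  note simps = coset_in_quotient quotient_add quotient_smult quotient_zero
  have inv: "\<exists>A'\<in>carrier ?Q. A' \<oplus>\<^bsub>?Q\<^esub> A = \<zero>\<^bsub>?Q\<^esub>" if A: "A \<in> carrier ?Q" for A
  proof -
    obtain x where "x \<in> carrier M" "A = B +>\<^bsub>M\<^esub> x" using A by (rule carrier_quotientE)
    then show ?thesis
      by (intro bexI[of _ "B +>\<^bsub>M\<^esub> (\<ominus>\<^bsub>M\<^esub> x)"]) (simp_all add: simps M.l_neg)
  qed
  have "abelian_group ?Q"
  proof (rule abelian_groupI)
    fix A A' A'' assume A: "A \<in> carrier ?Q" "A' \<in> carrier ?Q" "A'' \<in> carrier ?Q"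
    then show "A \<oplus>\<^bsub>?Q\<^esub> A' \<oplus>\<^bsub>?Q\<^esub> A'' = A \<oplus>\<^bsub>?Q\<^esub> (A' \<oplus>\<^bsub>?Q\<^esub> A'')"
      by (elim carrier_quotientE) (simp add: simps M.a_assoc)
    from A(1,2) show "A \<oplus>\<^bsub>?Q\<^esub> A' = A' \<oplus>\<^bsub>?Q\<^esub> A" "A \<oplus>\<^bsub>?Q\<^esub> A' \<in> carrier ?Q"
      by (elim carrier_quotientE; simp add: simps M.a_comm)+
    from A(1) show "\<zero>\<^bsub>?Q\<^esub> \<oplus>\<^bsub>?Q\<^esub> A = A" by (elim carrier_quotientE) (simp add: simps)
  qed (use inv in \<open>simp_all add: quotient_zero coset_in_quotient\<close>)
  show ?thesis
  proof (intro moduleI R.is_cring \<open>abelian_group ?Q\<close>)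
    fix r s A A' assume rs: "r \<in> carrier R" "s \<in> carrier R" and A: "A \<in> carrier ?Q" "A' \<in> carrier ?Q"
    from rs A(1) show "r \<odot>\<^bsub>?Q\<^esub> A \<in> carrier ?Q"
      by (elim carrier_quotientE) (simp add: simps)
    from rs A(1) show "(r \<oplus> s) \<odot>\<^bsub>?Q\<^esub> A = r \<odot>\<^bsub>?Q\<^esub> A \<oplus>\<^bsub>?Q\<^esub> s \<odot>\<^bsub>?Q\<^esub> A"
      by (elim carrier_quotientE) (simp add: simps smult_l_distr)
    from rs A(1) show "r \<otimes> s \<odot>\<^bsub>?Q\<^esub> A = r \<odot>\<^bsub>?Q\<^esub> (s \<odot>\<^bsub>?Q\<^esub> A)"
      by (elim carrier_quotientE) (simp add: simps smult_assoc1)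
    from rs A show "r \<odot>\<^bsub>?Q\<^esub> (A \<oplus>\<^bsub>?Q\<^esub> A') = r \<odot>\<^bsub>?Q\<^esub> A \<oplus>\<^bsub>?Q\<^esub> r \<odot>\<^bsub>?Q\<^esub> A'"
      by (elim carrier_quotientE) (simp add: simps smult_r_distr)
  next
    fix A assume "A \<in> carrier ?Q"
    then show "\<one> \<odot>\<^bsub>?Q\<^esub> A = A" by (elim carrier_quotientE) (simp add: simps)
  qed
qed

lemma coset_linear: "(\<lambda>x. B +>\<^bsub>M\<^esub> x) \<in> linear_maps R M (quotient_module M B)"
  by (rule linear_mapsI) (simp_all add: quotient_add quotient_smult coset_in_quotient)

end

section \<open>Algebras placed in degree zero\<close>

text \<open>
  These are the axioms of a differential graded algebra in species that remain in degree 0.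
  The notion separates the algebra structure on degree-zero cohomology from the task of placing an algebra in
  degree 0.
\<close>

locale algebra_in_species = R?: cring R
  for R :: "('k, 'z) ring_scheme" (structure) and A :: "('a, 'k, 'm) species_alg" +
  assumes module_scomp: "finite I \<Longrightarrow> module R (scomp A I)"
    and stransport_linear:
      "\<lbrakk>finite I; inj_on \<sigma> I\<rbrakk> \<Longrightarrow> stransport A \<sigma> I \<in> linear_maps R (scomp A I) (scomp A (\<sigma> ` I))"
    and stransport_cong:
      "\<lbrakk>finite I; inj_on \<sigma> I; \<And>i. i \<in> I \<Longrightarrow> \<sigma> i = \<tau> i; x \<in> carrier (scomp A I)\<rbrakk>
        \<Longrightarrow> stransport A \<sigma> I x = stransport A \<tau> I x"
    and stransport_id: "\<lbrakk>finite I; x \<in> carrier (scomp A I)\<rbrakk> \<Longrightarrow> stransport A id I x = x"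
    and stransport_comp:
      "\<lbrakk>finite I; inj_on \<sigma> I; inj_on \<tau> (\<sigma> ` I); x \<in> carrier (scomp A I)\<rbrakk>
        \<Longrightarrow> stransport A (\<tau> \<circ> \<sigma>) I x = stransport A \<tau> (\<sigma> ` I) (stransport A \<sigma> I x)"
    and sprod_linear_left:
      "\<lbrakk>finite S; finite T; S \<inter> T = {}; y \<in> carrier (scomp A T)\<rbrakk>
        \<Longrightarrow> (\<lambda>x. sprod A S T x y) \<in> linear_maps R (scomp A S) (scomp A (S \<union> T))"
    and sprod_linear_right:
      "\<lbrakk>finite S; finite T; S \<inter> T = {}; x \<in> carrier (scomp A S)\<rbrakk>
        \<Longrightarrow> (\<lambda>y. sprod A S T x y) \<in> linear_maps R (scomp A T) (scomp A (S \<union> T))"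
    and sprod_natural:
      "\<lbrakk>finite S; finite T; S \<inter> T = {}; inj_on \<sigma> (S \<union> T);
        x \<in> carrier (scomp A S); y \<in> carrier (scomp A T)\<rbrakk>
        \<Longrightarrow> stransport A \<sigma> (S \<union> T) (sprod A S T x y)
           = sprod A (\<sigma> ` S) (\<sigma> ` T) (stransport A \<sigma> S x) (stransport A \<sigma> T y)"
    and sprod_assoc:
      "\<lbrakk>finite S; finite T; finite U; S \<inter> T = {}; S \<inter> U = {}; T \<inter> U = {};
        x \<in> carrier (scomp A S); y \<in> carrier (scomp A T); z \<in> carrier (scomp A U)\<rbrakk>
        \<Longrightarrow> sprod A (S \<union> T) U (sprod A S T x y) z = sprod A S (T \<union> U) x (sprod A T U y z)"
    and sunit_closed: "sunit A \<in> carrier (scomp A {})"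
    and sunit_left: "\<lbrakk>finite I; x \<in> carrier (scomp A I)\<rbrakk> \<Longrightarrow> sprod A {} I (sunit A) x = x"
    and sunit_right: "\<lbrakk>finite I; x \<in> carrier (scomp A I)\<rbrakk> \<Longrightarrow> sprod A I {} x (sunit A) = x"

lemma in_degree_zero_sel [simp]:
  "carrier (component (in_degree_zero A) I n) = (if n = 0 then carrier (scomp A I) else {\<zero>\<^bsub>scomp A I\<^esub>})"
  "\<zero>\<^bsub>component (in_degree_zero A) I n\<^esub> = \<zero>\<^bsub>scomp A I\<^esub>"
  "x \<oplus>\<^bsub>component (in_degree_zero A) I n\<^esub> y = x \<oplus>\<^bsub>scomp A I\<^esub> y"
  "r \<odot>\<^bsub>component (in_degree_zero A) I n\<^esub> x = r \<odot>\<^bsub>scomp A I\<^esub> x"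
  "transport (in_degree_zero A) \<sigma> I n x = (if n = 0 then stransport A \<sigma> I x else \<zero>\<^bsub>scomp A (\<sigma> ` I)\<^esub>)"
  "differential (in_degree_zero A) I n x = \<zero>\<^bsub>scomp A I\<^esub>"
  "product (in_degree_zero A) S T m n x y =
    (if m = 0 \<and> n = 0 then sprod A S T x y else \<zero>\<^bsub>scomp A (S \<union> T)\<^esub>)"
  "unit_element (in_degree_zero A) = sunit A"
  by (simp_all add: in_degree_zero_def)

lemma power_of_minus_one_closed [simp, intro]:
  assumes "cring R" shows "power_of_minus_one R n \<in> carrier R"
proof -
  interpret cring R by fact
  show ?thesis by (simp add: power_of_minus_one_def)
qed

lemma module_zero_submodule:
  assumes "module R M" shows "module R (M\<lparr>carrier := {\<zero>\<^bsub>M\<^esub>}\<rparr>)"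
proof -
  interpret module R M by fact
  have "submodule {\<zero>\<^bsub>M\<^esub>} R M" by (rule submoduleI) auto
  then show ?thesis using assms by (rule submodule.submodule_is_module)
qed

context algebra_in_species
begin

lemma module_in_degree_zero: "finite I \<Longrightarrow> module R (component (in_degree_zero A) I n)"
  by (simp add: in_degree_zero_def module_scomp module_zero_submodule)

text \<open>
  In the axioms that involve several degrees, a degree other than 0 contributes the zero element, so
  both sides vanish by linearity; what remains is the corresponding axiom in degree 0.
\<close>

lemma dg_algebra_in_degree_zero: "dg_algebra_in_species R (in_degree_zero A)"
proof -
  let ?Y = "in_degree_zero A"
  have zero: "\<zero>\<^bsub>scomp A I\<^esub> \<in> carrier (scomp A I)" "\<zero>\<^bsub>scomp A I\<^esub> \<oplus>\<^bsub>scomp A I\<^esub> \<zero>\<^bsub>scomp A I\<^esub> = \<zero>\<^bsub>scomp A I\<^esub>"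
    "\<And>r. r \<in> carrier R \<Longrightarrow> r \<odot>\<^bsub>scomp A I\<^esub> \<zero>\<^bsub>scomp A I\<^esub> = \<zero>\<^bsub>scomp A I\<^esub>" if "finite I" for I
  proof -
    interpret M: module R "scomp A I" using that by (rule module_scomp)
    show "\<zero>\<^bsub>scomp A I\<^esub> \<in> carrier (scomp A I)" "\<zero>\<^bsub>scomp A I\<^esub> \<oplus>\<^bsub>scomp A I\<^esub> \<zero>\<^bsub>scomp A I\<^esub> = \<zero>\<^bsub>scomp A I\<^esub>"
      "\<And>r. r \<in> carrier R \<Longrightarrow> r \<odot>\<^bsub>scomp A I\<^esub> \<zero>\<^bsub>scomp A I\<^esub> = \<zero>\<^bsub>scomp A I\<^esub>" by simp_all
  qed
  have prod_zero_left: "sprod A S T \<zero>\<^bsub>scomp A S\<^esub> y = \<zero>\<^bsub>scomp A (S \<union> T)\<^esub>"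
    if "finite S" "finite T" "S \<inter> T = {}" "y \<in> carrier (scomp A T)" for S T y
    using linear_maps_zero[OF module_scomp module_scomp sprod_linear_left] that by blast
  have prod_zero_right: "sprod A S T x \<zero>\<^bsub>scomp A T\<^esub> = \<zero>\<^bsub>scomp A (S \<union> T)\<^esub>"
    if "finite S" "finite T" "S \<inter> T = {}" "x \<in> carrier (scomp A S)" for S T x
    using linear_maps_zero[OF module_scomp module_scomp sprod_linear_right] that by blast
  have transport_zero: "stransport A \<sigma> I \<zero>\<^bsub>scomp A I\<^esub> = \<zero>\<^bsub>scomp A (\<sigma> ` I)\<^esub>"
    if "finite I" "inj_on \<sigma> I" for \<sigma> I
    using linear_maps_zero[OF module_scomp module_scomp stransport_linear] that by blast
  note sprod_closed = linear_mapsD(1)[OF sprod_linear_left]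
  note transport_closed = linear_mapsD(1)[OF stransport_linear]
  show ?thesis
  proof (intro dg_algebra_in_species.intro dg_algebra_in_species_axioms.intro is_cring, goal_cases)
    case (1 I n)
    then show ?case by (rule module_in_degree_zero)
  next
    case (2 I \<sigma> n)
    then show ?case using linear_mapsD[OF stransport_linear[OF 2]]
      by (intro linear_mapsI) (auto simp: zero)
  next
    case (3 I \<sigma> \<tau> x n)
    then show ?case using image_cong[of I I \<sigma> \<tau>] stransport_cong[of I \<sigma> \<tau>] by (auto split: if_splits)
  next
    case (4 I x n)
    then show ?case by (auto simp: stransport_id split: if_splits)
  next
    case (5 I \<sigma> \<tau> x n)
    then show ?case by (auto simp: stransport_comp image_comp split: if_splits)
  next
    case (6 I n)
    then show ?case by (intro linear_mapsI) (auto simp: zero)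
  next
    case (7 I \<sigma> x n)
    then show ?case by (auto simp: transport_zero)
  next
    case (8 I x n)
    then show ?case by simp
  next
    case (9 S T y n m)
    then show ?case using linear_mapsD[OF sprod_linear_left[of S T y]]
      by (intro linear_mapsI) (auto simp: zero split: if_splits)
  next
    case (10 S T x m n)
    then show ?case using linear_mapsD[OF sprod_linear_right[of S T x]]
      by (intro linear_mapsI) (auto simp: zero split: if_splits)
  next
    case (11 S T \<sigma> x m y n)
    then have "inj_on \<sigma> S" "inj_on \<sigma> T" "\<sigma> ` S \<inter> \<sigma> ` T = {}" by (auto simp: inj_on_def)
    then show ?case using 11
      by (auto simp: sprod_natural transport_zero image_Un split: if_splits)
  next
    case (12 S T U x m y n z p)
    have "(S \<union> T) \<inter> U = {}" "S \<inter> (T \<union> U) = {}" using 12 by auto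
    then show ?case using 12
      by (auto simp: sprod_assoc prod_zero_left prod_zero_right Un_assoc split: if_splits)
  next
    case 13
    show ?case by (simp add: sunit_closed)
  next
    case 14
    show ?case by simp
  next
    case (15 I x n)
    then show ?case by (auto simp: sunit_left split: if_splits)
  next
    case (16 I x n)
    then show ?case by (auto simp: sunit_right split: if_splits)
  next
    case (17 S T x m y n)
    then show ?case
      by (auto simp: prod_zero_left prod_zero_right zero is_cring split: if_splits)
  qed
qed

end

section \<open>Cohomology classes\<close>

context dg_algebra_in_species
begin

abbreviation cohomology_class :: "'a set \<Rightarrow> int \<Rightarrow> 'm \<Rightarrow> 'm set" where
  "cohomology_class I n x \<equiv> coboundaries X I n +>\<^bsub>component X I n\<^esub> x"

abbreviation cocycle_module :: "'a set \<Rightarrow> int \<Rightarrow> ('k, 'm) module" where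
  "cocycle_module I n \<equiv> (component X I n)\<lparr>carrier := cocycles X I n\<rparr>"

lemma coboundaries_subset_cocycles: "finite I \<Longrightarrow> coboundaries X I n \<subseteq> cocycles X I n"
  using diff_linear[of I "n - 1"] diff_diff[of I _ "n - 1"]
  by (auto simp: coboundaries_def cocycles_def linear_maps_def)

lemma submodule_cocycles:
  assumes "finite I" shows "submodule (cocycles X I n) R (component X I n)"
proof -
  interpret M: module R "component X I n" using assms by (rule module_comp)
  interpret N: module R "component X I (n + 1)" using assms by (rule module_comp)
  note d = linear_mapsD[OF diff_linear[OF assms, of n]]
  show ?thesis
    by (rule M.submoduleI)
      (use linear_maps_minus[OF M.module_axioms N.module_axioms diff_linear[OF assms]]
           linear_maps_zero[OF M.module_axioms N.module_axioms diff_linear[OF assms]] in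
        \<open>auto simp: cocycles_def d\<close>)
qed

lemma module_cocycles: "finite I \<Longrightarrow> module R (cocycle_module I n)"
  using submodule.submodule_is_module[OF submodule_cocycles module_comp] by blast

lemma submodule_coboundaries:
  assumes "finite I" shows "submodule (coboundaries X I n) R (cocycle_module I n)"
proof -
  interpret M: module R "component X I (n - 1)" using assms by (rule module_comp)
  interpret N: module R "component X I n" using assms by (rule module_comp)
  interpret Z: module R "cocycle_module I n" using assms by (rule module_cocycles)
  have lin: "differential X I (n - 1) \<in> linear_maps R (component X I (n - 1)) (component X I n)"
    using diff_linear[OF assms, of "n - 1"] by simp
  note d = linear_mapsD(2,3)[OF lin, symmetric]
  have "submodule (coboundaries X I n) R (component X I n)"
  proof (rule N.submoduleI)
    show "\<zero>\<^bsub>component X I n\<^esub> \<in> coboundaries X I n"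
      using linear_maps_zero[OF M.module_axioms N.module_axioms lin] unfolding coboundaries_def
      by (metis M.zero_closed image_eqI)
  next
    fix a assume "a \<in> coboundaries X I n"
    then show "\<ominus>\<^bsub>component X I n\<^esub> a \<in> coboundaries X I n"
      using linear_maps_minus[OF M.module_axioms N.module_axioms lin, symmetric] unfolding coboundaries_def
      by auto
  qed (use coboundaries_subset_cocycles[OF assms, of n] in \<open>auto simp: coboundaries_def d cocycles_def\<close>)
  note sub = N.submoduleE[OF this]
  show ?thesis
    by (rule Z.module_incl_imp_submodule) (use coboundaries_subset_cocycles[OF assms]
      submodule.submodule_is_module[OF \<open>submodule (coboundaries X I n) R (component X I n)\<close> N.module_axioms] in auto)
qed

lemma cohomology_quotient: "finite I \<Longrightarrow> module_quotient R (cocycle_module I n) (coboundaries X I n)"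
  by (intro module_quotient.intro module_cocycles module_quotient_axioms.intro submodule_coboundaries)

lemma module_cohomology: "finite I \<Longrightarrow> module R (cohomology X I n)"
  using module_quotient.module_quotient_module[OF cohomology_quotient] by (simp add: cohomology_def)

lemma cohomology_class_linear:
  "finite I \<Longrightarrow> cohomology_class I n \<in> linear_maps R (cocycle_module I n) (cohomology X I n)"
  using module_quotient.coset_linear[OF cohomology_quotient] by (simp add: cohomology_def)

lemma carrier_cohomology: "carrier (cohomology X I n) = cohomology_class I n ` cocycles X I n"
  by (simp add: cohomology_def quotient_module_sel)

lemma zero_cohomology: "\<zero>\<^bsub>cohomology X I n\<^esub> = coboundaries X I n"
  by (simp add: cohomology_def quotient_module_sel)

text \<open>
  Negation is defined by a description that ranges over the carrier, so its agreement on cocycles and on the whole component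
  follows only from uniqueness of inverses.
\<close>

lemma a_minus_carrier_update:
  assumes "finite I" "x \<in> cocycles X I n"
  shows "\<ominus>\<^bsub>cocycle_module I n\<^esub> x = \<ominus>\<^bsub>component X I n\<^esub> x"
proof -
  interpret Z: module R "cocycle_module I n" using assms(1) by (rule module_cocycles)
  interpret N: module R "component X I n" using assms(1) by (rule module_comp)
  have "\<ominus>\<^bsub>cocycle_module I n\<^esub> x \<in> cocycles X I n" using Z.a_inv_closed assms by simp
  moreover have "x \<oplus>\<^bsub>component X I n\<^esub> \<ominus>\<^bsub>cocycle_module I n\<^esub> x = \<zero>\<^bsub>component X I n\<^esub>"
    using Z.r_neg[of x] assms by simp
  ultimately show ?thesis using assms(2) N.minus_equality[of "\<ominus>\<^bsub>cocycle_module I n\<^esub> x" x]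
    by (simp add: cocycles_def N.a_comm)
qed

lemma cohomology_class_eq_iff:
  assumes "finite I" "x \<in> cocycles X I n" "y \<in> cocycles X I n"
  shows "cohomology_class I n x = cohomology_class I n y \<longleftrightarrow>
    x \<oplus>\<^bsub>component X I n\<^esub> \<ominus>\<^bsub>component X I n\<^esub> y \<in> coboundaries X I n"
proof -
  interpret N: module R "component X I n" using assms(1) by (rule module_comp)
  show ?thesis
    using module_quotient.coset_eq_iff[OF cohomology_quotient[OF assms(1)], of x n y] assms
    by (simp add: a_minus_def a_minus_carrier_update)
qed

lemma in_cohomology_class_iff:
  assumes "finite I" "x \<in> cocycles X I n"
  shows "y \<in> cohomology_class I n x \<longleftrightarrow>
    y \<in> cocycles X I n \<and> cohomology_class I n y = cohomology_class I n x"
  using module_quotient.in_coset_iff[OF cohomology_quotient, of I x n y] assms by simp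

lemma cohomology_class_UNION:
  assumes "finite I" "x \<in> cocycles X I n"
    and "\<And>y. y \<in> cocycles X I n \<Longrightarrow> cohomology_class I n y = cohomology_class I n x \<Longrightarrow> h y = h x"
  shows "(\<Union>y\<in>cohomology_class I n x. h y) = h x"
proof -
  have "h y = h x" if "y \<in> cohomology_class I n x" for y
    by (rule assms(3)) (use that in_cohomology_class_iff[OF assms(1,2)] in auto)
  moreover have "x \<in> cohomology_class I n x" using in_cohomology_class_iff[OF assms(1,2)] assms(2) by simp
  ultimately show ?thesis by blast
qed

text \<open>Two representatives of a class differ by a coboundary, and so do their images.\<close>

lemma cohomology_class_map_eq:
  assumes "finite I" "finite J" "h \<in> linear_maps R (component X I n) (component X J m)"
    and "\<And>x. x \<in> cocycles X I n \<Longrightarrow> h x \<in> cocycles X J m"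
    and "\<And>x. x \<in> coboundaries X I n \<Longrightarrow> h x \<in> coboundaries X J m"
    and "x \<in> cocycles X I n" "y \<in> cocycles X I n"
    and "cohomology_class I n x = cohomology_class I n y"
  shows "cohomology_class J m (h x) = cohomology_class J m (h y)"
proof -
  interpret N: module R "component X I n" using assms(1) by (rule module_comp)
  have xy: "x \<in> carrier (component X I n)" "y \<in> carrier (component X I n)"
    using assms by (auto simp: cocycles_def)
  have "h (x \<oplus>\<^bsub>component X I n\<^esub> \<ominus>\<^bsub>component X I n\<^esub> y) \<in> coboundaries X J m"
    using assms cohomology_class_eq_iff by blast
  also have "h (x \<oplus>\<^bsub>component X I n\<^esub> \<ominus>\<^bsub>component X I n\<^esub> y) =
      h x \<oplus>\<^bsub>component X J m\<^esub> \<ominus>\<^bsub>component X J m\<^esub> h y"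
    using linear_mapsD[OF assms(3)] xy linear_maps_minus[OF N.module_axioms module_comp[OF assms(2)] assms(3)]
    by simp
  finally show ?thesis using assms by (simp add: cohomology_class_eq_iff)
qed

end

section \<open>The algebra of degree-zero cohomology classes\<close>

context dg_algebra_in_species
begin

lemma cocyclesD:
  "x \<in> cocycles X I n \<Longrightarrow> x \<in> carrier (component X I n)"
  "x \<in> cocycles X I n \<Longrightarrow> differential X I n x = \<zero>\<^bsub>component X I (n + 1)\<^esub>"
  by (auto simp: cocycles_def)

lemma zero_closed: "finite I \<Longrightarrow> \<zero>\<^bsub>component X I n\<^esub> \<in> carrier (component X I n)"
  using module.axioms(2)[OF module_comp] abelian_groupE(2) by blast

lemma cocycle_operations:
  assumes "finite I" "x \<in> cocycles X I n"
  shows "y \<in> cocycles X I n \<Longrightarrow> x \<oplus>\<^bsub>component X I n\<^esub> y \<in> cocycles X I n"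
    and "r \<in> carrier R \<Longrightarrow> r \<odot>\<^bsub>component X I n\<^esub> x \<in> cocycles X I n"
    and "y \<in> cocycles X I n \<Longrightarrow> cohomology_class I n (x \<oplus>\<^bsub>component X I n\<^esub> y) =
      cohomology_class I n x \<oplus>\<^bsub>cohomology X I n\<^esub> cohomology_class I n y"
    and "r \<in> carrier R \<Longrightarrow> cohomology_class I n (r \<odot>\<^bsub>component X I n\<^esub> x) =
      r \<odot>\<^bsub>cohomology X I n\<^esub> cohomology_class I n x"
proof -
  interpret Z: module R "cocycle_module I n" using assms(1) by (rule module_cocycles)
  show "y \<in> cocycles X I n \<Longrightarrow> x \<oplus>\<^bsub>component X I n\<^esub> y \<in> cocycles X I n"
    using Z.a_closed[of x y] assms by simp
  show "r \<in> carrier R \<Longrightarrow> r \<odot>\<^bsub>component X I n\<^esub> x \<in> cocycles X I n"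
    using Z.smult_closed[of r x] assms by simp
qed (use linear_mapsD[OF cohomology_class_linear[OF assms(1), of n]] assms in simp_all)

lemma cohomologyE:
  assumes "A \<in> carrier (cohomology X I n)"
  obtains x where "x \<in> cocycles X I n" "A = cohomology_class I n x"
  using assms by (auto simp: carrier_cohomology)

lemma cohomology_class_closed: "x \<in> cocycles X I n \<Longrightarrow> cohomology_class I n x \<in> carrier (cohomology X I n)"
  by (simp add: carrier_cohomology)

lemma transport_cocycle:
  assumes "finite I" "inj_on \<sigma> I" "x \<in> cocycles X I n"
  shows "transport X \<sigma> I n x \<in> cocycles X (\<sigma> ` I) n"
proof -
  have "transport X \<sigma> I (n + 1) \<zero>\<^bsub>component X I (n + 1)\<^esub> = \<zero>\<^bsub>component X (\<sigma> ` I) (n + 1)\<^esub>"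
    using assms by (intro linear_maps_zero[OF module_comp module_comp transport_linear]) auto
  then show ?thesis using assms diff_natural[OF assms(1,2), of x n] linear_mapsD(1)[OF transport_linear[OF assms(1,2)]]
    by (simp add: cocycles_def)
qed

lemma transport_coboundary:
  assumes "finite I" "inj_on \<sigma> I" "x \<in> coboundaries X I n"
  shows "transport X \<sigma> I n x \<in> coboundaries X (\<sigma> ` I) n"
proof -
  obtain z where z: "z \<in> carrier (component X I (n - 1))" "x = differential X I (n - 1) z"
    using assms(3) by (auto simp: coboundaries_def)
  then have "transport X \<sigma> I n x = differential X (\<sigma> ` I) (n - 1) (transport X \<sigma> I (n - 1) z)"
    using diff_natural[OF assms(1,2), of z "n - 1"] by simp
  moreover have "transport X \<sigma> I (n - 1) z \<in> carrier (component X (\<sigma> ` I) (n - 1))"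
    using z(1) by (rule linear_mapsD(1)[OF transport_linear[OF assms(1,2)]])
  ultimately show ?thesis by (auto simp: coboundaries_def)
qed

lemma product_closed:
  assumes "finite S" "finite T" "S \<inter> T = {}" "x \<in> carrier (component X S m)" "y \<in> carrier (component X T n)"
  shows "product X S T m n x y \<in> carrier (component X (S \<union> T) (m + n))"
  using linear_mapsD(1)[OF prod_linear_left[OF assms(1-3,5)] assms(4)] .

lemma product_zero:
  assumes "finite S" "finite T" "S \<inter> T = {}"
  shows "y \<in> carrier (component X T n) \<Longrightarrow> product X S T m n \<zero>\<^bsub>component X S m\<^esub> y = \<zero>\<^bsub>component X (S \<union> T) (m + n)\<^esub>"
    and "x \<in> carrier (component X S m) \<Longrightarrow> product X S T m n x \<zero>\<^bsub>component X T n\<^esub> = \<zero>\<^bsub>component X (S \<union> T) (m + n)\<^esub>"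
  using linear_maps_zero[OF module_comp module_comp prod_linear_left[OF assms]]
    linear_maps_zero[OF module_comp module_comp prod_linear_right[OF assms]] assms by blast+

lemma product_cocycle:
  assumes "finite S" "finite T" "S \<inter> T = {}" "x \<in> cocycles X S m" "y \<in> cocycles X T n"
  shows "product X S T m n x y \<in> cocycles X (S \<union> T) (m + n)"
proof -
  interpret M: module R "component X (S \<union> T) (m + n + 1)" using assms by (intro module_comp) auto
  have "m + 1 + n = m + n + 1" "m + (n + 1) = m + n + 1" by auto
  then have "product X S T (m + 1) n (differential X S m x) y = \<zero>\<^bsub>component X (S \<union> T) (m + n + 1)\<^esub>"
    "product X S T m (n + 1) x (differential X T n y) = \<zero>\<^bsub>component X (S \<union> T) (m + n + 1)\<^esub>"
    using product_zero[OF assms(1-3)] cocyclesD[OF assms(4)] cocyclesD[OF assms(5)] by metis+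
  then show ?thesis
    using leibniz[OF assms(1-3)] cocyclesD[OF assms(4)] cocyclesD[OF assms(5)] product_closed[OF assms(1-3)]
      power_of_minus_one_closed[OF is_cring]
    by (simp add: cocycles_def)
qed

lemma product_coboundary_left:
  assumes "finite S" "finite T" "S \<inter> T = {}" "x \<in> coboundaries X S m" "y \<in> cocycles X T n"
  shows "product X S T m n x y \<in> coboundaries X (S \<union> T) (m + n)"
proof -
  interpret M: module R "component X (S \<union> T) (m + n)" using assms by (intro module_comp) auto
  obtain z where z: "z \<in> carrier (component X S (m - 1))" "x = differential X S (m - 1) z"
    using assms(4) by (auto simp: coboundaries_def)
  have deg: "m - 1 + n = m + n - 1" "m - 1 + (n + 1) = m + n" by auto
  have "product X S T (m - 1) (n + 1) z (differential X T n y) = \<zero>\<^bsub>component X (S \<union> T) (m + n)\<^esub>"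
    using product_zero(2)[OF assms(1-3) z(1), of "n + 1"] cocyclesD(2)[OF assms(5)] by (simp add: deg)
  moreover have "product X S T m n x y \<in> carrier (component X (S \<union> T) (m + n))"
    using product_closed[OF assms(1-3)] cocyclesD(1)[OF assms(5)] cocyclesD(1)[of x S m] assms
      coboundaries_subset_cocycles by blast
  ultimately have "differential X (S \<union> T) (m + n - 1) (product X S T (m - 1) n z y) = product X S T m n x y"
    using leibniz[OF assms(1-3) z(1) cocyclesD(1)[OF assms(5)]] z(2) power_of_minus_one_closed[OF is_cring]
    by (simp add: deg)
  moreover have "product X S T (m - 1) n z y \<in> carrier (component X (S \<union> T) (m + n - 1))"
    using product_closed[OF assms(1-3) z(1) cocyclesD(1)[OF assms(5)]] by (simp add: deg)
  ultimately show ?thesis unfolding coboundaries_def by (metis image_eqI)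
qed

lemma power_of_minus_one_square: "power_of_minus_one R n \<otimes> power_of_minus_one R n = \<one>"
  by (simp add: power_of_minus_one_def l_minus r_minus)

text \<open>
  If \<open>d x = 0\<close>, the Leibniz rule reads \<open>d (x z) = \<plusminus> x (d z)\<close>.  The sign has square one, so it
  can be moved to the left hand side.
\<close>

lemma product_coboundary_right:
  assumes "finite S" "finite T" "S \<inter> T = {}" "x \<in> cocycles X S m" "y \<in> coboundaries X T n"
  shows "product X S T m n x y \<in> coboundaries X (S \<union> T) (m + n)"
proof -
  let ?s = "power_of_minus_one R (m + int (card S))"
  interpret M: module R "component X (S \<union> T) (m + n)" using assms by (intro module_comp) auto
  note [simp] = power_of_minus_one_closed[OF is_cring]
  obtain z where z: "z \<in> carrier (component X T (n - 1))" "y = differential X T (n - 1) z"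
    using assms(5) by (auto simp: coboundaries_def)
  have deg: "m + (n - 1) = m + n - 1" "m + 1 + (n - 1) = m + n" by auto
  have pz: "product X S T m (n - 1) x z \<in> carrier (component X (S \<union> T) (m + n - 1))"
    using product_closed[OF assms(1-3) cocyclesD(1)[OF assms(4)] z(1)] by (simp add: deg)
  have "product X S T (m + 1) (n - 1) (differential X S m x) z = \<zero>\<^bsub>component X (S \<union> T) (m + n)\<^esub>"
    using product_zero(1)[OF assms(1-3) z(1), of "m + 1"] cocyclesD(2)[OF assms(4)] by (simp add: deg)
  moreover have p: "product X S T m n x y \<in> carrier (component X (S \<union> T) (m + n))"
    using product_closed[OF assms(1-3) cocyclesD(1)[OF assms(4)]] cocyclesD(1)[of y T n] assms
      coboundaries_subset_cocycles by blast
  ultimately have "differential X (S \<union> T) (m + n - 1) (product X S T m (n - 1) x z) =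
      ?s \<odot>\<^bsub>component X (S \<union> T) (m + n)\<^esub> product X S T m n x y"
    using leibniz[OF assms(1-3) cocyclesD(1)[OF assms(4)] z(1)] z(2) by (simp add: deg)
  then have "differential X (S \<union> T) (m + n - 1)
        (?s \<odot>\<^bsub>component X (S \<union> T) (m + n - 1)\<^esub> product X S T m (n - 1) x z) = product X S T m n x y"
    using linear_mapsD(3)[OF diff_linear, of "S \<union> T" ?s _ "m + n - 1"] pz assms p
    by (simp add: power_of_minus_one_square flip: M.smult_assoc1)
  moreover have "?s \<odot>\<^bsub>component X (S \<union> T) (m + n - 1)\<^esub> product X S T m (n - 1) x z
      \<in> carrier (component X (S \<union> T) (m + n - 1))"
    using module.smult_closed[OF module_comp, of "S \<union> T" ?s] pz assms by simp
  ultimately show ?thesis unfolding coboundaries_def by (metis image_eqI)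
qed

lemma H0_scomp [simp]: "scomp (H0_algebra X) I = cohomology X I 0"
  by (simp add: H0_algebra_def)

lemma H0_stransport:
  assumes "finite I" "inj_on \<sigma> I" "x \<in> cocycles X I 0"
  shows "stransport (H0_algebra X) \<sigma> I (cohomology_class I 0 x) = cohomology_class (\<sigma> ` I) 0 (transport X \<sigma> I 0 x)"
proof -
  have "(\<Union>y\<in>cohomology_class I 0 x. cohomology_class (\<sigma> ` I) 0 (transport X \<sigma> I 0 y)) =
      cohomology_class (\<sigma> ` I) 0 (transport X \<sigma> I 0 x)"
    by (rule cohomology_class_UNION[OF assms(1,3)],
        rule cohomology_class_map_eq[OF assms(1) _ transport_linear[OF assms(1,2)]])
      (use assms transport_cocycle transport_coboundary in auto)
  then show ?thesis by (simp add: H0_algebra_def)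
qed

text \<open>
  The product of two classes is a union over representatives of both factors.  It is evaluated one factor
  at a time, since cocycles times coboundaries are coboundaries on either side.
\<close>

lemma H0_sprod:
  assumes "finite S" "finite T" "S \<inter> T = {}" "x \<in> cocycles X S 0" "y \<in> cocycles X T 0"
  shows "sprod (H0_algebra X) S T (cohomology_class S 0 x) (cohomology_class T 0 y) =
    cohomology_class (S \<union> T) 0 (product X S T 0 0 x y)"
proof -
  have fin: "finite (S \<union> T)" using assms by simp
  have inner: "(\<Union>y'\<in>cohomology_class T 0 y. cohomology_class (S \<union> T) 0 (product X S T 0 0 x' y')) =
      cohomology_class (S \<union> T) 0 (product X S T 0 0 x' y)" if x': "x' \<in> cocycles X S 0" for x'
  proof (rule cohomology_class_UNION[OF assms(2,5)])
    fix y' assume y': "y' \<in> cocycles X T 0" "cohomology_class T 0 y' = cohomology_class T 0 y"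
    have "(\<lambda>y. product X S T 0 0 x' y) \<in> linear_maps R (component X T 0) (component X (S \<union> T) 0)"
      using prod_linear_right[OF assms(1-3) cocyclesD(1)[OF x'], of 0] by simp
    then show "cohomology_class (S \<union> T) 0 (product X S T 0 0 x' y') = cohomology_class (S \<union> T) 0 (product X S T 0 0 x' y)"
      by (rule cohomology_class_map_eq[OF assms(2) fin])
        (use y' assms(5) product_cocycle[OF assms(1-3) x', of _ 0] product_coboundary_right[OF assms(1-3) x', of _ 0] in auto)
  qed
  have "(\<Union>x'\<in>cohomology_class S 0 x. \<Union>y'\<in>cohomology_class T 0 y. cohomology_class (S \<union> T) 0 (product X S T 0 0 x' y')) =
      (\<Union>x'\<in>cohomology_class S 0 x. cohomology_class (S \<union> T) 0 (product X S T 0 0 x' y))"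
    using in_cohomology_class_iff[OF assms(1,4)] by (intro SUP_cong refl inner) auto
  also have "\<dots> = cohomology_class (S \<union> T) 0 (product X S T 0 0 x y)"
  proof (rule cohomology_class_UNION[OF assms(1,4)])
    fix x' assume x': "x' \<in> cocycles X S 0" "cohomology_class S 0 x' = cohomology_class S 0 x"
    have "(\<lambda>x. product X S T 0 0 x y) \<in> linear_maps R (component X S 0) (component X (S \<union> T) 0)"
      using prod_linear_left[OF assms(1-3) cocyclesD(1)[OF assms(5)], of 0] by simp
    then show "cohomology_class (S \<union> T) 0 (product X S T 0 0 x' y) = cohomology_class (S \<union> T) 0 (product X S T 0 0 x y)"
      by (rule cohomology_class_map_eq[OF assms(1) fin])
        (use x' assms(4) product_cocycle[OF assms(1-3) _ assms(5), of _ 0] product_coboundary_left[OF assms(1-3) _ assms(5), of _ 0] in auto)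
  qed
  finally show ?thesis by (simp add: H0_algebra_def)
qed

lemma unit_cocycle: "unit_element X \<in> cocycles X {} 0"
  using unit_closed diff_unit by (simp add: cocycles_def)

lemma H0_sunit: "sunit (H0_algebra X) = cohomology_class {} 0 (unit_element X)"
  by (simp add: H0_algebra_def)

lemma algebra_H0: "algebra_in_species R (H0_algebra X)"
proof (intro algebra_in_species.intro algebra_in_species_axioms.intro is_cring; (unfold H0_scomp H0_sunit)?)
  fix I :: "'a set" assume I: "finite I"
  show "module R (cohomology X I 0)" using I by (rule module_cohomology)
  fix x assume "x \<in> carrier (cohomology X I 0)"
  then obtain x' where x': "x' \<in> cocycles X I 0" "x = cohomology_class I 0 x'" by (rule cohomologyE)
  show "stransport (H0_algebra X) id I x = x"
    using I x' H0_stransport[of I id x'] transport_id[OF I cocyclesD(1)] by simp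
  show "sprod (H0_algebra X) {} I (cohomology_class {} 0 (unit_element X)) x = x"
    using I x' H0_sprod[OF _ I _ unit_cocycle, of x'] unit_left[OF I cocyclesD(1)] by simp
  show "sprod (H0_algebra X) I {} x (cohomology_class {} 0 (unit_element X)) = x"
    using I x' H0_sprod[OF I _ _ _ unit_cocycle, of x'] unit_right[OF I cocyclesD(1)] by simp
next
  fix I :: "'a set" and \<sigma> :: "'a \<Rightarrow> 'a" assume I: "finite I" "inj_on \<sigma> I"
  note t = linear_mapsD[OF transport_linear[OF I, of 0]]
  have I': "finite (\<sigma> ` I)" using I by simp
  show "stransport (H0_algebra X) \<sigma> I \<in> linear_maps R (cohomology X I 0) (cohomology X (\<sigma> ` I) 0)"
  proof (rule linear_mapsI)
    fix x assume "x \<in> carrier (cohomology X I 0)"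
    then obtain x' where x': "x' \<in> cocycles X I 0" "x = cohomology_class I 0 x'" by (rule cohomologyE)
    show "stransport (H0_algebra X) \<sigma> I x \<in> carrier (cohomology X (\<sigma> ` I) 0)"
      using I x' by (simp add: H0_stransport transport_cocycle cohomology_class_closed)
    show "stransport (H0_algebra X) \<sigma> I (r \<odot>\<^bsub>cohomology X I 0\<^esub> x) =
        r \<odot>\<^bsub>cohomology X (\<sigma> ` I) 0\<^esub> stransport (H0_algebra X) \<sigma> I x" if "r \<in> carrier R" for r
      using I I' x' that
      by (simp add: H0_stransport transport_cocycle cocyclesD t cocycle_operations(2) flip: cocycle_operations(4))
    fix y assume "y \<in> carrier (cohomology X I 0)"
    then obtain y' where y': "y' \<in> cocycles X I 0" "y = cohomology_class I 0 y'" by (rule cohomologyE)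
    show "stransport (H0_algebra X) \<sigma> I (x \<oplus>\<^bsub>cohomology X I 0\<^esub> y) =
        stransport (H0_algebra X) \<sigma> I x \<oplus>\<^bsub>cohomology X (\<sigma> ` I) 0\<^esub> stransport (H0_algebra X) \<sigma> I y"
      using I I' x' y'
      by (simp add: H0_stransport transport_cocycle cocyclesD t cocycle_operations(1) flip: cocycle_operations(3))
  qed
  fix x assume "x \<in> carrier (cohomology X I 0)"
  then obtain x' where x': "x' \<in> cocycles X I 0" "x = cohomology_class I 0 x'" by (rule cohomologyE)
  fix \<tau> :: "'a \<Rightarrow> 'a"
  show "stransport (H0_algebra X) (\<tau> \<circ> \<sigma>) I x =
      stransport (H0_algebra X) \<tau> (\<sigma> ` I) (stransport (H0_algebra X) \<sigma> I x)" if "inj_on \<tau> (\<sigma> ` I)"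
    using I I' x' that comp_inj_on[OF I(2) that] transport_comp[OF I that cocyclesD(1)[OF x'(1)]]
    by (simp add: H0_stransport transport_cocycle image_comp)
  assume eq: "\<And>i. i \<in> I \<Longrightarrow> \<sigma> i = \<tau> i"
  then have "\<sigma> ` I = \<tau> ` I" "inj_on \<tau> I" using I(2) by (auto simp: inj_on_def)
  then show "stransport (H0_algebra X) \<sigma> I x = stransport (H0_algebra X) \<tau> I x"
    using I x' transport_cong[OF I eq cocyclesD(1)[OF x'(1)]] by (simp add: H0_stransport)
next
  fix S T :: "'a set" and y assume ST: "finite S" "finite T" "S \<inter> T = {}" and "y \<in> carrier (cohomology X T 0)"
  then obtain y' where y': "y' \<in> cocycles X T 0" "y = cohomology_class T 0 y'" by (elim cohomologyE)
  have fin: "finite (S \<union> T)" using ST by simp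
  note t = linear_mapsD[OF prod_linear_left[OF ST cocyclesD(1)[OF y'(1)], of 0]]
  note c = product_cocycle[OF ST _ y'(1), of _ 0]
  show "(\<lambda>x. sprod (H0_algebra X) S T x y) \<in> linear_maps R (cohomology X S 0) (cohomology X (S \<union> T) 0)"
  proof (rule linear_mapsI)
    fix x assume "x \<in> carrier (cohomology X S 0)"
    then obtain x' where x': "x' \<in> cocycles X S 0" "x = cohomology_class S 0 x'" by (rule cohomologyE)
    show "sprod (H0_algebra X) S T x y \<in> carrier (cohomology X (S \<union> T) 0)"
      using ST x' y' c by (simp add: H0_sprod cohomology_class_closed)
    show "sprod (H0_algebra X) S T (r \<odot>\<^bsub>cohomology X S 0\<^esub> x) y =
        r \<odot>\<^bsub>cohomology X (S \<union> T) 0\<^esub> sprod (H0_algebra X) S T x y" if "r \<in> carrier R" for r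
      using ST fin x' y' that c t
      by (simp add: H0_sprod cocyclesD cocycle_operations(2) flip: cocycle_operations(4))
    fix z assume "z \<in> carrier (cohomology X S 0)"
    then obtain z' where z': "z' \<in> cocycles X S 0" "z = cohomology_class S 0 z'" by (rule cohomologyE)
    show "sprod (H0_algebra X) S T (x \<oplus>\<^bsub>cohomology X S 0\<^esub> z) y =
        sprod (H0_algebra X) S T x y \<oplus>\<^bsub>cohomology X (S \<union> T) 0\<^esub> sprod (H0_algebra X) S T z y"
      using ST fin x' y' z' c t
      by (simp add: H0_sprod cocyclesD cocycle_operations(1) flip: cocycle_operations(3))
  qed
next
  fix S T :: "'a set" and y assume ST: "finite S" "finite T" "S \<inter> T = {}" and "y \<in> carrier (cohomology X S 0)"
  then obtain y' where y': "y' \<in> cocycles X S 0" "y = cohomology_class S 0 y'" by (elim cohomologyE)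
  have fin: "finite (S \<union> T)" using ST by simp
  note t = linear_mapsD[OF prod_linear_right[OF ST cocyclesD(1)[OF y'(1)], of 0]]
  note c = product_cocycle[OF ST y'(1), of _ 0]
  show "sprod (H0_algebra X) S T y \<in> linear_maps R (cohomology X T 0) (cohomology X (S \<union> T) 0)"
  proof (rule linear_mapsI)
    fix x assume "x \<in> carrier (cohomology X T 0)"
    then obtain x' where x': "x' \<in> cocycles X T 0" "x = cohomology_class T 0 x'" by (rule cohomologyE)
    show "sprod (H0_algebra X) S T y x \<in> carrier (cohomology X (S \<union> T) 0)"
      using ST x' y' c by (simp add: H0_sprod cohomology_class_closed)
    show "sprod (H0_algebra X) S T y (r \<odot>\<^bsub>cohomology X T 0\<^esub> x) =
        r \<odot>\<^bsub>cohomology X (S \<union> T) 0\<^esub> sprod (H0_algebra X) S T y x" if "r \<in> carrier R" for r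
      using ST fin x' y' that c t
      by (simp add: H0_sprod cocyclesD cocycle_operations(2) flip: cocycle_operations(4))
    fix z assume "z \<in> carrier (cohomology X T 0)"
    then obtain z' where z': "z' \<in> cocycles X T 0" "z = cohomology_class T 0 z'" by (rule cohomologyE)
    show "sprod (H0_algebra X) S T y (x \<oplus>\<^bsub>cohomology X T 0\<^esub> z) =
        sprod (H0_algebra X) S T y x \<oplus>\<^bsub>cohomology X (S \<union> T) 0\<^esub> sprod (H0_algebra X) S T y z"
      using ST fin x' y' z' c t
      by (simp add: H0_sprod cocyclesD cocycle_operations(1) flip: cocycle_operations(3))
  qed
next
  fix S T :: "'a set" and x y
  assume ST: "finite S" "finite T" "S \<inter> T = {}"
    and "x \<in> carrier (cohomology X S 0)" "y \<in> carrier (cohomology X T 0)"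
  then obtain x' y' where x': "x' \<in> cocycles X S 0" "x = cohomology_class S 0 x'"
    and y': "y' \<in> cocycles X T 0" "y = cohomology_class T 0 y'" by (elim cohomologyE)
  note xy = product_cocycle[OF ST x'(1) y'(1)]
  show "stransport (H0_algebra X) \<sigma> (S \<union> T) (sprod (H0_algebra X) S T x y) =
      sprod (H0_algebra X) (\<sigma> ` S) (\<sigma> ` T) (stransport (H0_algebra X) \<sigma> S x) (stransport (H0_algebra X) \<sigma> T y)"
    if "inj_on \<sigma> (S \<union> T)" for \<sigma>
  proof -
    have \<sigma>: "inj_on \<sigma> S" "inj_on \<sigma> T" "\<sigma> ` S \<inter> \<sigma> ` T = {}" using that ST by (auto simp: inj_on_def)
    have fin: "finite (S \<union> T)" "finite (\<sigma> ` S)" "finite (\<sigma> ` T)" using ST by auto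
    show ?thesis
      using H0_stransport[OF fin(1) that, of "product X S T 0 0 x' y'"] xy
        prod_natural[OF ST that cocyclesD(1)[OF x'(1)] cocyclesD(1)[OF y'(1)]]
      by (simp add: x' y' \<sigma> ST fin H0_stransport H0_sprod transport_cocycle image_Un)
  qed
  fix U :: "'a set" and z
  assume U: "finite U" "S \<inter> U = {}" "T \<inter> U = {}" and "z \<in> carrier (cohomology X U 0)"
  then obtain z' where z': "z' \<in> cocycles X U 0" "z = cohomology_class U 0 z'" by (elim cohomologyE)
  have fin: "finite (S \<union> T)" "finite (T \<union> U)" "(S \<union> T) \<inter> U = {}" "S \<inter> (T \<union> U) = {}"
    using ST U by auto
  show "sprod (H0_algebra X) (S \<union> T) U (sprod (H0_algebra X) S T x y) z =
      sprod (H0_algebra X) S (T \<union> U) x (sprod (H0_algebra X) T U y z)"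
    using prod_assoc[OF ST(1,2) U(1) ST(3) U(2,3) cocyclesD(1)[OF x'(1)] cocyclesD(1)[OF y'(1)] cocyclesD(1)[OF z'(1)]]
      xy product_cocycle[OF ST(2) U(1) U(3) y'(1) z'(1)]
    by (simp add: x' y' z' ST U fin H0_sprod Un_assoc)
next
  show "cohomology_class {} 0 (unit_element X) \<in> carrier (cohomology X {} 0)"
    using unit_cocycle by (rule cohomology_class_closed)
qed

end

section \<open>The projection of a nonpositively graded algebra\<close>

context dg_algebra_in_species
begin

definition H0_projection :: "'a set \<Rightarrow> int \<Rightarrow> 'm \<Rightarrow> 'm set" where
  "H0_projection I n x = (if n = 0 then cohomology_class I 0 x else \<zero>\<^bsub>cohomology X I 0\<^esub>)"

lemma dg_algebra_H0: "dg_algebra_in_species R (in_degree_zero (H0_algebra X))"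
  using algebra_in_species.dg_algebra_in_degree_zero[OF algebra_H0] .

end

lemma in_degree_zero_coboundaries:
  assumes "carrier (component (in_degree_zero A) I (n - 1)) \<noteq> {}"
  shows "coboundaries (in_degree_zero A) I n = {\<zero>\<^bsub>scomp A I\<^esub>}"
  using assms by (auto simp: coboundaries_def simp del: in_degree_zero_sel(1))

lemma in_degree_zero_cocycles:
  "cocycles (in_degree_zero A) I n = carrier (component (in_degree_zero A) I n)"
  by (simp add: cocycles_def)

locale nonpositive_dg_algebra = dg_algebra_in_species R X
  for R :: "('k, 'z) ring_scheme" (structure) and X :: "('a, 'k, 'm) dg_species_alg" +
  assumes nonpositive: "finite I \<Longrightarrow> 0 < n \<Longrightarrow> carrier (component X I n) = {\<zero>\<^bsub>component X I n\<^esub>}"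
begin

abbreviation H0_dg where "H0_dg \<equiv> in_degree_zero (H0_algebra X)"

lemma cocycles_0: "finite I \<Longrightarrow> cocycles X I 0 = carrier (component X I 0)"
  using linear_mapsD(1)[OF diff_linear, of I _ 0] nonpositive[of I 1] by (auto simp: cocycles_def)

text \<open>
  The only case of multiplicativity that is not immediate is that of degrees \<open>m\<close> and \<open>- m\<close> with
  \<open>m \<noteq> 0\<close>: one of them is positive, so the corresponding factor and the product vanish.
\<close>

lemma H0_projection_morphism: "dg_algebra_morphism R X H0_dg H0_projection"
proof (intro dg_algebra_morphism.intro dg_algebra_morphism_axioms.intro
    dg_algebra_in_species_axioms dg_algebra_H0)
  fix I :: "'a set" and n assume I: "finite I"
  interpret H: module R "cohomology X I 0" using I by (rule module_cohomology)
  have cl: "cohomology_class I 0 \<in> linear_maps R (component X I 0) (cohomology X I 0)"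
    using cohomology_class_linear[OF I, of 0] cocycles_0[OF I] by (simp add: linear_maps_def)
  show "H0_projection I n \<in> linear_maps R (component X I n) (component H0_dg I n)"
    by (cases "n = 0"; rule linear_mapsI) (simp_all add: H0_projection_def linear_mapsD[OF cl])
  fix x assume x: "x \<in> carrier (component X I n)"
  show "H0_projection (\<sigma> ` I) n (transport X \<sigma> I n x) = transport H0_dg \<sigma> I n (H0_projection I n x)"
    if "inj_on \<sigma> I" for \<sigma>
    using x I that by (cases "n = 0") (simp_all add: H0_projection_def H0_stransport cocycles_0)
  have "cohomology_class I 0 (differential X I n x) = coboundaries X I 0" if "n + 1 = 0"
  proof -
    have n: "n = -1" using that by simp
    have "differential X I n x \<in> coboundaries X I 0"
      using x unfolding n coboundaries_def by simp
    then show ?thesis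
      by (intro abelian_subgroup.a_rcos_const[of _ "cocycle_module I 0", unfolded a_r_coset_carrier_update])
        (intro abelian_subgroupI3 additive_subgroupI submodule.axioms(1)[OF submodule_coboundaries[OF I]]
          module.axioms(2)[OF module_cocycles[OF I]])
  qed
  then show "H0_projection I (n + 1) (differential X I n x) = differential H0_dg I n (H0_projection I n x)"
    by (simp add: H0_projection_def zero_cohomology)
next
  fix S T :: "'a set" and x y m n
  assume ST: "finite S" "finite T" "S \<inter> T = {}"
    and x: "x \<in> carrier (component X S m)" and y: "y \<in> carrier (component X T n)"
  interpret H: module R "cohomology X (S \<union> T) 0" using ST by (intro module_cohomology) auto
  have fin: "finite (S \<union> T)" using ST by simp
  consider "m = 0" "n = 0" | "m + n \<noteq> 0" | "m + n = 0" "0 < m" | "m + n = 0" "0 < n" by linarith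
  then show "H0_projection (S \<union> T) (m + n) (product X S T m n x y) =
      product H0_dg S T m n (H0_projection S m x) (H0_projection T n y)"
  proof cases
    case 1
    then show ?thesis using ST x y by (simp add: H0_projection_def H0_sprod cocycles_0)
  next
    case 2
    then show ?thesis by (auto simp: H0_projection_def)
  next
    case 3
    have "product X S T m n x y = \<zero>\<^bsub>component X (S \<union> T) (m + n)\<^esub>"
      using nonpositive[OF ST(1) 3(2)] x product_zero(1)[OF ST y] by simp
    moreover have "cohomology_class (S \<union> T) 0 \<zero>\<^bsub>component X (S \<union> T) 0\<^esub> = \<zero>\<^bsub>cohomology X (S \<union> T) 0\<^esub>"
      using linear_maps_zero[OF module_cocycles[OF fin] module_cohomology[OF fin] cohomology_class_linear[OF fin], of 0]
      by simp
    ultimately show ?thesis using 3 by (simp add: H0_projection_def)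
  next
    case 4
    have "product X S T m n x y = \<zero>\<^bsub>component X (S \<union> T) (m + n)\<^esub>"
      using nonpositive[OF ST(2) 4(2)] y product_zero(2)[OF ST x] by simp
    moreover have "cohomology_class (S \<union> T) 0 \<zero>\<^bsub>component X (S \<union> T) 0\<^esub> = \<zero>\<^bsub>cohomology X (S \<union> T) 0\<^esub>"
      using linear_maps_zero[OF module_cocycles[OF fin] module_cohomology[OF fin] cohomology_class_linear[OF fin], of 0]
      by simp
    ultimately show ?thesis using 4 by (simp add: H0_projection_def)
  qed
next
  show "H0_projection {} 0 (unit_element X) = unit_element H0_dg"
    by (simp add: H0_projection_def H0_sunit)
qed

text \<open>
  The target has zero differential, so its only coboundary is zero and its cohomology classes
  are singletons.  In degree 0 the induced map is therefore \<open>A \<mapsto> {A}\<close>.  In any other degree both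
  sides are zero modules.
\<close>

lemma H0_projection_cohomology_iso:
  assumes exact: "n < 0 \<Longrightarrow> cocycles X I n = coboundaries X I n" and I: "finite I"
  shows "cohomology_map H0_dg H0_projection I n \<in> linear_isos R (cohomology X I n) (cohomology H0_dg I n)"
proof -
  interpret Y: dg_algebra_in_species R H0_dg by (rule dg_algebra_H0)
  interpret H: module R "cohomology X I 0" using I by (rule module_cohomology)
  have "coboundaries H0_dg I n = {\<zero>\<^bsub>cohomology X I 0\<^esub>}"
    unfolding H0_scomp[symmetric]
    by (rule in_degree_zero_coboundaries) (use Y.zero_closed[OF I] in blast)
  have cosetY: "Y.cohomology_class I n A = {A}" if "A \<in> carrier (cohomology X I 0)" for A
    using that \<open>coboundaries H0_dg I n = _\<close> by (simp add: a_r_coset_def')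
  have map: "cohomology_map H0_dg H0_projection I n A = (\<Union>x\<in>A. {H0_projection I n x})"
    if "\<And>x. x \<in> A \<Longrightarrow> H0_projection I n x \<in> carrier (cohomology X I 0)" for A
    unfolding cohomology_map_def using cosetY that by auto
  show ?thesis
  proof (cases "n = 0")
    case True
    have eval: "cohomology_map H0_dg H0_projection I n A = {A}" if "A \<in> carrier (cohomology X I n)" for A
    proof -
      from that obtain x where x: "x \<in> cocycles X I 0" "A = cohomology_class I 0 x"
        unfolding True by (rule cohomologyE)
      have "H0_projection I n y = A" if "y \<in> A" for y
        using that x in_cohomology_class_iff[OF I x(1)] True by (simp add: H0_projection_def)
      moreover have "x \<in> A" using x in_cohomology_class_iff[OF I x(1)] by simp
      moreover have "A \<in> carrier (cohomology X I 0)" using that True by simp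
      ultimately show ?thesis using map[of A] by auto
    qed
    have carrierY: "carrier (cohomology H0_dg I n) = (\<lambda>A. {A}) ` carrier (cohomology X I 0)"
      using cosetY True by (simp add: Y.carrier_cohomology in_degree_zero_cocycles)
    note cY = cohomology_def[of H0_dg I]
    show ?thesis unfolding linear_isos_def
    proof (intro CollectI conjI linear_mapsI)
      fix A assume A: "A \<in> carrier (cohomology X I n)"
      then show "cohomology_map H0_dg H0_projection I n A \<in> carrier (cohomology H0_dg I n)"
        using eval carrierY True by simp
      fix r assume r: "r \<in> carrier R"
      then show "cohomology_map H0_dg H0_projection I n (r \<odot>\<^bsub>cohomology X I n\<^esub> A) =
          r \<odot>\<^bsub>cohomology H0_dg I n\<^esub> cohomology_map H0_dg H0_projection I n A"
        using A True eval[of A] eval[of "r \<odot>\<^bsub>cohomology X I n\<^esub> A"] cosetY[of "r \<odot>\<^bsub>cohomology X I n\<^esub> A"]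
        by (simp add: cY quotient_module_sel)
    next
      fix A B assume "A \<in> carrier (cohomology X I n)" "B \<in> carrier (cohomology X I n)"
      then show "cohomology_map H0_dg H0_projection I n (A \<oplus>\<^bsub>cohomology X I n\<^esub> B) =
          cohomology_map H0_dg H0_projection I n A \<oplus>\<^bsub>cohomology H0_dg I n\<^esub> cohomology_map H0_dg H0_projection I n B"
        using True eval[of A] eval[of B] eval[of "A \<oplus>\<^bsub>cohomology X I n\<^esub> B"]
        by (simp add: cY quotient_module_sel set_add_def')
    next
      show "bij_betw (cohomology_map H0_dg H0_projection I n) (carrier (cohomology X I n)) (carrier (cohomology H0_dg I n))"
        using eval True unfolding carrierY
        by (intro bij_betw_imageI) (auto simp: inj_on_def)
    qed
  next
    case False
    let ?B = "coboundaries X I n"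
    interpret Q: module R "cohomology X I n" using I by (rule module_cohomology)
    interpret QY: module R "cohomology H0_dg I n" using I by (rule Y.module_cohomology)
    have "cocycles X I n \<subseteq> ?B"
    proof (cases "n < 0")
      case True
      then show ?thesis using exact by simp
    next
      case n: False
      then have "cocycles X I n \<subseteq> {\<zero>\<^bsub>component X I n\<^esub>}"
        using False nonpositive[OF I, of n] by (auto simp: cocycles_def)
      moreover have "\<zero>\<^bsub>component X I n\<^esub> \<in> ?B"
        using submodule.axioms(1)[OF submodule_coboundaries[OF I, of n]] subgroup.one_closed by fastforce
      ultimately show ?thesis by auto
    qed
    moreover have "cohomology_class I n x = ?B" if "x \<in> ?B" for x
      using that
      by (intro abelian_subgroup.a_rcos_const[of _ "cocycle_module I n", unfolded a_r_coset_carrier_update])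
        (intro abelian_subgroupI3 additive_subgroupI submodule.axioms(1)[OF submodule_coboundaries[OF I]]
          module.axioms(2)[OF module_cocycles[OF I]])
    ultimately have "carrier (cohomology X I n) \<subseteq> {?B}"
      by (auto simp: carrier_cohomology)
    then have cX: "carrier (cohomology X I n) = {\<zero>\<^bsub>cohomology X I n\<^esub>}"
      using Q.M.zero_closed by (auto simp: zero_cohomology)
    have cY: "carrier (cohomology H0_dg I n) = {\<zero>\<^bsub>cohomology H0_dg I n\<^esub>}"
      using cosetY False \<open>coboundaries H0_dg I n = _\<close>
      by (simp add: Y.carrier_cohomology Y.zero_cohomology in_degree_zero_cocycles)
    have "?B \<noteq> {}" using Q.M.zero_closed I
      by (auto simp: cX carrier_cohomology zero_cohomology coboundaries_def dest: zero_closed[of I "n - 1"])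
    then have "cohomology_map H0_dg H0_projection I n \<zero>\<^bsub>cohomology X I n\<^esub> = \<zero>\<^bsub>cohomology H0_dg I n\<^esub>"
      using map[of ?B] False \<open>coboundaries H0_dg I n = _\<close> H.M.zero_closed
      by (auto simp: zero_cohomology Y.zero_cohomology H0_projection_def)
    then show ?thesis
      by (auto simp: linear_isos_def cX cY bij_betw_def intro!: linear_mapsI)
  qed
qed

theorem H0_projection_quasi_iso:
  assumes "\<And>I n. finite I \<Longrightarrow> n < 0 \<Longrightarrow> cocycles X I n = coboundaries X I n"
  shows "dg_algebra_quasi_iso R X H0_dg H0_projection"
  by (intro dg_algebra_quasi_iso.intro H0_projection_morphism dg_algebra_quasi_iso_axioms.intro
      H0_projection_cohomology_iso) (use assms in auto)

end

section \<open>Set compositions\<close>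

lemma set_composition_Nil [simp]: "set_composition I [] \<longleftrightarrow> I = {}"
  by (auto simp: set_composition_def)

text \<open>
  Read from the left, a composition of \<open>I\<close> is a nonempty block \<open>A\<close> followed by a composition of \<open>I - A\<close>.
  This recursive form makes the notion accessible to induction on lists.
\<close>

lemma set_composition_Cons [simp]:
  "set_composition I (A # w) \<longleftrightarrow> A \<noteq> {} \<and> A \<subseteq> I \<and> set_composition (I - A) w"
proof -
  have "(\<forall>i<length (A # w). \<forall>j<length (A # w). i \<noteq> j \<longrightarrow> (A # w) ! i \<inter> (A # w) ! j = {})
    \<longleftrightarrow> (\<forall>B\<in>set w. A \<inter> B = {}) \<and>
      (\<forall>i<length w. \<forall>j<length w. i \<noteq> j \<longrightarrow> w ! i \<inter> w ! j = {})"
    by (simp add: All_less_Suc2 all_set_conv_all_nth Int_commute) blast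
  moreover have "A \<union> \<Union>(set w) = I \<and> (\<forall>B\<in>set w. A \<inter> B = {})
    \<longleftrightarrow> A \<subseteq> I \<and> \<Union>(set w) = I - A" by blast
  ultimately show ?thesis by (auto simp: set_composition_def)
qed

lemma set_composition_append [simp]:
  "set_composition I (u @ v) \<longleftrightarrow>
    (\<exists>J\<subseteq>I. set_composition J u \<and> set_composition (I - J) v)"
proof (induction u arbitrary: I)
  case (Cons A u)
  have "(\<exists>J\<subseteq>I - A. set_composition J u \<and> set_composition (I - A - J) v) \<longleftrightarrow>
      (\<exists>J. A \<subseteq> J \<and> J \<subseteq> I \<and> set_composition (J - A) u \<and> set_composition (I - J) v)"
    if "A \<subseteq> I"
  proof safe
    fix J assume J: "J \<subseteq> I - A" "set_composition J u" "set_composition (I - A - J) v"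
    have "A \<union> J - A = J" "I - (A \<union> J) = I - A - J" using J by auto
    then show "\<exists>J. A \<subseteq> J \<and> J \<subseteq> I \<and> set_composition (J - A) u \<and> set_composition (I - J) v"
      using J that by (intro exI[of _ "A \<union> J"]) auto
  next
    fix J assume J: "A \<subseteq> J" "J \<subseteq> I" "set_composition (J - A) u" "set_composition (I - J) v"
    have "I - A - (J - A) = I - J" using J by auto
    then show "\<exists>J\<subseteq>I - A. set_composition J u \<and> set_composition (I - A - J) v"
      using J by (intro exI[of _ "J - A"]) auto
  qed
  then show ?case by (simp add: Cons.IH) blast
qed simp

lemma set_composition_length_le: "finite I \<Longrightarrow> set_composition I w \<Longrightarrow> length w \<le> card I"
proof (induction w arbitrary: I)
  case (Cons A w)
  then have "length w \<le> card (I - A)" "A \<noteq> {}" "A \<subseteq> I" by auto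
  moreover from this Cons have "card (I - A) < card I"
    by (intro psubset_card_mono) auto
  ultimately show ?case by simp
qed simp

lemma compositions_positive_degree: "finite I \<Longrightarrow> 0 < n \<Longrightarrow> compositions I n = {}"
  by (auto simp: compositions_def dest: set_composition_length_le)

lemma finite_compositions [simp, intro]: "finite I \<Longrightarrow> finite (compositions I n)"
proof (rule finite_subset)
  assume "finite I"
  then show "compositions I n \<subseteq> {w. set w \<subseteq> Pow I \<and> length w \<le> card I}"
    using set_composition_length_le by (auto simp: compositions_def set_composition_def)
  show "finite {w. set w \<subseteq> Pow I \<and> length w \<le> card I}"
    using \<open>finite I\<close> by (intro finite_lists_length_le) simp
qed

lemma compositions_empty: "compositions {} n = (if n = 0 then {[]} else {})"
proof -
  have "set_composition {} w \<longleftrightarrow> w = []" for w :: "'a set list" by (cases w) auto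
  then show ?thesis by (auto simp: compositions_def)
qed

lemma set_composition_map:
  assumes "inj_on \<sigma> I"
  shows "set_composition I w \<Longrightarrow> set_composition (\<sigma> ` I) (map ((`) \<sigma>) w)"
  using assms
proof (induction w arbitrary: I)
  case (Cons A w)
  then have "\<sigma> ` (I - A) = \<sigma> ` I - \<sigma> ` A" by (intro inj_on_image_set_diff) auto
  then show ?case using Cons by (metis (no_types) Diff_subset image_is_empty image_mono
    inj_on_subset list.simps(9) set_composition_Cons)
qed simp

lemma map_image_compositions:
  assumes "inj_on \<sigma> I"
  shows "w \<in> compositions I n \<Longrightarrow> map ((`) \<sigma>) w \<in> compositions (\<sigma> ` I) n"
  using set_composition_map[OF assms] card_image[OF assms] by (auto simp: compositions_def)

lemma append_compositions:
  assumes "finite S" "finite T" "S \<inter> T = {}" "F \<in> compositions S m" "G \<in> compositions T n"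
  shows "F @ G \<in> compositions (S \<union> T) (m + n)"
proof -
  have "S \<union> T - S = T" using assms by auto
  then have "set_composition (S \<union> T) (F @ G)"
    using assms by (auto simp: compositions_def intro!: exI[of _ S])
  then show ?thesis using assms by (auto simp: compositions_def card_Un_disjoint)
qed

lemma set_composition_split_block:
  assumes "set_composition I (u @ C # v)" "(A, B) \<in> splittings C"
  shows "set_composition I (u @ A # B # v)"
proof -
  from assms(1) obtain J where J: "J \<subseteq> I" "set_composition J u" "C \<subseteq> I - J" "set_composition (I - J - C) v"
    by auto
  have AB: "A \<noteq> {}" "B \<noteq> {}" "A \<inter> B = {}" "A \<union> B = C" using assms(2) by (auto simp: splittings_def)
  then have "I - J - C = I - J - A - B" by auto
  then have "set_composition (I - J) (A # B # v)" using J AB by auto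
  then show ?thesis using J by auto
qed

lemma set_composition_merge_blocks:
  assumes "set_composition I (u @ A # B # v)"
  shows "set_composition I (u @ (A \<union> B) # v)" "(A, B) \<in> splittings (A \<union> B)"
proof -
  from assms obtain J where J: "J \<subseteq> I" "set_composition J u" "set_composition (I - J) (A # B # v)"
    by auto
  have "I - J - (A \<union> B) = I - J - A - B" by auto
  then have "set_composition (I - J) ((A \<union> B) # v)" using J by auto
  then show "set_composition I (u @ (A \<union> B) # v)" using J by auto
  show "(A, B) \<in> splittings (A \<union> B)" using J by (auto simp: splittings_def)
qed

lemma finite_splittings: "finite C \<Longrightarrow> finite (splittings C)"
  by (rule finite_subset[of _ "Pow C \<times> Pow C"]) (auto simp: splittings_def)

abbreviation split_at :: "'a set list \<Rightarrow> nat \<Rightarrow> 'a set \<times> 'a set \<Rightarrow> 'a set list" where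
  "split_at F i P \<equiv> take i F @ [fst P, snd P] @ drop (Suc i) F"

lemma set_composition_nth_subset: "set_composition I F \<Longrightarrow> i < length F \<Longrightarrow> F ! i \<subseteq> I"
  by (auto simp: set_composition_def)

lemma split_at_compositions:
  assumes "F \<in> compositions I n" "i < length F" "P \<in> splittings (F ! i)"
  shows "split_at F i P \<in> compositions I (n + 1)"
proof -
  have "set_composition I (take i F @ F ! i # drop (Suc i) F)"
    using assms by (simp add: compositions_def flip: id_take_nth_drop)
  then have "set_composition I (take i F @ fst P # snd P # drop (Suc i) F)"
    using assms(3) by (intro set_composition_split_block) auto
  then show ?thesis using assms by (auto simp: compositions_def simp del: set_composition_append set_composition_Cons)
qed

text \<open>
  Splitting a block commutes with relabelling it; this is the source of the naturality of the differential.
\<close>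

lemma splittings_image:
  assumes "inj_on \<sigma> C"
  shows "splittings (\<sigma> ` C) = map_prod ((`) \<sigma>) ((`) \<sigma>) ` splittings C"
    and "inj_on (map_prod ((`) \<sigma>) ((`) \<sigma>)) (splittings C)"
proof -
  show "inj_on (map_prod ((`) \<sigma>) ((`) \<sigma>)) (splittings C)"
    by (rule inj_on_subset[OF map_prod_inj_on[OF inj_on_image_Pow inj_on_image_Pow]])
      (use assms in \<open>auto simp: splittings_def\<close>)
  show "splittings (\<sigma> ` C) = map_prod ((`) \<sigma>) ((`) \<sigma>) ` splittings C"
  proof (intro equalityI subsetI)
    fix P assume "P \<in> splittings (\<sigma> ` C)"
    then obtain A B where P: "P = (A, B)" "A \<noteq> {}" "B \<noteq> {}" "A \<inter> B = {}" "A \<union> B = \<sigma> ` C"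
      by (auto simp: splittings_def)
    let ?A = "{c \<in> C. \<sigma> c \<in> A}" and ?B = "{c \<in> C. \<sigma> c \<in> B}"
    have AB: "\<sigma> ` ?A = A" "\<sigma> ` ?B = B" using P by auto
    have "?A \<noteq> {}" "?B \<noteq> {}" using AB P(2,3) by (metis image_empty)+
    moreover have "?A \<inter> ?B = {}" "?A \<union> ?B = C" using P(4,5) by blast+
    ultimately have "(?A, ?B) \<in> splittings C" unfolding splittings_def by blast
    moreover have "P = map_prod ((`) \<sigma>) ((`) \<sigma>) (?A, ?B)" by (simp only: P(1) map_prod_simp AB)
    ultimately show "P \<in> map_prod ((`) \<sigma>) ((`) \<sigma>) ` splittings C" by (rule rev_image_eqI)
  next
    fix P assume "P \<in> map_prod ((`) \<sigma>) ((`) \<sigma>) ` splittings C"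
    then obtain A B where P: "P = (\<sigma> ` A, \<sigma> ` B)" "A \<noteq> {}" "B \<noteq> {}" "A \<inter> B = {}" "A \<union> B = C"
      by (auto simp: splittings_def)
    then have "\<sigma> ` A \<inter> \<sigma> ` B = {}"
      using inj_on_image_Int[OF assms, of A B] by auto
    then show "P \<in> splittings (\<sigma> ` C)" using P by (auto simp: splittings_def)
  qed
qed

lemma set_composition_insert_singleton:
  assumes "set_composition I (u @ v)" "a \<notin> I"
  shows "set_composition (insert a I) (u @ {a} # v)"
proof -
  obtain J where J: "J \<subseteq> I" "set_composition J u" "set_composition (I - J) v" using assms(1) by auto
  then have "insert a I - J - {a} = I - J" "a \<notin> J" using assms(2) by auto
  then show ?thesis using J by (auto intro!: exI[of _ J])
qed

text \<open>
  The words at which the contracting homotopy evaluates its argument are again compositions.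
\<close>

lemma set_composition_extract:
  assumes "set_composition I (u @ C # v @ w)" "a \<in> C" "C \<noteq> {a}"
  shows "set_composition I (u @ (C - {a}) # v @ {a} # w)"
proof -
  obtain J where J: "J \<subseteq> I" "set_composition J u" "set_composition (I - J) (C # v @ w)"
    using assms(1) by auto
  then obtain K where K: "C \<subseteq> I - J" "K \<subseteq> I - J - C" "set_composition K v" "set_composition (I - J - C - K) w"
    by auto
  have "I - J - (C - {a}) - K - {a} = I - J - C - K" using assms(2) by auto
  then have "set_composition (I - J - (C - {a}) - K) ({a} # w)" using K assms(2) by auto
  then have "set_composition (I - J - (C - {a})) (v @ {a} # w)"
    using K unfolding set_composition_append by blast
  then have "set_composition (I - J) ((C - {a}) # v @ {a} # w)" using K(1) assms(2,3) by auto
  then show ?thesis using J unfolding set_composition_append by blast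
qed

section \<open>Merging, inserting and extracting blocks\<close>

text \<open>
  The operators below act on functions \<open>f\<close> on lists of blocks.  Recursion on a list \<open>A # w\<close> separates the terms that
  involve the first block from those of the operator applied to the function \<open>f (A # _)\<close>; the sign records that
  passing a block costs a factor \<open>- 1\<close>.
\<close>

context cring
begin

text \<open>
  The value of \<open>f\<close> at the list \<open>A # w\<close> with its first two blocks merged.  If \<open>w\<close> is empty, there is
  nothing to merge, and the value is zero.
\<close>

primrec merge_first :: "('x set list \<Rightarrow> 'a) \<Rightarrow> 'x set \<Rightarrow> 'x set list \<Rightarrow> 'a" where
  "merge_first f A [] = \<zero>"
| "merge_first f A (B # w) = f ((A \<union> B) # w)"

text \<open>
  For a composition \<open>w\<close> this is the coefficient of \<open>d f\<close> at \<open>w\<close>.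
\<close>

primrec merge_sum :: "('x set list \<Rightarrow> 'a) \<Rightarrow> 'x set list \<Rightarrow> 'a" where
  "merge_sum f [] = \<zero>"
| "merge_sum f (A # w) = \<ominus> merge_first f A w \<ominus> merge_sum (\<lambda>v. f (A # v)) w"

text \<open>
  The alternating sum of \<open>f\<close> over all ways to insert a block \<open>{a}\<close> into \<open>w\<close>.  In terms of basis elements it
  describes the map that deletes a block \<open>{a}\<close>, with a sign given by its position, and that sends
  compositions in which \<open>a\<close> has company to zero.
\<close>

primrec insert_sum :: "'x \<Rightarrow> ('x set list \<Rightarrow> 'a) \<Rightarrow> 'x set list \<Rightarrow> 'a" where
  "insert_sum a f [] = f [{a}]"
| "insert_sum a f (A # w) = f ({a} # A # w) \<ominus> insert_sum a (\<lambda>v. f (A # v)) w"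

text \<open>
  The contracting homotopy: a signed sum over the ways to take \<open>a\<close> out of its block and to put it as a block
  \<open>{a}\<close> further to the right.  In terms of basis elements, a composition in which \<open>{a}\<close> is a block goes to a signed sum of the
  compositions in which \<open>a\<close> has joined one of the blocks before it.
\<close>

primrec extract_sum :: "'x \<Rightarrow> ('x set list \<Rightarrow> 'a) \<Rightarrow> 'x set list \<Rightarrow> 'a" where
  "extract_sum a f [] = \<zero>"
| "extract_sum a f (A # w) =
    (if A = {a} then \<zero>
     else if a \<in> A then \<ominus> insert_sum a (\<lambda>v. f ((A - {a}) # v)) w
     else \<ominus> extract_sum a (\<lambda>v. f (A # v)) w)"

lemma merge_first_closed [simp, intro]: "(\<And>v. f v \<in> carrier R) \<Longrightarrow> merge_first f A w \<in> carrier R"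
  by (cases w) auto

lemma merge_sum_closed [simp, intro]: "(\<And>v. f v \<in> carrier R) \<Longrightarrow> merge_sum f w \<in> carrier R"
  by (induction w arbitrary: f) auto

lemma insert_sum_closed [simp, intro]: "(\<And>v. f v \<in> carrier R) \<Longrightarrow> insert_sum a f w \<in> carrier R"
  by (induction w arbitrary: f) auto

lemma extract_sum_closed [simp, intro]: "(\<And>v. f v \<in> carrier R) \<Longrightarrow> extract_sum a f w \<in> carrier R"
  by (induction w arbitrary: f) auto

lemma merge_first_add:
  assumes "\<And>v. f v \<in> carrier R" "\<And>v. g v \<in> carrier R"
  shows "merge_first (\<lambda>v. f v \<oplus> g v) A w = merge_first f A w \<oplus> merge_first g A w"
  using assms by (cases w) auto

lemma merge_first_minus: "merge_first (\<lambda>v. \<ominus> f v) A w = \<ominus> merge_first f A w"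
  by (cases w) auto

lemma merge_sum_add:
  assumes "\<And>v. f v \<in> carrier R" "\<And>v. g v \<in> carrier R"
  shows "merge_sum (\<lambda>v. f v \<oplus> g v) w = merge_sum f w \<oplus> merge_sum g w"
  using assms
  by (induction w arbitrary: f g) (simp_all add: merge_first_add minus_eq minus_add a_ac)

lemma merge_sum_minus:
  assumes "\<And>v. f v \<in> carrier R"
  shows "merge_sum (\<lambda>v. \<ominus> f v) w = \<ominus> merge_sum f w"
  using assms
  by (induction w arbitrary: f) (simp_all add: merge_first_minus minus_eq minus_add a_ac)

lemma insert_sum_add:
  assumes "\<And>v. f v \<in> carrier R" "\<And>v. g v \<in> carrier R"
  shows "insert_sum a (\<lambda>v. f v \<oplus> g v) w = insert_sum a f w \<oplus> insert_sum a g w"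
  using assms by (induction w arbitrary: f g) (simp_all add: minus_eq minus_add a_ac)

lemma insert_sum_minus:
  assumes "\<And>v. f v \<in> carrier R"
  shows "insert_sum a (\<lambda>v. \<ominus> f v) w = \<ominus> insert_sum a f w"
  using assms by (induction w arbitrary: f) (simp_all add: minus_eq minus_add a_ac)

lemma extract_sum_add:
  assumes "\<And>v. f v \<in> carrier R" "\<And>v. g v \<in> carrier R"
  shows "extract_sum a (\<lambda>v. f v \<oplus> g v) w = extract_sum a f w \<oplus> extract_sum a g w"
  using assms
  by (induction w arbitrary: f g) (simp_all add: insert_sum_add minus_add a_ac)

lemma extract_sum_minus:
  assumes "\<And>v. f v \<in> carrier R"
  shows "extract_sum a (\<lambda>v. \<ominus> f v) w = \<ominus> extract_sum a f w"
  using assms by (induction w arbitrary: f) (simp_all add: insert_sum_minus)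

lemmas word_sum_linear =
  merge_sum_add merge_sum_minus insert_sum_add insert_sum_minus extract_sum_add extract_sum_minus

text \<open>
  Merging \<open>A\<close> with its right neighbour commutes with merging two blocks of the remaining list, also if these overlap,
  because the union of sets is associative.
\<close>

lemma merge_first_merge_sum:
  assumes "\<And>v. f v \<in> carrier R"
  shows "merge_first (merge_sum f) A w = merge_sum (merge_first f A) w"
proof (cases w)
  case (Cons B u)
  then show ?thesis by (cases u) (simp_all add: Un_assoc)
qed simp

text \<open>
  Any two merges can be done in either order, and the two orders come with opposite signs.
\<close>

lemma merge_sum_merge_sum:
  assumes "\<And>v. f v \<in> carrier R"
  shows "merge_sum (merge_sum f) w = \<zero>"
  using assms
proof (induction w arbitrary: f)
  case (Cons A w)
  then show ?case
    by (simp add: merge_first_merge_sum word_sum_linear minus_eq r_neg l_neg)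
qed simp

lemma insert_sum_merge_first:
  assumes "\<And>v. f v \<in> carrier R"
  shows "insert_sum a (merge_first f A) w
    = f ((A \<union> {a}) # w) \<oplus> (merge_first (insert_sum a f) A w \<ominus> merge_first (\<lambda>v. f ({a} # v)) A w)"
proof (cases w)
  case (Cons B u)
  have "p \<ominus> q = p \<oplus> ((r \<ominus> q) \<ominus> r)" if "p \<in> carrier R" "q \<in> carrier R" "r \<in> carrier R" for p q r
    using that by algebra
  then show ?thesis using assms Cons by simp
qed (use assms in \<open>simp add: minus_eq\<close>)

text \<open>
  Insertion anticommutes with the differential.  A merge of \<open>{a}\<close> with a block \<open>A\<close>
  arises twice, with \<open>{a}\<close> to the left and to the right of \<open>A\<close>, and these two terms have opposite
  signs.
\<close>

lemma insert_sum_merge_sum: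
  assumes "\<And>v. f v \<in> carrier R"
  shows "insert_sum a (merge_sum f) w = \<ominus> merge_sum (insert_sum a f) w"
  using assms
proof (induction w arbitrary: f)
  case (Cons A w)
  \<comment> \<open>\<open>p\<close> stands for the merge of \<open>A\<close> with \<open>{a}\<close>, \<open>x\<close> and \<open>y\<close> for the merges of \<open>A\<close> with the next block\<close>
  have cancel: "\<ominus> p \<ominus> (\<ominus> x \<ominus> m) \<ominus> (\<ominus> (p \<oplus> (y \<ominus> x)) \<oplus> d) = \<ominus> (\<ominus> y \<ominus> (m \<oplus> \<ominus> d))"
    if "p \<in> carrier R" "x \<in> carrier R" "y \<in> carrier R" "m \<in> carrier R" "d \<in> carrier R"
    for p x y m d
    using that by algebra
  have "{a} \<union> A = A \<union> {a}" by auto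
  moreover have "insert_sum a (\<lambda>v. merge_sum f (A # v)) w =
      \<ominus> (f ((A \<union> {a}) # w) \<oplus> (merge_first (insert_sum a f) A w \<ominus> merge_first (\<lambda>v. f ({a} # v)) A w))
      \<oplus> \<ominus> (\<ominus> merge_sum (insert_sum a (\<lambda>v. f (A # v))) w)"
    using Cons.prems
    by (simp add: word_sum_linear insert_sum_merge_first minus_eq[of "\<ominus> _"] Cons.IH)
  moreover have "merge_sum (\<lambda>v. insert_sum a f (A # v)) w =
      merge_sum (\<lambda>v. f ({a} # A # v)) w \<oplus> \<ominus> merge_sum (insert_sum a (\<lambda>v. f (A # v))) w"
    using Cons.prems by (simp add: word_sum_linear minus_eq)
  ultimately show ?case using Cons.prems by (simp add: cancel del: insert_sum.simps(2)) (simp add: cancel)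
qed (simp add: minus_eq)

text \<open>
  The congruence rules list the words at which each operator evaluates \<open>f\<close>.  They allow one to change \<open>f\<close>
  outside the compositions of a given set.
\<close>

lemma merge_sum_cong:
  assumes "\<And>u A B v. w = u @ A # B # v \<Longrightarrow> f (u @ (A \<union> B) # v) = g (u @ (A \<union> B) # v)"
  shows "merge_sum f w = merge_sum g w"
  using assms
proof (induction w arbitrary: f g)
  case (Cons C w)
  have "merge_first f C w = merge_first g C w"
  proof (cases w)
    case (Cons B v)
    then show ?thesis using Cons.prems[of "[]" C B v] by simp
  qed simp
  moreover have "merge_sum (\<lambda>v. f (C # v)) w = merge_sum (\<lambda>v. g (C # v)) w"
    by (rule Cons.IH) (use Cons.prems in \<open>metis append_Cons\<close>)
  ultimately show ?case by simp
qed simp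

lemma insert_sum_cong:
  assumes "\<And>u v. w = u @ v \<Longrightarrow> f (u @ {a} # v) = g (u @ {a} # v)"
  shows "insert_sum a f w = insert_sum a g w"
  using assms
proof (induction w arbitrary: f g)
  case (Cons C w)
  have "insert_sum a (\<lambda>v. f (C # v)) w = insert_sum a (\<lambda>v. g (C # v)) w"
    by (rule Cons.IH) (use Cons.prems in \<open>metis append_Cons\<close>)
  then show ?case using Cons.prems[of "[]"] by simp
qed simp

lemma extract_sum_cong:
  assumes "\<And>u C v v'. w = u @ C # v @ v' \<Longrightarrow> a \<in> C \<Longrightarrow> C \<noteq> {a} \<Longrightarrow>
    f (u @ (C - {a}) # v @ {a} # v') = g (u @ (C - {a}) # v @ {a} # v')"
  shows "extract_sum a f w = extract_sum a g w"
  using assms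
proof (induction w arbitrary: f g)
  case (Cons C w)
  have "extract_sum a (\<lambda>v. f (C # v)) w = extract_sum a (\<lambda>v. g (C # v)) w"
    by (rule Cons.IH) (use Cons.prems in \<open>metis append_Cons\<close>)
  moreover have "insert_sum a (\<lambda>v. f ((C - {a}) # v)) w = insert_sum a (\<lambda>v. g ((C - {a}) # v)) w"
    if "a \<in> C" "C \<noteq> {a}"
    by (rule insert_sum_cong) (use Cons.prems[of "[]"] that in simp)
  ultimately show ?case by simp
qed simp

lemma merge_sum_zero: "merge_sum (\<lambda>v. \<zero>) w = \<zero>"
proof (induction w)
  case (Cons A w)
  then show ?case by (cases w) (simp_all add: minus_eq)
qed simp

lemma insert_sum_zero: "insert_sum a (\<lambda>v. \<zero>) w = \<zero>"
  by (induction w) (simp_all add: minus_eq)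

lemma extract_sum_zero: "extract_sum a (\<lambda>v. \<zero>) w = \<zero>"
  by (induction w) (simp_all add: insert_sum_zero)

text \<open>
  The homotopy relation \<open>d h + h d = 1 - s p\<close>, by induction on the list, with a case distinction on whether the first
  block \<open>F\<close> is \<open>{a}\<close>, contains \<open>a\<close> together with other elements, or does not contain \<open>a\<close>.  In the last
  case the terms that merge \<open>F\<close> with its right neighbour are not covered by the induction
  hypothesis.  They cancel each other unless the next block is \<open>{a}\<close>, and then they cancel the correction
  term \<open>s p\<close> of the shorter list.
\<close>

lemma extract_sum_homotopy:
  assumes "\<And>v. f v \<in> carrier R"
    and "set_composition I w" "a \<in> I"
  shows "merge_sum (extract_sum a f) w \<oplus> extract_sum a (merge_sum f) w =
    f w \<ominus> (if hd w = {a} then insert_sum a f (tl w) else \<zero>)"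
  using assms
proof (induction w arbitrary: f I)
  case Nil
  then show ?case by simp
next
  case (Cons F w)
  note [simp] = Cons.prems(1)
  have F: "F \<noteq> {}" "set_composition (I - F) w" using Cons.prems by auto
  consider "F = {a}" | "a \<in> F" "F \<noteq> {a}" | "a \<notin> F" by blast
  then show ?case
  proof cases
    case 1
    show ?thesis
    proof (cases w)
      case (Cons B u)
      have "a \<notin> B" "B \<noteq> {}" using F 1 Cons by auto
      then have "insert a B \<noteq> {a}" "insert a B - {a} = B" by auto
      moreover have "x = y \<ominus> (y \<ominus> x)" if "x \<in> carrier R" "y \<in> carrier R" for x y
        using that by algebra
      ultimately show ?thesis using 1 Cons by (simp add: word_sum_linear merge_sum_zero minus_eq[of _ \<zero>])
    qed (simp add: 1 minus_eq r_neg)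
  next
    case 2
    show ?thesis
    proof (cases w)
      case (Cons B u)
      have "a \<notin> B" "B \<noteq> {}" using F 2 Cons by auto
      then have "F \<union> B \<noteq> {a}" "F \<union> B - {a} = (F - {a}) \<union> B" "insert a F = F" using 2 by auto
      note eqs = this
      let ?f' = "\<lambda>v. f ((F - {a}) # v)"
      have "merge_sum (extract_sum a f) (F # w) =
          insert_sum a (\<lambda>v. f ((F - {a} \<union> B) # v)) u \<oplus> merge_sum (insert_sum a ?f') w"
        using 2 eqs Cons by (simp add: word_sum_linear minus_eq del: merge_sum.simps(2))
          (simp add: word_sum_linear merge_first_minus minus_add minus_eq)
      moreover have "extract_sum a (merge_sum f) (F # w) =
          insert_sum a (merge_first f (F - {a})) w \<oplus> insert_sum a (merge_sum ?f') w"
        using 2 by (simp add: word_sum_linear minus_add minus_eq)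
      moreover have "insert_sum a (merge_first f (F - {a})) w =
          f (F # w) \<ominus> insert_sum a (\<lambda>v. f ((F - {a} \<union> B) # v)) u"
        using eqs Cons by simp
      moreover have "(p \<oplus> d) \<oplus> ((x \<ominus> p) \<oplus> \<ominus> d) = x \<ominus> \<zero>"
        if "p \<in> carrier R" "d \<in> carrier R" "x \<in> carrier R" for p d x using that by algebra
      ultimately show ?thesis using 2 by (simp add: insert_sum_merge_sum)
    next
      case Nil
      have "insert a F = F" using 2 by auto
      then show ?thesis using 2 Nil by (simp add: word_sum_linear minus_eq)
    qed
  next
    case 3
    have "F \<noteq> {a}" using 3 by auto
    have "a \<in> I - F" using Cons.prems 3 by auto
    then obtain B u where w: "w = B # u" using F by (cases w) auto
    note IH = Cons.IH[OF _ F(2) \<open>a \<in> I - F\<close>, of "\<lambda>v. f (F # v)"]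
    let ?p = "extract_sum a (merge_first f F) w" and ?q = "extract_sum a f ((F \<union> B) # u)"
      and ?d = "merge_sum (extract_sum a (\<lambda>v. f (F # v))) w"
      and ?e = "extract_sum a (merge_sum (\<lambda>v. f (F # v))) w"
      and ?c = "if B = {a} then insert_sum a (\<lambda>v. f (F # v)) u else \<zero>"
    have "F \<union> B \<noteq> {a}" "F \<union> B - {a} = F \<union> (B - {a})" using 3 F by auto
    then have c: "?p \<ominus> ?q = ?c" using 3 w by (simp add: minus_eq r_neg l_neg)
    have "merge_sum (extract_sum a f) (F # w) = \<ominus> merge_first (extract_sum a f) F w \<oplus> ?d"
      using 3 \<open>F \<noteq> {a}\<close> by (simp add: word_sum_linear minus_eq)
    also have "\<dots> = \<ominus> ?q \<oplus> ?d" using w by simp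
    finally have 1: "merge_sum (extract_sum a f) (F # w) = \<ominus> ?q \<oplus> ?d" .
    have 2: "extract_sum a (merge_sum f) (F # w) = ?p \<oplus> ?e"
      using 3 \<open>F \<noteq> {a}\<close> by (simp add: word_sum_linear minus_eq minus_add)
    have "(\<ominus> q \<oplus> d) \<oplus> (p \<oplus> e) = (p \<ominus> q) \<oplus> (d \<oplus> e)"
      if "p \<in> carrier R" "q \<in> carrier R" "d \<in> carrier R" "e \<in> carrier R" for p q d e
      using that by algebra
    then have "merge_sum (extract_sum a f) (F # w) \<oplus> extract_sum a (merge_sum f) (F # w)
        = (?p \<ominus> ?q) \<oplus> (?d \<oplus> ?e)"
      unfolding 1 2 by (simp del: merge_sum.simps extract_sum.simps)
    also have "?d \<oplus> ?e = f (F # w) \<ominus> ?c" using IH w by (simp del: merge_sum.simps extract_sum.simps)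
    also have "?p \<ominus> ?q = ?c" by (fact c)
    also have "?c \<oplus> (f (F # w) \<ominus> ?c) = f (F # w)"
    proof -
      have key: "p \<oplus> (x \<ominus> p) = x" if "p \<in> carrier R" "x \<in> carrier R" for p x using that by algebra
      show ?thesis by (rule key) auto
    qed
    finally show ?thesis using \<open>F \<noteq> {a}\<close> by (simp add: minus_eq del: merge_sum.simps extract_sum.simps)
  qed
qed

end

section \<open>The operations of the cobar construction on basis elements\<close>

context cring
begin

abbreviation cobar where "cobar \<equiv> cobar_comp R"

lemma module_cobar: "module R (cobar I n)"
  unfolding cobar_comp_def by (rule module_free_module)

lemma cobar_smult: "r \<odot>\<^bsub>cobar I n\<^esub> f = (\<lambda>w. r \<otimes> f w)"
  by (simp add: cobar_comp_def)

lemma cobar_basis_closed: "F \<in> compositions I n \<Longrightarrow> basis_vector R F \<in> carrier (cobar I n)"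
  unfolding cobar_comp_def by (rule basis_vector_closed)

lemma cobar_diff_basis_closed:
  assumes "F \<in> compositions I n"
  shows "cobar_diff_basis R I n F \<in> carrier (cobar I (n + 1))"
proof -
  interpret M: module R "cobar I (n + 1)" by (rule module_cobar)
  show ?thesis unfolding cobar_diff_basis_def
    using assms by (intro M.finsum_closed Pi_I M.smult_closed power_of_minus_one_closed is_cring
        cobar_basis_closed split_at_compositions) auto
qed

text \<open>
  Naturality and the Leibniz rule require the image of \<open>d F\<close> under a linear map: transport, or
  multiplication by a basis element on one side.
\<close>

lemma linear_map_cobar_diff_basis:
  assumes "finite I" "F \<in> compositions I n" "module R N" "L \<in> linear_maps R (cobar I (n + 1)) N"
  shows "L (cobar_diff_basis R I n F) =
    (\<Oplus>\<^bsub>N\<^esub>i\<in>{..<length F}. power_of_minus_one R (int i + 1) \<odot>\<^bsub>N\<^esub>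
       (\<Oplus>\<^bsub>N\<^esub>P\<in>splittings (F ! i). L (basis_vector R (split_at F i P))))"
proof -
  interpret M: module R "cobar I (n + 1)" by (rule module_cobar)
  interpret N: module R N by fact
  have b: "(\<lambda>P. basis_vector R (split_at F i P)) \<in> splittings (F ! i) \<rightarrow> carrier (cobar I (n + 1))"
    if "i < length F" for i
    using that assms by (intro Pi_I cobar_basis_closed split_at_compositions) auto
  have fin: "finite (splittings (F ! i))" if "i < length F" for i
    using set_composition_nth_subset[of I F i] that assms
    by (intro finite_splittings) (auto simp: compositions_def intro: finite_subset)
  have inner: "L (power_of_minus_one R (int i + 1) \<odot>\<^bsub>cobar I (n + 1)\<^esub>
        (\<Oplus>\<^bsub>cobar I (n + 1)\<^esub>P\<in>splittings (F ! i). basis_vector R (split_at F i P))) =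
      power_of_minus_one R (int i + 1) \<odot>\<^bsub>N\<^esub>
       (\<Oplus>\<^bsub>N\<^esub>P\<in>splittings (F ! i). L (basis_vector R (split_at F i P)))" if "i < length F" for i
    using linear_mapsD(3)[OF assms(4) power_of_minus_one_closed[OF is_cring] M.finsum_closed[OF b[OF that]]]
      linear_maps_finsum[OF module_cobar assms(3,4) b[OF that] fin[OF that]] by simp
  have "L (cobar_diff_basis R I n F) = (\<Oplus>\<^bsub>N\<^esub>i\<in>{..<length F}. L (power_of_minus_one R (int i + 1) \<odot>\<^bsub>cobar I (n + 1)\<^esub>
        (\<Oplus>\<^bsub>cobar I (n + 1)\<^esub>P\<in>splittings (F ! i). basis_vector R (split_at F i P))))"
    unfolding cobar_diff_basis_def
    using b by (intro linear_maps_finsum[OF module_cobar assms(3,4)] Pi_I M.smult_closed M.finsum_closed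
        power_of_minus_one_closed is_cring) auto
  also have "\<dots> = (\<Oplus>\<^bsub>N\<^esub>i\<in>{..<length F}. power_of_minus_one R (int i + 1) \<odot>\<^bsub>N\<^esub>
       (\<Oplus>\<^bsub>N\<^esub>P\<in>splittings (F ! i). L (basis_vector R (split_at F i P))))"
    using linear_mapsD(1)[OF assms(4)] b
    by (intro N.finsum_cong' refl Pi_I N.smult_closed power_of_minus_one_closed is_cring N.finsum_closed inner) auto
  finally show ?thesis .
qed

lemma cobar_E_sel:
  "component (cobar_E R) = cobar"
  "transport (cobar_E R) \<sigma> I n = linear_extension (compositions I n) (cobar (\<sigma> ` I) n)
       (\<lambda>F. basis_vector R (map ((`) \<sigma>) F))"
  "differential (cobar_E R) I n = linear_extension (compositions I n) (cobar I (n + 1)) (cobar_diff_basis R I n)"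
  "product (cobar_E R) S T m n f g = linear_extension (compositions S m) (cobar (S \<union> T) (m + n))
         (\<lambda>F. linear_extension (compositions T n) (cobar (S \<union> T) (m + n)) (\<lambda>G. basis_vector R (F @ G)) g) f"
  "unit_element (cobar_E R) = basis_vector R []"
  by (simp_all add: cobar_E_def)

lemma cobar_transport_linear:
  assumes "finite I" "inj_on \<sigma> I"
  shows "transport (cobar_E R) \<sigma> I n \<in> linear_maps R (cobar I n) (cobar (\<sigma> ` I) n)"
  unfolding cobar_E_sel cobar_comp_def[of R I n]
  using assms by (intro linear_extension_linear module_cobar Pi_I cobar_basis_closed map_image_compositions) auto

lemma cobar_transport_basis:
  assumes "finite I" "inj_on \<sigma> I" "F \<in> compositions I n"
  shows "transport (cobar_E R) \<sigma> I n (basis_vector R F) = basis_vector R (map ((`) \<sigma>) F)"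
  unfolding cobar_E_sel
  using assms by (intro linear_extension_basis_vector module_cobar Pi_I cobar_basis_closed map_image_compositions) auto

lemma cobar_differential_linear:
  assumes "finite I"
  shows "differential (cobar_E R) I n \<in> linear_maps R (cobar I n) (cobar I (n + 1))"
  unfolding cobar_E_sel cobar_comp_def[of R I n]
  using assms by (intro linear_extension_linear module_cobar Pi_I cobar_diff_basis_closed) auto

lemma cobar_differential_basis:
  assumes "finite I" "F \<in> compositions I n"
  shows "differential (cobar_E R) I n (basis_vector R F) = cobar_diff_basis R I n F"
  unfolding cobar_E_sel
  using assms by (intro linear_extension_basis_vector module_cobar Pi_I cobar_diff_basis_closed) auto

context
  fixes S T :: "'x set" and m n :: int
  assumes ST: "finite S" "finite T" "S \<inter> T = {}"
begin

lemma cobar_product_inner: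
  assumes "F \<in> compositions S m"
  shows "linear_extension (compositions T n) (cobar (S \<union> T) (m + n)) (\<lambda>G. basis_vector R (F @ G))
    \<in> linear_maps R (cobar T n) (cobar (S \<union> T) (m + n))"
  unfolding cobar_comp_def[of R T n]
  using assms ST by (intro linear_extension_linear module_cobar Pi_I cobar_basis_closed append_compositions) auto

lemma cobar_product_linear_left:
  assumes "g \<in> carrier (cobar T n)"
  shows "(\<lambda>f. product (cobar_E R) S T m n f g) \<in> linear_maps R (cobar S m) (cobar (S \<union> T) (m + n))"
  unfolding cobar_E_sel cobar_comp_def[of R S m]
  using assms ST linear_mapsD(1)[OF cobar_product_inner]
  by (intro linear_extension_linear module_cobar Pi_I) auto

lemma cobar_product_linear_right:
  assumes "f \<in> carrier (cobar S m)"
  shows "product (cobar_E R) S T m n f \<in> linear_maps R (cobar T n) (cobar (S \<union> T) (m + n))"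
proof -
  have "f F \<in> carrier R" for F using assms unfolding cobar_comp_def by (rule free_module_apply_closed)
  then have "(\<lambda>g. product (cobar_E R) S T m n f g) \<in> linear_maps R (cobar T n) (cobar (S \<union> T) (m + n))"
    unfolding cobar_E_sel linear_extension_def[of "compositions S m"]
    using ST by (intro linear_maps_sum linear_maps_smult module_cobar cobar_product_inner) auto
  then show ?thesis by simp
qed

lemma cobar_product_basis:
  assumes "F \<in> compositions S m" "G \<in> compositions T n"
  shows "product (cobar_E R) S T m n (basis_vector R F) (basis_vector R G) = basis_vector R (F @ G)"
proof -
  have "product (cobar_E R) S T m n (basis_vector R F) (basis_vector R G) =
      linear_extension (compositions T n) (cobar (S \<union> T) (m + n)) (\<lambda>G. basis_vector R (F @ G)) (basis_vector R G)"
    unfolding cobar_E_sel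
    using assms ST linear_mapsD(1)[OF cobar_product_inner] cobar_basis_closed[OF assms(2)]
    by (intro linear_extension_basis_vector module_cobar Pi_I) auto
  also have "\<dots> = basis_vector R (F @ G)"
    using assms ST
    by (intro linear_extension_basis_vector module_cobar Pi_I cobar_basis_closed append_compositions) auto
  finally show ?thesis .
qed

end

section \<open>The differential on coefficient functions\<close>

abbreviation merge_at :: "nat \<Rightarrow> 'x set list \<Rightarrow> 'x set list" where
  "merge_at i w \<equiv> take i w @ (w ! i \<union> w ! Suc i) # drop (Suc (Suc i)) w"

lemma merge_sum_smult:
  assumes "r \<in> carrier R" "\<And>v. f v \<in> carrier R"
  shows "merge_sum (\<lambda>v. r \<otimes> f v) w = r \<otimes> merge_sum f w"
  using assms(2)
proof (induction w arbitrary: f)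
  case (Cons A w)
  have "merge_first (\<lambda>v. r \<otimes> f v) A w = r \<otimes> merge_first f A w" using assms(1) by (cases w) auto
  then show ?case using Cons assms(1) by (simp add: minus_eq r_distr r_minus)
qed (use assms(1) in simp)

text \<open>
  The recursion unrolled into an indexed sum, for comparison with the differential given on the basis.
\<close>

lemma merge_sum_eq_finsum:
  assumes "\<And>v. f v \<in> carrier R"
  shows "merge_sum f w = (\<Oplus>i\<in>{..<length w - 1}. power_of_minus_one R (int i + 1) \<otimes> f (merge_at i w))"
  using assms
proof (induction w arbitrary: f)
  case (Cons A w)
  note [simp] = Cons.prems power_of_minus_one_closed[OF is_cring]
  show ?case
  proof (cases w)
    case w: (Cons B u)
    let ?g = "\<lambda>i. power_of_minus_one R (int i + 1) \<otimes> f (A # merge_at i w)"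
    have "(\<Oplus>i\<in>{..<length (A # w) - 1}. power_of_minus_one R (int i + 1) \<otimes> f (merge_at i (A # w))) =
        (\<Oplus>i\<in>insert 0 (Suc ` {..<length u}). power_of_minus_one R (int i + 1) \<otimes> f (merge_at i (A # w)))"
      by (simp add: w lessThan_Suc_eq_insert_0)
    also have "\<dots> = power_of_minus_one R 1 \<otimes> f ((A \<union> B) # u) \<oplus>
        (\<Oplus>i\<in>Suc ` {..<length u}. power_of_minus_one R (int i + 1) \<otimes> f (merge_at i (A # w)))"
      by (subst finsum_insert) (auto simp: w)
    also have "(\<Oplus>i\<in>Suc ` {..<length u}. power_of_minus_one R (int i + 1) \<otimes> f (merge_at i (A # w))) =
        (\<Oplus>i\<in>{..<length u}. power_of_minus_one R (int (Suc i) + 1) \<otimes> f (merge_at (Suc i) (A # w)))"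
      by (rule finsum_reindex) auto
    also have "\<dots> = (\<Oplus>i\<in>{..<length u}. (\<ominus> \<one>) \<otimes> ?g i)"
      by (rule finsum_cong') (auto simp: power_of_minus_one_def l_minus r_minus)
    also have "\<dots> = (\<ominus> \<one>) \<otimes> (\<Oplus>i\<in>{..<length u}. ?g i)"
      by (rule finsum_rdistr[symmetric]) auto
    also have "(\<Oplus>i\<in>{..<length u}. ?g i) = merge_sum (\<lambda>v. f (A # v)) w"
      using Cons.IH[of "\<lambda>v. f (A # v)"] by (simp add: w)
    finally show ?thesis by (simp add: w power_of_minus_one_def l_minus minus_eq)
  qed (simp add: minus_eq)
qed simp

text \<open>
  Splitting block \<open>i\<close> of \<open>F\<close> and merging blocks \<open>i\<close> and \<open>i + 1\<close> of \<open>H\<close> are inverse to each other.  So each \<open>H\<close>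
  arises at most once by splitting block \<open>i\<close> of \<open>F\<close>, and the inner sum of \<open>d F\<close> has coefficients 0 and 1.
\<close>

lemma split_at_eq_iff:
  assumes "set_composition I H" "length H = Suc (length F)" "i < length F"
  shows "P \<in> splittings (F ! i) \<and> H = split_at F i P \<longleftrightarrow> F = merge_at i H \<and> P = (H ! i, H ! Suc i)"
proof
  assume A: "P \<in> splittings (F ! i) \<and> H = split_at F i P"
  then have H: "H ! i = fst P" "H ! Suc i = snd P" "take i H = take i F" "drop (Suc (Suc i)) H = drop (Suc i) F"
    using assms(3) by (auto simp: nth_append)
  have "fst P \<union> snd P = F ! i" using A by (auto simp: splittings_def)
  then show "F = merge_at i H \<and> P = (H ! i, H ! Suc i)" unfolding H using id_take_nth_drop[OF assms(3)] by simp
next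
  assume A: "F = merge_at i H \<and> P = (H ! i, H ! Suc i)"
  have H: "H = take i H @ H ! i # H ! Suc i # drop (Suc (Suc i)) H"
    using assms by (simp add: Cons_nth_drop_Suc flip: id_take_nth_drop)
  then have "(H ! i, H ! Suc i) \<in> splittings (H ! i \<union> H ! Suc i)"
    using assms(1) by (metis set_composition_merge_blocks(2))
  moreover have F: "F ! i = H ! i \<union> H ! Suc i" "take i F = take i H" "drop (Suc i) F = drop (Suc (Suc i)) H"
    using A assms by (auto simp: nth_append)
  ultimately show "P \<in> splittings (F ! i) \<and> H = split_at F i P" using A H unfolding F by simp
qed

lemma cobar_diff_basis_apply:
  assumes "finite I" "F \<in> compositions I n" "H \<in> compositions I (n + 1)"
  shows "cobar_diff_basis R I n F H = merge_sum (basis_vector R F) H"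
proof -
  interpret M: module R "cobar I (n + 1)" by (rule module_cobar)
  note [simp] = power_of_minus_one_closed[OF is_cring]
  have len: "length H = Suc (length F)" using assms by (auto simp: compositions_def)
  have b: "(\<lambda>P. basis_vector R (split_at F i P)) \<in> splittings (F ! i) \<rightarrow> carrier (cobar I (n + 1))"
    if "i < length F" for i
    using that assms by (intro Pi_I cobar_basis_closed split_at_compositions) auto
  have fin: "finite (splittings (F ! i))" if "i < length F" for i
    using set_composition_nth_subset[of I F i] that assms
    by (intro finite_splittings) (auto simp: compositions_def intro: finite_subset)
  have inner: "(\<Oplus>\<^bsub>cobar I (n + 1)\<^esub>P\<in>splittings (F ! i). basis_vector R (split_at F i P)) H =
      basis_vector R F (merge_at i H)" if i: "i < length F" for i
  proof -
    have iff: "P \<in> splittings (F ! i) \<and> H = split_at F i P \<longleftrightarrow> F = merge_at i H \<and> P = (H ! i, H ! Suc i)" for P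
      using assms(3) len i by (intro split_at_eq_iff[of I]) (auto simp: compositions_def)
    have "(\<Oplus>\<^bsub>cobar I (n + 1)\<^esub>P\<in>splittings (F ! i). basis_vector R (split_at F i P)) H =
        (\<Oplus>P\<in>splittings (F ! i). basis_vector R (split_at F i P) H)"
      using b[OF i] unfolding cobar_comp_def by (rule finsum_free_module_apply)
    also have "\<dots> = (\<Oplus>P\<in>splittings (F ! i). if (H ! i, H ! Suc i) = P then basis_vector R F (merge_at i H) else \<zero>)"
    proof (rule finsum_cong')
      fix P assume "P \<in> splittings (F ! i)"
      then have "H = split_at F i P \<longleftrightarrow> F = merge_at i H \<and> P = (H ! i, H ! Suc i)" using iff by blast
      then show "basis_vector R (split_at F i P) H =
          (if (H ! i, H ! Suc i) = P then basis_vector R F (merge_at i H) else \<zero>)"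
        unfolding basis_vector_def by metis
    qed (auto simp: basis_vector_def)
    also have "\<dots> = basis_vector R F (merge_at i H)"
    proof (cases "F = merge_at i H")
      case True
      then have "(H ! i, H ! Suc i) \<in> splittings (F ! i)" using iff by blast
      then show ?thesis using fin[OF i] by (intro add.finprod_singleton) (auto simp: basis_vector_def)
    next
      case False
      then show ?thesis by (auto simp: basis_vector_def intro!: add.finprod_one_eqI)
    qed
    finally show ?thesis .
  qed
  have "cobar_diff_basis R I n F H = (\<Oplus>i\<in>{..<length F}.
      (power_of_minus_one R (int i + 1) \<odot>\<^bsub>cobar I (n + 1)\<^esub>
        (\<Oplus>\<^bsub>cobar I (n + 1)\<^esub>P\<in>splittings (F ! i). basis_vector R (split_at F i P))) H)"
    unfolding cobar_diff_basis_def cobar_comp_def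
    using M.smult_closed M.finsum_closed[OF b]
    by (intro finsum_free_module_apply) (auto simp: cobar_comp_def simp del: free_module_sel)
  also have "\<dots> = (\<Oplus>i\<in>{..<length F}. power_of_minus_one R (int i + 1) \<otimes> basis_vector R F (merge_at i H))"
  proof (rule finsum_cong')
    fix i assume "i \<in> {..<length F}"
    then show "(power_of_minus_one R (int i + 1) \<odot>\<^bsub>cobar I (n + 1)\<^esub>
        (\<Oplus>\<^bsub>cobar I (n + 1)\<^esub>P\<in>splittings (F ! i). basis_vector R (split_at F i P))) H =
        power_of_minus_one R (int i + 1) \<otimes> basis_vector R F (merge_at i H)"
      using inner[of i] by (simp only: cobar_smult lessThan_iff)
  qed (auto simp: basis_vector_def)
  also have "\<dots> = merge_sum (basis_vector R F) H"
    using len by (subst merge_sum_eq_finsum) (auto simp: basis_vector_def)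
  finally show ?thesis .
qed

lemma cobar_closed: "f \<in> carrier (cobar I n) \<Longrightarrow> f w \<in> carrier R"
  unfolding cobar_comp_def by (rule free_module_apply_closed)

lemma restrict_compositions_closed:
  assumes "finite I" "\<And>w. f w \<in> carrier R"
  shows "(\<lambda>w. if w \<in> compositions I n then f w else \<zero>) \<in> carrier (cobar I n)"
  using assms by (simp add: cobar_comp_def carrier_free_module)

text \<open>
  A merge of two blocks that overlap or are empty may be a composition although the list itself is
  none, so the signed sum over merges has to be cut off outside the compositions.
\<close>

lemma cobar_differential_eq:
  assumes "finite I" "f \<in> carrier (cobar I n)"
  shows "differential (cobar_E R) I n f =
    (\<lambda>w. if w \<in> compositions I (n + 1) then merge_sum f w else \<zero>)"
proof -
  let ?D = "\<lambda>f w. if w \<in> compositions I (n + 1) then merge_sum f w else \<zero>"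
  interpret M: module R "cobar I (n + 1)" by (rule module_cobar)
  have lin: "?D \<in> linear_maps R (free_module R (compositions I n)) (cobar I (n + 1))"
  proof (rule linear_mapsI)
    fix f assume "f \<in> carrier (free_module R (compositions I n))"
    note f = free_module_apply_closed[OF this]
    show "?D f \<in> carrier (cobar I (n + 1))"
      by (rule restrict_compositions_closed) (use f assms in auto)
    show "?D (r \<odot>\<^bsub>free_module R (compositions I n)\<^esub> f) = r \<odot>\<^bsub>cobar I (n + 1)\<^esub> ?D f"
      if "r \<in> carrier R" for r
      using f that by (auto simp: cobar_comp_def merge_sum_smult)
    fix g assume "g \<in> carrier (free_module R (compositions I n))"
    note g = free_module_apply_closed[OF this]
    show "?D (f \<oplus>\<^bsub>free_module R (compositions I n)\<^esub> g) = ?D f \<oplus>\<^bsub>cobar I (n + 1)\<^esub> ?D g"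
      using f g by (auto simp: cobar_comp_def merge_sum_add)
  qed
  have "?D f = linear_extension (compositions I n) (cobar I (n + 1)) (cobar_diff_basis R I n) f"
  proof (rule linear_extension_unique[OF _ module_cobar lin])
    fix F assume F: "F \<in> compositions I n"
    show "?D (basis_vector R F) = cobar_diff_basis R I n F"
    proof (rule free_module_eqI)
      show "?D (basis_vector R F) \<in> carrier (free_module R (compositions I (n + 1)))"
        unfolding cobar_comp_def[symmetric]
        by (rule restrict_compositions_closed) (use assms in \<open>auto simp: basis_vector_def\<close>)
    qed (use cobar_diff_basis_closed[OF F] cobar_diff_basis_apply[OF assms(1) F] in \<open>auto simp: cobar_comp_def\<close>)
  qed (use assms in \<open>auto simp: cobar_comp_def\<close>)
  then show ?thesis by (simp add: cobar_E_sel)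
qed

end

section \<open>The cobar construction is a dg algebra\<close>

context cring
begin

lemma cobar_eq_on_basis:
  assumes "finite I" "module R M" "T \<in> linear_maps R (cobar I n) M" "T' \<in> linear_maps R (cobar I n) M"
    and "\<And>F. F \<in> compositions I n \<Longrightarrow> T (basis_vector R F) = T' (basis_vector R F)"
    and "f \<in> carrier (cobar I n)"
  shows "T f = T' f"
  using linear_maps_eq_on_basis[of "compositions I n" M T T' f] assms unfolding cobar_comp_def by blast

lemma cobar_bilinear_eq_on_basis:
  assumes "finite S" "finite U" "module R M"
    and "\<And>y. y \<in> carrier (cobar U n) \<Longrightarrow> (\<lambda>x. T x y) \<in> linear_maps R (cobar S m) M"
    and "\<And>x. x \<in> carrier (cobar S m) \<Longrightarrow> (\<lambda>y. T x y) \<in> linear_maps R (cobar U n) M"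
    and "\<And>y. y \<in> carrier (cobar U n) \<Longrightarrow> (\<lambda>x. T' x y) \<in> linear_maps R (cobar S m) M"
    and "\<And>x. x \<in> carrier (cobar S m) \<Longrightarrow> (\<lambda>y. T' x y) \<in> linear_maps R (cobar U n) M"
    and "\<And>F G. F \<in> compositions S m \<Longrightarrow> G \<in> compositions U n \<Longrightarrow>
      T (basis_vector R F) (basis_vector R G) = T' (basis_vector R F) (basis_vector R G)"
    and "f \<in> carrier (cobar S m)" "g \<in> carrier (cobar U n)"
  shows "T f g = T' f g"
  by (rule bilinear_eq_on_basis[OF finite_compositions[OF assms(1)] finite_compositions[OF assms(2)]
    assms(3-10)[unfolded cobar_comp_def]])

lemma cobar_product_closed:
  assumes "finite S" "finite T" "S \<inter> T = {}" "f \<in> carrier (cobar S m)" "g \<in> carrier (cobar T n)"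
  shows "product (cobar_E R) S T m n f g \<in> carrier (cobar (S \<union> T) (m + n))"
  using linear_mapsD(1)[OF cobar_product_linear_right[OF assms(1-4)] assms(5)] .

lemma cobar_transport_diff_basis:
  assumes "finite I" "inj_on \<sigma> I" "F \<in> compositions I n"
  shows "transport (cobar_E R) \<sigma> I (n + 1) (cobar_diff_basis R I n F) =
    cobar_diff_basis R (\<sigma> ` I) n (map ((`) \<sigma>) F)"
proof -
  interpret N: module R "cobar (\<sigma> ` I) (n + 1)" by (rule module_cobar)
  let ?t = "\<lambda>i P. basis_vector R (split_at (map ((`) \<sigma>) F) i P)"
  have \<sigma>F: "map ((`) \<sigma>) F \<in> compositions (\<sigma> ` I) n" using assms by (intro map_image_compositions)
  have b: "?t i \<in> splittings (map ((`) \<sigma>) F ! i) \<rightarrow> carrier (cobar (\<sigma> ` I) (n + 1))" if "i < length F" for i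
    using that by (intro Pi_I cobar_basis_closed split_at_compositions \<sigma>F) auto
  have inner: "(\<Oplus>\<^bsub>cobar (\<sigma> ` I) (n + 1)\<^esub>P\<in>splittings (F ! i).
        transport (cobar_E R) \<sigma> I (n + 1) (basis_vector R (split_at F i P))) =
      (\<Oplus>\<^bsub>cobar (\<sigma> ` I) (n + 1)\<^esub>P\<in>splittings (map ((`) \<sigma>) F ! i). ?t i P)" if i: "i < length F" for i
  proof -
    have Fi: "inj_on \<sigma> (F ! i)" "map ((`) \<sigma>) F ! i = \<sigma> ` (F ! i)"
      using set_composition_nth_subset[OF _ i, of I] assms i
      by (auto simp: compositions_def intro: inj_on_subset)
    note im = splittings_image[OF Fi(1)]
    have b': "?t i \<in> map_prod ((`) \<sigma>) ((`) \<sigma>) ` splittings (F ! i) \<rightarrow> carrier (cobar (\<sigma> ` I) (n + 1))"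
      using b[OF i] unfolding Fi(2) im(1) .
    have "(\<Oplus>\<^bsub>cobar (\<sigma> ` I) (n + 1)\<^esub>P\<in>splittings (map ((`) \<sigma>) F ! i). ?t i P) =
        (\<Oplus>\<^bsub>cobar (\<sigma> ` I) (n + 1)\<^esub>P\<in>splittings (F ! i). ?t i (map_prod ((`) \<sigma>) ((`) \<sigma>) P))"
      unfolding Fi(2) im(1) by (rule N.finsum_reindex[OF b' im(2)])
    also have "\<dots> = (\<Oplus>\<^bsub>cobar (\<sigma> ` I) (n + 1)\<^esub>P\<in>splittings (F ! i).
        transport (cobar_E R) \<sigma> I (n + 1) (basis_vector R (split_at F i P)))"
    proof (rule N.finsum_cong')
      fix P assume P: "P \<in> splittings (F ! i)"
      show "?t i (map_prod ((`) \<sigma>) ((`) \<sigma>) P) = transport (cobar_E R) \<sigma> I (n + 1) (basis_vector R (split_at F i P))"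
        using cobar_transport_basis[OF assms(1,2) split_at_compositions[OF assms(3) i P]]
        by (simp add: take_map drop_map)
    next
      show "(\<lambda>P. transport (cobar_E R) \<sigma> I (n + 1) (basis_vector R (split_at F i P)))
          \<in> splittings (F ! i) \<rightarrow> carrier (cobar (\<sigma> ` I) (n + 1))"
        by (intro Pi_I linear_mapsD(1)[OF cobar_transport_linear[OF assms(1,2)]] cobar_basis_closed
            split_at_compositions[OF assms(3) i])
    qed simp
    finally show ?thesis by simp
  qed
  have "transport (cobar_E R) \<sigma> I (n + 1) (cobar_diff_basis R I n F) =
    (\<Oplus>\<^bsub>cobar (\<sigma> ` I) (n + 1)\<^esub>i\<in>{..<length F}. power_of_minus_one R (int i + 1) \<odot>\<^bsub>cobar (\<sigma> ` I) (n + 1)\<^esub>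
       (\<Oplus>\<^bsub>cobar (\<sigma> ` I) (n + 1)\<^esub>P\<in>splittings (F ! i).
          transport (cobar_E R) \<sigma> I (n + 1) (basis_vector R (split_at F i P))))"
    by (rule linear_map_cobar_diff_basis[OF assms(1,3) module_cobar cobar_transport_linear[OF assms(1,2)]])
  also have "\<dots> = (\<Oplus>\<^bsub>cobar (\<sigma> ` I) (n + 1)\<^esub>i\<in>{..<length (map ((`) \<sigma>) F)}.
      power_of_minus_one R (int i + 1) \<odot>\<^bsub>cobar (\<sigma> ` I) (n + 1)\<^esub>
       (\<Oplus>\<^bsub>cobar (\<sigma> ` I) (n + 1)\<^esub>P\<in>splittings (map ((`) \<sigma>) F ! i). ?t i P))"
  proof (rule N.finsum_cong')
    fix i assume "i \<in> {..<length (map ((`) \<sigma>) F)}"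
    then have "i < length F" by simp
    from inner[OF this] show "power_of_minus_one R (int i + 1) \<odot>\<^bsub>cobar (\<sigma> ` I) (n + 1)\<^esub>
       (\<Oplus>\<^bsub>cobar (\<sigma> ` I) (n + 1)\<^esub>P\<in>splittings (F ! i).
          transport (cobar_E R) \<sigma> I (n + 1) (basis_vector R (split_at F i P))) =
       power_of_minus_one R (int i + 1) \<odot>\<^bsub>cobar (\<sigma> ` I) (n + 1)\<^esub>
       (\<Oplus>\<^bsub>cobar (\<sigma> ` I) (n + 1)\<^esub>P\<in>splittings (map ((`) \<sigma>) F ! i). ?t i P)" by (simp only:)
  qed (use b in \<open>auto intro!: N.smult_closed N.finsum_closed is_cring simp del: nth_map\<close>)
  finally show ?thesis by (simp only: cobar_diff_basis_def)
qed

lemma power_of_minus_one_add: "power_of_minus_one R (a + b) = power_of_minus_one R a \<otimes> power_of_minus_one R b"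
  by (simp add: power_of_minus_one_def l_minus r_minus)

text \<open>
  The blocks of \<open>F @ G\<close> are split either within \<open>F\<close> or within \<open>G\<close>, and in the latter case the position of the block
  is shifted by the number of blocks of \<open>F\<close>.
\<close>

lemma cobar_diff_basis_append:
  assumes ST: "finite S" "finite T" "S \<inter> T = {}"
    and F: "F \<in> compositions S m" and G: "G \<in> compositions T n"
  shows "cobar_diff_basis R (S \<union> T) (m + n) (F @ G) =
    product (cobar_E R) S T (m + 1) n (cobar_diff_basis R S m F) (basis_vector R G)
    \<oplus>\<^bsub>cobar (S \<union> T) (m + n + 1)\<^esub> power_of_minus_one R (int (length F)) \<odot>\<^bsub>cobar (S \<union> T) (m + n + 1)\<^esub>
      product (cobar_E R) S T m (n + 1) (basis_vector R F) (cobar_diff_basis R T n G)"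
proof -
  let ?N = "cobar (S \<union> T) (m + n + 1)"
  interpret N: module R ?N by (rule module_cobar)
  note s = power_of_minus_one_closed[OF is_cring]
  have deg: "m + 1 + n = m + n + 1" "m + (n + 1) = m + n + 1" by auto
  let ?t = "\<lambda>i. power_of_minus_one R (int i + 1) \<odot>\<^bsub>?N\<^esub>
      (\<Oplus>\<^bsub>?N\<^esub>P\<in>splittings ((F @ G) ! i). basis_vector R (split_at (F @ G) i P))"
  have FG: "F @ G \<in> compositions (S \<union> T) (m + n)" by (rule append_compositions[OF ST F G])
  have t: "?t i \<in> carrier ?N" if "i < length F + length G" for i
    using that FG by (intro N.smult_closed N.finsum_closed s Pi_I cobar_basis_closed split_at_compositions) auto
  have tPi: "?t \<in> A \<rightarrow> carrier ?N" if "A \<subseteq> {..<length F + length G}" for A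
    using that by (intro Pi_I t) auto
  have left: "product (cobar_E R) S T (m + 1) n (cobar_diff_basis R S m F) (basis_vector R G) =
      (\<Oplus>\<^bsub>?N\<^esub>i\<in>{..<length F}. ?t i)"
  proof -
    have lin: "(\<lambda>f. product (cobar_E R) S T (m + 1) n f (basis_vector R G)) \<in> linear_maps R (cobar S (m + 1)) ?N"
      using cobar_product_linear_left[OF ST cobar_basis_closed[OF G], of "m + 1"] by (simp only: deg)
    have "product (cobar_E R) S T (m + 1) n (cobar_diff_basis R S m F) (basis_vector R G) =
      (\<Oplus>\<^bsub>?N\<^esub>i\<in>{..<length F}. power_of_minus_one R (int i + 1) \<odot>\<^bsub>?N\<^esub>
        (\<Oplus>\<^bsub>?N\<^esub>P\<in>splittings (F ! i).
          product (cobar_E R) S T (m + 1) n (basis_vector R (split_at F i P)) (basis_vector R G)))"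
      by (rule linear_map_cobar_diff_basis[OF ST(1) F module_cobar lin])
    also have "\<dots> = (\<Oplus>\<^bsub>?N\<^esub>i\<in>{..<length F}. ?t i)"
    proof (rule N.finsum_cong')
      fix i assume i: "i \<in> {..<length F}"
      have "(\<Oplus>\<^bsub>?N\<^esub>P\<in>splittings (F ! i).
            product (cobar_E R) S T (m + 1) n (basis_vector R (split_at F i P)) (basis_vector R G)) =
          (\<Oplus>\<^bsub>?N\<^esub>P\<in>splittings ((F @ G) ! i). basis_vector R (split_at (F @ G) i P))"
      proof (rule N.finsum_cong')
        fix P assume "P \<in> splittings ((F @ G) ! i)"
        then have P: "P \<in> splittings (F ! i)" using i by (simp add: nth_append)
        show "product (cobar_E R) S T (m + 1) n (basis_vector R (split_at F i P)) (basis_vector R G) =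
            basis_vector R (split_at (F @ G) i P)"
          using cobar_product_basis[OF ST split_at_compositions[OF F _ P] G] i by simp
      next
        show "(\<lambda>P. basis_vector R (split_at (F @ G) i P)) \<in> splittings ((F @ G) ! i) \<rightarrow> carrier ?N"
          using i by (intro Pi_I cobar_basis_closed split_at_compositions FG) auto
      qed (use i in \<open>simp add: nth_append\<close>)
      then show "power_of_minus_one R (int i + 1) \<odot>\<^bsub>?N\<^esub> (\<Oplus>\<^bsub>?N\<^esub>P\<in>splittings (F ! i).
            product (cobar_E R) S T (m + 1) n (basis_vector R (split_at F i P)) (basis_vector R G)) = ?t i"
        by (simp only:)
    qed (rule refl, rule tPi, auto)
    finally show ?thesis .
  qed
  have right: "power_of_minus_one R (int (length F)) \<odot>\<^bsub>?N\<^esub>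
      product (cobar_E R) S T m (n + 1) (basis_vector R F) (cobar_diff_basis R T n G) =
      (\<Oplus>\<^bsub>?N\<^esub>i\<in>{length F..<length F + length G}. ?t i)"
  proof -
    have lin: "product (cobar_E R) S T m (n + 1) (basis_vector R F) \<in> linear_maps R (cobar T (n + 1)) ?N"
      using cobar_product_linear_right[OF ST cobar_basis_closed[OF F], of "n + 1"] by (simp only: deg)
    let ?u = "\<lambda>j. power_of_minus_one R (int j + 1) \<odot>\<^bsub>?N\<^esub>
        (\<Oplus>\<^bsub>?N\<^esub>P\<in>splittings (G ! j).
          product (cobar_E R) S T m (n + 1) (basis_vector R F) (basis_vector R (split_at G j P)))"
    have b: "(\<lambda>P. product (cobar_E R) S T m (n + 1) (basis_vector R F) (basis_vector R (split_at G j P)))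
        \<in> splittings (G ! j) \<rightarrow> carrier ?N" if "j < length G" for j
      using that G by (intro Pi_I linear_mapsD(1)[OF lin] cobar_basis_closed split_at_compositions)
    have u: "?u j \<in> carrier ?N" if "j < length G" for j
      using b[OF that] by (intro N.smult_closed N.finsum_closed s) auto
    have ut: "power_of_minus_one R (int (length F)) \<odot>\<^bsub>?N\<^esub> ?u j = ?t (length F + j)" if j: "j < length G" for j
    proof -
      have "(\<Oplus>\<^bsub>?N\<^esub>P\<in>splittings (G ! j).
          product (cobar_E R) S T m (n + 1) (basis_vector R F) (basis_vector R (split_at G j P))) =
          (\<Oplus>\<^bsub>?N\<^esub>P\<in>splittings ((F @ G) ! (length F + j)). basis_vector R (split_at (F @ G) (length F + j) P))"
      proof (rule N.finsum_cong')
        fix P assume "P \<in> splittings ((F @ G) ! (length F + j))"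
        then have P: "P \<in> splittings (G ! j)" by simp
        show "product (cobar_E R) S T m (n + 1) (basis_vector R F) (basis_vector R (split_at G j P)) =
            basis_vector R (split_at (F @ G) (length F + j) P)"
          using cobar_product_basis[OF ST F split_at_compositions[OF G j P]] by simp
      next
        show "(\<lambda>P. basis_vector R (split_at (F @ G) (length F + j) P))
            \<in> splittings ((F @ G) ! (length F + j)) \<rightarrow> carrier ?N"
          using j by (intro Pi_I cobar_basis_closed split_at_compositions FG) auto
      qed simp
      moreover have "power_of_minus_one R (int (length F + j) + 1) =
          power_of_minus_one R (int (length F)) \<otimes> power_of_minus_one R (int j + 1)"
        by (simp add: add.assoc flip: power_of_minus_one_add)
      ultimately show ?thesis using N.smult_assoc1[OF s s N.finsum_closed[OF b[OF j]]] by simp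
    qed
    have "product (cobar_E R) S T m (n + 1) (basis_vector R F) (cobar_diff_basis R T n G) =
        (\<Oplus>\<^bsub>?N\<^esub>j\<in>{..<length G}. ?u j)"
      by (rule linear_map_cobar_diff_basis[OF ST(2) G module_cobar lin])
    then have "power_of_minus_one R (int (length F)) \<odot>\<^bsub>?N\<^esub>
        product (cobar_E R) S T m (n + 1) (basis_vector R F) (cobar_diff_basis R T n G) =
        (\<Oplus>\<^bsub>?N\<^esub>j\<in>{..<length G}. power_of_minus_one R (int (length F)) \<odot>\<^bsub>?N\<^esub> ?u j)"
      using N.finsum_smult_ldistr[OF _ s, of "{..<length G}" ?u] u by (simp add: Pi_iff)
    also have "\<dots> = (\<Oplus>\<^bsub>?N\<^esub>j\<in>{..<length G}. ?t (length F + j))"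
    proof (rule N.finsum_cong')
      fix j assume "j \<in> {..<length G}"
      then have "j < length G" by simp
      then show "power_of_minus_one R (int (length F)) \<odot>\<^bsub>?N\<^esub> ?u j = ?t (length F + j)" by (rule ut)
    qed (rule refl, intro Pi_I t, simp)
    also have "\<dots> = (\<Oplus>\<^bsub>?N\<^esub>i\<in>(+) (length F) ` {..<length G}. ?t i)"
      by (rule N.finsum_reindex[symmetric], rule tPi) auto
    also have "(+) (length F) ` {..<length G} = {length F..<length F + length G}"
      by (simp add: lessThan_atLeast0 add.commute)
    finally show ?thesis .
  qed
  have "cobar_diff_basis R (S \<union> T) (m + n) (F @ G) = (\<Oplus>\<^bsub>?N\<^esub>i\<in>{..<length F} \<union> {length F..<length F + length G}. ?t i)"
    by (simp only: cobar_diff_basis_def length_append ivl_disj_un_one(2) le_add1)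
  also have "\<dots> = (\<Oplus>\<^bsub>?N\<^esub>i\<in>{..<length F}. ?t i) \<oplus>\<^bsub>?N\<^esub> (\<Oplus>\<^bsub>?N\<^esub>i\<in>{length F..<length F + length G}. ?t i)"
    by (rule N.finsum_Un_disjoint, simp, simp, force, rule tPi, force, rule tPi, force)
  finally show ?thesis by (simp only: left right)
qed

text \<open>
  Apart from \<open>d d = 0\<close>, which is a statement on coefficients, every identity among the axioms is linear in each variable and is
  checked on basis elements.
\<close>

lemma dg_algebra_cobar_E: "dg_algebra_in_species R (cobar_E R :: ('x, 'a, 'x set list \<Rightarrow> 'a) dg_species_alg)"
proof (intro dg_algebra_in_species.intro dg_algebra_in_species_axioms.intro is_cring, unfold cobar_E_sel(1), goal_cases)
  case (1 I n)
  show ?case by (rule module_cobar)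
next
  case (2 I \<sigma> n)
  then show ?case by (rule cobar_transport_linear)
next
  case (3 I \<sigma> \<tau> x n)
  then have im: "\<sigma> ` I = \<tau> ` I" and inj: "inj_on \<tau> I" by (auto simp: inj_on_def)
  have eq: "map ((`) \<sigma>) F = map ((`) \<tau>) F" if F: "F \<in> compositions I n" for F
  proof (intro map_cong image_cong refl)
    fix B b assume "B \<in> set F" "b \<in> B"
    then have "b \<in> I" using F by (auto simp: compositions_def set_composition_def)
    then show "\<sigma> b = \<tau> b" by (rule 3(3))
  qed
  show ?case
  proof (rule cobar_eq_on_basis[OF 3(1) module_cobar cobar_transport_linear[OF 3(1,2)] _ _ 3(4)])
    show "transport (cobar_E R) \<tau> I n \<in> linear_maps R (cobar I n) (cobar (\<sigma> ` I) n)"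
      unfolding im by (rule cobar_transport_linear[OF 3(1) inj])
    fix F assume F: "F \<in> compositions I n"
    show "transport (cobar_E R) \<sigma> I n (basis_vector R F) = transport (cobar_E R) \<tau> I n (basis_vector R F)"
      unfolding cobar_transport_basis[OF 3(1,2) F] cobar_transport_basis[OF 3(1) inj F] eq[OF F] ..
  qed
next
  case (4 I x n)
  show ?case
  proof (rule cobar_eq_on_basis[OF 4(1) module_cobar _ linear_maps_id _ 4(2)])
    show "transport (cobar_E R) id I n \<in> linear_maps R (cobar I n) (cobar I n)"
      using cobar_transport_linear[OF 4(1), of id n] by simp
    show "transport (cobar_E R) id I n (basis_vector R F) = basis_vector R F" if "F \<in> compositions I n" for F
      using cobar_transport_basis[OF 4(1) inj_on_id that] by simp
  qed
next
  case (5 I \<sigma> \<tau> x n)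
  note inj = comp_inj_on[OF 5(2,3)]
  show ?case
  proof (rule cobar_eq_on_basis[OF 5(1) module_cobar cobar_transport_linear[OF 5(1) inj] _ _ 5(4)])
    show "(\<lambda>x. transport (cobar_E R) \<tau> (\<sigma> ` I) n (transport (cobar_E R) \<sigma> I n x))
        \<in> linear_maps R (cobar I n) (cobar ((\<tau> \<circ> \<sigma>) ` I) n)"
      using linear_maps_comp[OF cobar_transport_linear[OF 5(1,2)] cobar_transport_linear[OF _ 5(3)]] 5(1)
      by (simp add: image_comp)
    fix F assume F: "F \<in> compositions I n"
    have "map ((`) (\<tau> \<circ> \<sigma>)) F = map ((`) \<tau>) (map ((`) \<sigma>) F)" by (simp add: image_comp)
    then show "transport (cobar_E R) (\<tau> \<circ> \<sigma>) I n (basis_vector R F) =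
        transport (cobar_E R) \<tau> (\<sigma> ` I) n (transport (cobar_E R) \<sigma> I n (basis_vector R F))"
      using F 5 inj map_image_compositions[OF 5(2) F] by (simp add: cobar_transport_basis del: map_map)
  qed
next
  case (6 I n)
  then show ?case by (rule cobar_differential_linear)
next
  case (7 I \<sigma> x n)
  have fin: "finite (\<sigma> ` I)" using 7 by simp
  show ?case
  proof (rule cobar_eq_on_basis[OF 7(1) module_cobar _ _ _ 7(3)])
    show "(\<lambda>x. differential (cobar_E R) (\<sigma> ` I) n (transport (cobar_E R) \<sigma> I n x))
        \<in> linear_maps R (cobar I n) (cobar (\<sigma> ` I) (n + 1))"
      by (rule linear_maps_comp[OF cobar_transport_linear[OF 7(1,2)] cobar_differential_linear[OF fin]])
    show "(\<lambda>x. transport (cobar_E R) \<sigma> I (n + 1) (differential (cobar_E R) I n x))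
        \<in> linear_maps R (cobar I n) (cobar (\<sigma> ` I) (n + 1))"
      by (rule linear_maps_comp[OF cobar_differential_linear[OF 7(1)] cobar_transport_linear[OF 7(1,2)]])
    fix F assume F: "F \<in> compositions I n"
    then show "differential (cobar_E R) (\<sigma> ` I) n (transport (cobar_E R) \<sigma> I n (basis_vector R F)) =
        transport (cobar_E R) \<sigma> I (n + 1) (differential (cobar_E R) I n (basis_vector R F))"
      using 7 fin map_image_compositions[OF 7(2) F]
      by (simp only: cobar_transport_basis cobar_differential_basis cobar_transport_diff_basis)
  qed
next
  case (8 I x n)
  note x = cobar_closed[OF 8(2)]
  let ?dx = "\<lambda>w. if w \<in> compositions I (n + 1) then merge_sum x w else \<zero>"
  have dx: "?dx \<in> carrier (cobar I (n + 1))" by (rule restrict_compositions_closed) (use 8 x in auto)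
  have "merge_sum ?dx w = \<zero>" if w: "w \<in> compositions I (n + 1 + 1)" for w
  proof -
    have "merge_sum ?dx w = merge_sum (merge_sum x) w"
    proof (rule merge_sum_cong)
      fix u A B v assume "w = u @ A # B # v"
      then have "u @ (A \<union> B) # v \<in> compositions I (n + 1)"
        using w set_composition_merge_blocks(1)[of I u A B v]
        by (simp add: compositions_def del: set_composition_append)
      then show "?dx (u @ (A \<union> B) # v) = merge_sum x (u @ (A \<union> B) # v)" by simp
    qed
    then show ?thesis using x by (simp add: merge_sum_merge_sum)
  qed
  then show ?case
    unfolding cobar_differential_eq[OF 8] cobar_differential_eq[OF 8(1) dx] by (auto simp: cobar_comp_def)
next
  case (9 S T y n m)
  then show ?case by (rule cobar_product_linear_left)
next
  case (10 S T x m n)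
  then show ?case by (rule cobar_product_linear_right)
next
  case (11 S T \<sigma> x m y n)
  note ST = 11(1-3)
  have \<sigma>: "inj_on \<sigma> S" "inj_on \<sigma> T" "\<sigma> ` S \<inter> \<sigma> ` T = {}"
    using 11(3,4) by (auto simp: inj_on_def)
  have fin: "finite (S \<union> T)" "finite (\<sigma> ` S)" "finite (\<sigma> ` T)" using ST by auto
  have un: "\<sigma> ` (S \<union> T) = \<sigma> ` S \<union> \<sigma> ` T" by auto
  note tS = cobar_transport_linear[OF ST(1) \<sigma>(1)] and tT = cobar_transport_linear[OF ST(2) \<sigma>(2)]
    and tST = cobar_transport_linear[OF fin(1) 11(4)]
  show ?case
  proof (rule cobar_bilinear_eq_on_basis[OF ST(1,2) module_cobar _ _ _ _ _ 11(5,6)])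
    show "(\<lambda>x. transport (cobar_E R) \<sigma> (S \<union> T) (m + n) (product (cobar_E R) S T m n x y))
        \<in> linear_maps R (cobar S m) (cobar (\<sigma> ` (S \<union> T)) (m + n))" if "y \<in> carrier (cobar T n)" for y
      by (rule linear_maps_comp[OF cobar_product_linear_left[OF ST that] tST])
    show "(\<lambda>y. transport (cobar_E R) \<sigma> (S \<union> T) (m + n) (product (cobar_E R) S T m n x y))
        \<in> linear_maps R (cobar T n) (cobar (\<sigma> ` (S \<union> T)) (m + n))" if "x \<in> carrier (cobar S m)" for x
      by (rule linear_maps_comp[OF cobar_product_linear_right[OF ST that] tST])
    show "(\<lambda>x. product (cobar_E R) (\<sigma> ` S) (\<sigma> ` T) m n (transport (cobar_E R) \<sigma> S m x) (transport (cobar_E R) \<sigma> T n y))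
        \<in> linear_maps R (cobar S m) (cobar (\<sigma> ` (S \<union> T)) (m + n))" if "y \<in> carrier (cobar T n)" for y
      unfolding un
      by (rule linear_maps_comp[OF tS cobar_product_linear_left[OF fin(2,3) \<sigma>(3) linear_mapsD(1)[OF tT that]]])
    show "(\<lambda>y. product (cobar_E R) (\<sigma> ` S) (\<sigma> ` T) m n (transport (cobar_E R) \<sigma> S m x) (transport (cobar_E R) \<sigma> T n y))
        \<in> linear_maps R (cobar T n) (cobar (\<sigma> ` (S \<union> T)) (m + n))" if "x \<in> carrier (cobar S m)" for x
      unfolding un
      by (rule linear_maps_comp[OF tT cobar_product_linear_right[OF fin(2,3) \<sigma>(3) linear_mapsD(1)[OF tS that]]])
    fix F G assume F: "F \<in> compositions S m" and G: "G \<in> compositions T n"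
    show "transport (cobar_E R) \<sigma> (S \<union> T) (m + n) (product (cobar_E R) S T m n (basis_vector R F) (basis_vector R G)) =
        product (cobar_E R) (\<sigma> ` S) (\<sigma> ` T) m n (transport (cobar_E R) \<sigma> S m (basis_vector R F))
          (transport (cobar_E R) \<sigma> T n (basis_vector R G))"
      using F G append_compositions[OF ST F G] map_image_compositions[OF \<sigma>(1) F] map_image_compositions[OF \<sigma>(2) G]
        cobar_product_basis[OF fin(2,3) \<sigma>(3)] cobar_product_basis[OF ST] fin 11(4) ST \<sigma>
      by (simp add: cobar_transport_basis)
  qed
next
  case (12 S T U x m y n z p)
  note fin = 12(1-3) and ST = 12(1,2,4) and TU = 12(2,3,6)
  have STU: "finite (S \<union> T)" "finite U" "(S \<union> T) \<inter> U = {}" and STU': "finite S" "finite (T \<union> U)" "S \<inter> (T \<union> U) = {}"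
    using 12 by auto
  let ?N = "cobar (S \<union> T \<union> U) (m + n + p)"
  have N: "cobar (S \<union> (T \<union> U)) (m + (n + p)) = ?N" by (simp add: Un_assoc add.assoc)
  show ?case
  proof (rule cobar_eq_on_basis[OF fin(3) module_cobar _ _ _ 12(9)])
    show "(\<lambda>z. product (cobar_E R) (S \<union> T) U (m + n) p (product (cobar_E R) S T m n x y) z) \<in> linear_maps R (cobar U p) ?N"
      by (rule cobar_product_linear_right[OF STU cobar_product_closed[OF ST 12(7,8)]])
    show "(\<lambda>z. product (cobar_E R) S (T \<union> U) m (n + p) x (product (cobar_E R) T U n p y z)) \<in> linear_maps R (cobar U p) ?N"
      unfolding N[symmetric] by (rule linear_maps_comp[OF cobar_product_linear_right[OF TU 12(8)] cobar_product_linear_right[OF STU' 12(7)]])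
    fix H assume H: "H \<in> compositions U p"
    note h = cobar_basis_closed[OF H]
    show "product (cobar_E R) (S \<union> T) U (m + n) p (product (cobar_E R) S T m n x y) (basis_vector R H) =
        product (cobar_E R) S (T \<union> U) m (n + p) x (product (cobar_E R) T U n p y (basis_vector R H))"
    proof (rule cobar_bilinear_eq_on_basis[OF fin(1,2) module_cobar _ _ _ _ _ 12(7,8)])
      show "(\<lambda>x. product (cobar_E R) (S \<union> T) U (m + n) p (product (cobar_E R) S T m n x y) (basis_vector R H))
          \<in> linear_maps R (cobar S m) ?N" if "y \<in> carrier (cobar T n)" for y
        by (rule linear_maps_comp[OF cobar_product_linear_left[OF ST that] cobar_product_linear_left[OF STU h]])
      show "(\<lambda>y. product (cobar_E R) (S \<union> T) U (m + n) p (product (cobar_E R) S T m n x y) (basis_vector R H))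
          \<in> linear_maps R (cobar T n) ?N" if "x \<in> carrier (cobar S m)" for x
        by (rule linear_maps_comp[OF cobar_product_linear_right[OF ST that] cobar_product_linear_left[OF STU h]])
      show "(\<lambda>x. product (cobar_E R) S (T \<union> U) m (n + p) x (product (cobar_E R) T U n p y (basis_vector R H)))
          \<in> linear_maps R (cobar S m) ?N" if "y \<in> carrier (cobar T n)" for y
        unfolding N[symmetric] by (rule cobar_product_linear_left[OF STU' cobar_product_closed[OF TU that h]])
      show "(\<lambda>y. product (cobar_E R) S (T \<union> U) m (n + p) x (product (cobar_E R) T U n p y (basis_vector R H)))
          \<in> linear_maps R (cobar T n) ?N" if "x \<in> carrier (cobar S m)" for x
        unfolding N[symmetric] by (rule linear_maps_comp[OF cobar_product_linear_left[OF TU h] cobar_product_linear_right[OF STU' that]])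
      fix F G assume F: "F \<in> compositions S m" and G: "G \<in> compositions T n"
      show "product (cobar_E R) (S \<union> T) U (m + n) p
            (product (cobar_E R) S T m n (basis_vector R F) (basis_vector R G)) (basis_vector R H) =
          product (cobar_E R) S (T \<union> U) m (n + p) (basis_vector R F)
            (product (cobar_E R) T U n p (basis_vector R G) (basis_vector R H))"
        using cobar_product_basis[OF ST F G] cobar_product_basis[OF TU G H]
          cobar_product_basis[OF STU append_compositions[OF ST F G] H]
          cobar_product_basis[OF STU' F append_compositions[OF TU G H]] by simp
    qed
  qed
next
  case 13
  show ?case unfolding cobar_E_sel by (rule cobar_basis_closed) (simp add: compositions_empty)
next
  case 14
  have "[] \<in> compositions {} 0" by (simp add: compositions_empty)
  then have "differential (cobar_E R) {} 0 (basis_vector R []) = cobar_diff_basis R {} 0 []"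
    by (intro cobar_differential_basis) auto
  also have "\<dots> = \<zero>\<^bsub>cobar {} 1\<^esub>"
  proof -
    interpret M: module R "cobar {} 1" by (rule module_cobar)
    show ?thesis by (simp add: cobar_diff_basis_def)
  qed
  finally show ?case by (simp only: cobar_E_sel(5))
next
  case (15 I x n)
  have e: "[] \<in> compositions {} 0" by (simp add: compositions_empty)
  show ?case unfolding cobar_E_sel(5)
    using cobar_product_linear_right[OF _ 15(1) _ cobar_basis_closed[OF e], of n] cobar_product_basis[OF _ 15(1) _ e, of _ n]
    by (intro cobar_eq_on_basis[OF 15(1) module_cobar _ linear_maps_id _ 15(2)]) auto
next
  case (16 I x n)
  have e: "[] \<in> compositions {} 0" by (simp add: compositions_empty)
  show ?case unfolding cobar_E_sel(5)
    using cobar_product_linear_left[OF 16(1) _ _ cobar_basis_closed[OF e], of n] cobar_product_basis[OF 16(1) _ _ _ e, of _ n]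
    by (intro cobar_eq_on_basis[OF 16(1) module_cobar _ linear_maps_id _ 16(2)]) auto
next
  case (17 S T x m y n)
  note ST = 17(1-3)
  have fin: "finite (S \<union> T)" using ST by simp
  let ?N = "cobar (S \<union> T) (m + n + 1)" and ?s = "power_of_minus_one R (m + int (card S))"
  have s: "?s \<in> carrier R" using is_cring by simp
  have deg: "m + 1 + n = m + n + 1" "m + (n + 1) = m + n + 1" by auto
  note dS = cobar_differential_linear[OF ST(1)] and dT = cobar_differential_linear[OF ST(2)]
    and dST = cobar_differential_linear[OF fin]
  show ?case
  proof (rule cobar_bilinear_eq_on_basis[OF ST(1,2) module_cobar _ _ _ _ _ 17(4,5)])
    show "(\<lambda>x. differential (cobar_E R) (S \<union> T) (m + n) (product (cobar_E R) S T m n x y)) \<in> linear_maps R (cobar S m) ?N"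
      if "y \<in> carrier (cobar T n)" for y
      by (rule linear_maps_comp[OF cobar_product_linear_left[OF ST that] dST])
    show "(\<lambda>y. differential (cobar_E R) (S \<union> T) (m + n) (product (cobar_E R) S T m n x y)) \<in> linear_maps R (cobar T n) ?N"
      if "x \<in> carrier (cobar S m)" for x
      by (rule linear_maps_comp[OF cobar_product_linear_right[OF ST that] dST])
    show "(\<lambda>x. product (cobar_E R) S T (m + 1) n (differential (cobar_E R) S m x) y \<oplus>\<^bsub>?N\<^esub>
        ?s \<odot>\<^bsub>?N\<^esub> product (cobar_E R) S T m (n + 1) x (differential (cobar_E R) T n y)) \<in> linear_maps R (cobar S m) ?N"
      if y: "y \<in> carrier (cobar T n)" for y
      using linear_maps_comp[OF dS[of m] cobar_product_linear_left[OF ST y, of "m + 1"]]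
        cobar_product_linear_left[OF ST linear_mapsD(1)[OF dT y], of m]
      by (intro linear_maps_add linear_maps_smult module_cobar s) (simp_all only: deg)
    show "(\<lambda>y. product (cobar_E R) S T (m + 1) n (differential (cobar_E R) S m x) y \<oplus>\<^bsub>?N\<^esub>
        ?s \<odot>\<^bsub>?N\<^esub> product (cobar_E R) S T m (n + 1) x (differential (cobar_E R) T n y)) \<in> linear_maps R (cobar T n) ?N"
      if x: "x \<in> carrier (cobar S m)" for x
      using linear_maps_comp[OF dT[of n] cobar_product_linear_right[OF ST x, of "n + 1"]]
        cobar_product_linear_right[OF ST linear_mapsD(1)[OF dS x], of n]
      by (intro linear_maps_add linear_maps_smult module_cobar s) (simp_all only: deg)
    fix F G assume F: "F \<in> compositions S m" and G: "G \<in> compositions T n"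
    have "m + int (card S) = int (length F)" using F by (auto simp: compositions_def)
    then show "differential (cobar_E R) (S \<union> T) (m + n) (product (cobar_E R) S T m n (basis_vector R F) (basis_vector R G)) =
        product (cobar_E R) S T (m + 1) n (differential (cobar_E R) S m (basis_vector R F)) (basis_vector R G) \<oplus>\<^bsub>?N\<^esub>
        ?s \<odot>\<^bsub>?N\<^esub> product (cobar_E R) S T m (n + 1) (basis_vector R F) (differential (cobar_E R) T n (basis_vector R G))"
      using cobar_diff_basis_append[OF ST F G] cobar_differential_basis[OF fin append_compositions[OF ST F G]]
      by (simp only: cobar_product_basis[OF ST F G] cobar_differential_basis[OF ST(1) F] cobar_differential_basis[OF ST(2) G])
  qed
qed

end

section \<open>Exactness in negative degrees\<close>

context cring
begin

text \<open>
  Putting \<open>{a}\<close> in front anticommutes with the differential.  On a composition, no merge of the first block produces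
  \<open>{a}\<close>, since blocks are nonempty and disjoint.
\<close>

lemma merge_sum_prepend_singleton:
  assumes "\<And>v. q v \<in> carrier R" "set_composition I w"
  shows "merge_sum (\<lambda>v. if v \<noteq> [] \<and> hd v = {a} then q (tl v) else \<zero>) w =
    (if w \<noteq> [] \<and> hd w = {a} then \<ominus> merge_sum q (tl w) else \<zero>)"
proof (cases w)
  case w: (Cons A u)
  let ?q = "\<lambda>v. if v \<noteq> [] \<and> hd v = {a} then q (tl v) else \<zero>"
  have "merge_first ?q A u = \<zero>"
  proof (cases u)
    case (Cons B v)
    then have "A \<noteq> {}" "B \<noteq> {}" "A \<inter> B = {}" using assms(2) w by auto
    then have "A \<union> B \<noteq> {a}" by (auto simp: Un_singleton_iff)
    then show ?thesis using Cons by simp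
  qed simp
  moreover have "merge_sum (\<lambda>v. ?q (A # v)) u = (if A = {a} then merge_sum q u else \<zero>)"
    by (simp add: merge_sum_zero)
  ultimately show ?thesis using w assms(1) by (simp add: minus_eq)
qed simp

text \<open>
  The contraction onto compositions that start with \<open>{a}\<close> reduces a cocycle on \<open>insert a I\<close> to one on \<open>I\<close>
  of the same degree.  The empty set has only the empty composition, of degree 0, so the induction starts
  with zero modules.
\<close>

theorem cobar_exact:
  assumes "finite I" "n < 0" "f \<in> carrier (cobar I n)"
    and "\<And>w. w \<in> compositions I (n + 1) \<Longrightarrow> merge_sum f w = \<zero>"
  shows "\<exists>g\<in>carrier (cobar I (n - 1)). \<forall>w\<in>compositions I n. merge_sum g w = f w"
  using assms(1,3,4)
proof (induction I arbitrary: f)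
  case empty
  have "(\<lambda>w. if w \<in> compositions {} (n - 1) then \<zero> else \<zero>) \<in> carrier (cobar {} (n - 1))"
    by (rule restrict_compositions_closed) auto
  then show ?case using assms(2) by (auto simp: compositions_empty)
next
  case (insert a I)
  let ?J = "insert a I"
  note f = cobar_closed[OF insert.prems(1)]
  have merge: "u @ (A \<union> B) # v \<in> compositions K k"
    if "u @ A # B # v \<in> compositions K (k + 1)" for K u A B v k
    using that set_composition_merge_blocks(1)[of K u A B v]
    by (auto simp: compositions_def simp del: set_composition_append set_composition_Cons)
  have card: "int (card ?J) = int (card I) + 1" using insert.hyps by simp
  \<comment> \<open>the image of the cocycle \<open>f\<close> under deletion of \<open>{a}\<close>, again a cocycle\<close>
  define p where "p = (\<lambda>w. if w \<in> compositions I n then insert_sum a f w else \<zero>)"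
  have "p \<in> carrier (cobar I n)"
    unfolding p_def by (rule restrict_compositions_closed) (use f insert.hyps in auto)
  moreover have "merge_sum p w = \<zero>" if w: "w \<in> compositions I (n + 1)" for w
  proof -
    have "merge_sum p w = merge_sum (insert_sum a f) w"
    proof (rule merge_sum_cong)
      fix u A B v assume "w = u @ A # B # v"
      then have "u @ (A \<union> B) # v \<in> compositions I n" using w by (intro merge) simp
      then show "p (u @ (A \<union> B) # v) = insert_sum a f (u @ (A \<union> B) # v)" by (simp add: p_def)
    qed
    also have "\<dots> = \<ominus> insert_sum a (merge_sum f) w" using f by (simp add: insert_sum_merge_sum)
    also have "insert_sum a (merge_sum f) w = insert_sum a (\<lambda>_. \<zero>) w"
    proof (rule insert_sum_cong)
      fix u v assume "w = u @ v"
      then have "u @ {a} # v \<in> compositions ?J (n + 1)"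
        using w set_composition_insert_singleton[of I u v a] insert.hyps card
        by (auto simp: compositions_def simp del: set_composition_append set_composition_Cons)
      then show "merge_sum f (u @ {a} # v) = \<zero>" by (rule insert.prems(2))
    qed
    finally show ?thesis by (simp add: insert_sum_zero)
  qed
  ultimately obtain q where q: "q \<in> carrier (cobar I (n - 1))" "\<forall>w\<in>compositions I n. merge_sum q w = p w"
    using insert.IH by blast
  note q' = cobar_closed[OF q(1)]
  let ?sq = "\<lambda>v. if v \<noteq> [] \<and> hd v = {a} then q (tl v) else \<zero>"
  \<comment> \<open>the primitive \<open>h f - s q\<close>\<close>
  define g where "g = (\<lambda>w. if w \<in> compositions ?J (n - 1) then extract_sum a f w \<oplus> \<ominus> ?sq w else \<zero>)"
  have "g \<in> carrier (cobar ?J (n - 1))"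
    unfolding g_def by (rule restrict_compositions_closed) (use f q' insert.hyps in auto)
  moreover have "merge_sum g w = f w" if w: "w \<in> compositions ?J n" for w
  proof -
    have sc: "set_composition ?J w" using w by (auto simp: compositions_def)
    then have "w \<noteq> []" by auto
    have "merge_sum g w = merge_sum (\<lambda>w. extract_sum a f w \<oplus> \<ominus> ?sq w) w"
    proof (rule merge_sum_cong)
      fix u A B v assume "w = u @ A # B # v"
      then have "u @ (A \<union> B) # v \<in> compositions ?J (n - 1)" using w by (intro merge) simp
      then show "g (u @ (A \<union> B) # v) = extract_sum a f (u @ (A \<union> B) # v) \<oplus> \<ominus> ?sq (u @ (A \<union> B) # v)"
        by (simp add: g_def)
    qed
    also have "\<dots> = merge_sum (extract_sum a f) w \<oplus> \<ominus> merge_sum ?sq w"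
      using f q' by (simp add: merge_sum_add merge_sum_minus)
    \<comment> \<open>by the choice of \<open>q\<close> this is the correction term of the homotopy relation\<close>
    also have "merge_sum ?sq w = (if hd w = {a} then \<ominus> insert_sum a f (tl w) else \<zero>)"
    proof -
      have "merge_sum q (tl w) = insert_sum a f (tl w)" if "hd w = {a}"
      proof -
        have "w = {a} # tl w" using that \<open>w \<noteq> []\<close> by (metis list.collapse)
        moreover have "?J - {a} = I" using insert.hyps by auto
        ultimately have "set_composition I (tl w)" "length w = Suc (length (tl w))"
          using sc by (metis set_composition_Cons) (metis \<open>w = {a} # tl w\<close> length_Cons)
        then have "tl w \<in> compositions I n" using w card by (auto simp: compositions_def)
        then show ?thesis using q(2) by (simp add: p_def)
      qed
      then show ?thesis using merge_sum_prepend_singleton[of q ?J w a, OF q' sc] \<open>w \<noteq> []\<close> by simp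
    qed
    also have "merge_sum (extract_sum a f) w = f w \<oplus> \<ominus> (if hd w = {a} then insert_sum a f (tl w) else \<zero>)"
    proof -
      \<comment> \<open>extraction turns \<open>w\<close> into compositions of degree \<open>n + 1\<close>, where \<open>d f\<close> vanishes\<close>
      have "extract_sum a (merge_sum f) w = extract_sum a (\<lambda>_. \<zero>) w"
      proof (rule extract_sum_cong)
        fix u C v v' assume "w = u @ C # v @ v'" "a \<in> C" "C \<noteq> {a}"
        then have "u @ (C - {a}) # v @ {a} # v' \<in> compositions ?J (n + 1)"
          using w set_composition_extract[of ?J u C v v' a]
          by (auto simp: compositions_def simp del: set_composition_append set_composition_Cons)
        then show "merge_sum f (u @ (C - {a}) # v @ {a} # v') = \<zero>" by (rule insert.prems(2))
      qed
      then show ?thesis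
        using extract_sum_homotopy[of f ?J w a, OF f sc] f by (simp add: extract_sum_zero minus_eq)
    qed
    finally show ?thesis using f by (auto simp: a_assoc l_neg)
  qed
  ultimately show ?case by blast
qed

lemma nonpositive_dg_algebra_cobar_E:
  "nonpositive_dg_algebra R (cobar_E R :: ('x, 'a, 'x set list \<Rightarrow> 'a) dg_species_alg)"
proof (intro nonpositive_dg_algebra.intro dg_algebra_cobar_E nonpositive_dg_algebra_axioms.intro)
  fix I :: "'x set" and n :: int assume "finite I" "0 < n"
  then show "carrier (component (cobar_E R) I n) = {\<zero>\<^bsub>component (cobar_E R) I n\<^esub>}"
    by (auto simp: cobar_E_sel cobar_comp_def carrier_free_module compositions_positive_degree)
qed

lemma cobar_cocycles_eq_coboundaries:
  assumes "finite I" "n < 0"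
  shows "cocycles (cobar_E R) I n = coboundaries (cobar_E R) I n"
proof
  interpret X: dg_algebra_in_species R "cobar_E R" by (rule dg_algebra_cobar_E)
  show "coboundaries (cobar_E R) I n \<subseteq> cocycles (cobar_E R) I n"
    using assms(1) by (rule X.coboundaries_subset_cocycles)
  show "cocycles (cobar_E R) I n \<subseteq> coboundaries (cobar_E R) I n"
  proof
    fix f assume "f \<in> cocycles (cobar_E R) I n"
    then have f: "f \<in> carrier (cobar I n)" and df: "differential (cobar_E R) I n f = (\<lambda>w. \<zero>)"
      by (simp_all add: cocycles_def cobar_E_sel(1)) (simp add: cobar_comp_def)
    have "merge_sum f w = \<zero>" if "w \<in> compositions I (n + 1)" for w
      using fun_cong[OF df, of w] that by (simp add: cobar_differential_eq[OF assms(1) f])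
    then obtain g where g: "g \<in> carrier (cobar I (n - 1))" "\<forall>w\<in>compositions I n. merge_sum g w = f w"
      using cobar_exact[OF assms f] by blast
    have "f w = \<zero>" if "w \<notin> compositions I n" for w
      using that f by (auto simp: cobar_comp_def free_module_def)
    then have "differential (cobar_E R) I (n - 1) g = f"
      using g(2) by (auto simp: cobar_differential_eq[OF assms(1) g(1)])
    then show "f \<in> coboundaries (cobar_E R) I n"
      using g(1) by (auto simp: coboundaries_def cobar_E_sel(1))
  qed
qed

end

theorem theorem3p1:
  fixes R :: "('k, 'z) ring_scheme"
  assumes "cring R"
  shows "dg_algebra_quasi_iso R
    (cobar_E R :: ('a, 'k, 'a set list \<Rightarrow> 'k) dg_species_alg)
    (in_degree_zero (koszul_dual_E R))
    (cobar_projection R)"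
proof -
  interpret cring R by fact
  interpret X: nonpositive_dg_algebra R "cobar_E R :: ('a, 'k, 'a set list \<Rightarrow> 'k) dg_species_alg"
    by (rule nonpositive_dg_algebra_cobar_E)
  have "X.H0_projection = cobar_projection R"
    by (simp add: fun_eq_iff X.H0_projection_def cobar_projection_def koszul_dual_E_def cobar_E_sel(1))
  then show ?thesis
    using X.H0_projection_quasi_iso[OF cobar_cocycles_eq_coboundaries] by (simp add: koszul_dual_E_def)
qed

end
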